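(* Let $\mathbb{K}$ be an algebraically closed field, let $R=\mathbb{K}[s,t,u,v]$ be bigraded by $\deg s=\deg t=(1,0)$, $\deg u=\deg v=(0,1)$, let $a,b\geq 1$, and let $U\subseteq R_{a,b}=H^0(\mathcal{O}_{\mathbb{P}^1\times\mathbb{P}^1}(a,b))$ be a four-dimensional basepoint free subspace with basis $\{p_0,p_1,p_2,p_3\}$ and ideal $I_U=(p_0,p_1,p_2,p_3)$. Assume that $I_U$ has a nonzero syzygy $S$ of bidegree $(0,n)$, that $I_U$ has no nonzero syzygy of bidegree $(0,m)$ with $m<n$, and that $b\geq 2n-1$. Let $V\subseteq U$ be the subspace associated to $S$. (i) If $\dim V=2$, then $I_U$ has syzygies $S_1$ and $S_2$ of bidegree $(a,b-n)$ such that $\dim_{\mathbb{K}}\langle S,S_1,S_2\rangle_{2a-1,b-1}=2ab$. (ii) If $\dim V=3$, then $I_U$ has syzygies $S_1$ of bidegree $(a,b-n)$, $S_2$ of bidegree $(a,b-n+\mu)$, and $S_3$ of bidegree $(a,b-\mu)$, for some integer $\mu$, such that $\dim_{\mathbb{K}}\langle S,S_1,S_2,S_3\rangle_{2a-1,b-1}=2ab$. (iii) If $\dim V=4$, then $I_U$ has syzygies $S_1$ of bidegree $(a,b-n+\mu_1)$, $S_2$ of bidegree $(a,b-n+\mu_2)$, and $S_3$ of bidegree $(a,b-\mu_1-\mu_2)$, for some integers $\mu_1,\mu_2$, such that $\dim_{\mathbb{K}}\langle S,S_1,S_2,S_3\rangle_{2a-1,b-1}=2ab$. In each case, the first differential $d_1$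 of the strand $\mathcal{Z}_{2a-1,b-1}$ of the approximation complex of $p_0,p_1,p_2,p_3$ is determined by these syzygies. Moreover, the determinant of a $2ab\times 2ab$ matrix representation of $d_1$ in this bidegree is (up to a nonzero scalar of $\mathbb{K}$) a power of the implicit equation of $X_U$.
   Context: $R_{c,d}$ denotes the bidegree $(c,d)$ component of $R$. $U$ is basepoint free if $p_0,\dots,p_3$ have no common zero on $\mathbb{P}^1\times\mathbb{P}^1$ (equivalently $\sqrt{I_U}=(s,t)\cap(u,v)$). Then $p_0,\dots,p_3$ define a regular map $\phi_U:\mathbb{P}^1\times\mathbb{P}^1\to\mathbb{P}^3$ with image the surface $X_U$; the implicit equation of $X_U$ is the irreducible polynomial $F\in\mathbb{K}[y_0,y_1,y_2,y_3]$ (unique up to scalar) generating the ideal of $X_U$. A syzygy of $I_U$ is a column $(c_0,c_1,c_2,c_3)^T\in R^4$ with $\sum_i c_ip_i=0$; it has bidegree $(c,d)$ if all its entries lie in $R_{c,d}$. The module of syzygies $\mathrm{syz}(I_U)\subseteq R^4$ is bigraded by the bidegree of entries. For syzygies $T_1,\dots,T_k$, $\langle T_1,\dots,T_k\rangle\subseteq R^4$ is the $R$-submodule they generate and $\langle T_1,\dots,T_k\rangle_{c,d}$ is its component consisting of columns with entries in $R_{c,d}$. Subspace $V$ associated to $S$: write the $i$th entry of $S$ as $\sum_{j=0}^n a_{ij}u^{n-j}v^j$ with $a_{ij}\in\mathbb{K}$, $0\le i\le 3$. Put $f_j=\sum_{i=0}^3a_{ij}p_i\in U$ for $0\le j\le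 n$, and $V=\mathrm{Span}_{\mathbb{K}}\{f_0,\dots,f_n\}\subseteq U$. Approximation complex: with $Z_i$ the module of $i$-cycles of the Koszul complex of $p_0,\dots,p_3$ over $R$, $\mathcal{Z}_i=\mathbb{K}[y_0,\dots,y_3]\otimes_{\mathbb{K}}Z_i$, and the differentials are those of the Koszul complex on $y_0,\dots,y_3$. In particular $\mathcal{Z}_0=\mathbb{K}[y_0,\dots,y_3]\otimes_{\mathbb K} R$, $\mathcal{Z}_1=\mathbb{K}[y_0,\dots,y_3]\otimes_{\mathbb K}\mathrm{syz}(I_U)$, and $d_1(c_0,c_1,c_2,c_3)=c_0y_0+c_1y_1+c_2y_2+c_3y_3$. The strand $\mathcal{Z}_{2a-1,b-1}$ is the bidegree $(2a-1,b-1)$ part with respect to the bigrading of $R$; it is a complex of free $\mathbb{K}[y_0,\dots,y_3]$-modules, with $d_1:\mathbb{K}[y_0,\dots,y_3]\otimes_{\mathbb K}\mathrm{syz}(I_U)_{2a-1,b-1}\to\mathbb{K}[y_0,\dots,y_3]\otimes_{\mathbb K} R_{2a-1,b-1}$. That $d_1$ is determined by the given syzygies means that the component of bidegree $(2a-1,b-1)$ of the submodule generated by those syzygies is all of $\mathrm{syz}(I_U)_{2a-1,b-1}$, so a matrix of $d_1$ is obtained from monomial multiples of those syzygies. *)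

theory Defs
  imports
    "HOL-Library.Poly_Mapping"
    "HOL-Computational_Algebra.Polynomial"
    "HOL-Analysis.Finite_Cartesian_Product"
    "Jordan_Normal_Form.Determinant"
begin

no_notation Matrix.vec_index (infixl \<open>$\<close> 100)

section \<open>Multivariate polynomials\<close>

text \<open>
  A monomial is a finitely supported exponent function, a polynomial a finitely supported
  coefficient function on monomials.
\<close>

type_synonym ('v, 'k) mpoly = "('v \<Rightarrow>\<^sub>0 nat) \<Rightarrow>\<^sub>0 'k"

abbreviation const_mp :: "'k::comm_ring_1 \<Rightarrow> ('v, 'k) mpoly" where
  "const_mp \<equiv> Poly_Mapping.single 0"

abbreviation var_mp :: "'v \<Rightarrow> ('v, 'k::comm_ring_1) mpoly" where
  "var_mp i \<equiv> Poly_Mapping.single (Poly_Mapping.single i 1) 1"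

definition eval_mp :: "('v \<Rightarrow> 'k) \<Rightarrow> ('v, 'k::comm_ring_1) mpoly \<Rightarrow> 'k" where
  "eval_mp x f = (\<Sum>m\<in>Poly_Mapping.keys f.
     Poly_Mapping.lookup f m * (\<Prod>i\<in>Poly_Mapping.keys m. x i ^ Poly_Mapping.lookup m i))"

definition (in Modules.module) ordered_basis :: "'b list \<Rightarrow> 'b set \<Rightarrow> bool" where
  "ordered_basis bs M \<longleftrightarrow> distinct bs \<and> independent (set bs) \<and> span (set bs) = M"


section \<open>The bigraded ring \<open>R = K[s,t,u,v]\<close>\<close>

datatype bivar = Vs | Vt | Vu | Vv

type_synonym 'k R = "(bivar, 'k) mpoly"

text \<open>Bidegrees are integers, so that components of negative bidegree are zero.\<close>

definition bihom :: "int \<Rightarrow> int \<Rightarrow> 'k::comm_ring_1 R set" where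
  "bihom c d = {f. \<forall>m\<in>Poly_Mapping.keys f.
     int (Poly_Mapping.lookup m Vs + Poly_Mapping.lookup m Vt) = c \<and>
     int (Poly_Mapping.lookup m Vu + Poly_Mapping.lookup m Vv) = d}"

definition bihom4 :: "int \<Rightarrow> int \<Rightarrow> ('k::comm_ring_1 R ^ 4) set" where
  "bihom4 c d = {x. \<forall>i. x $ i \<in> bihom c d}"

lemma const_mp_mult: "const_mp (c * d) = const_mp c * const_mp d"
  by (simp add: mult_single)

global_interpretation KR: vector_space "\<lambda>(c::'k::field) (f::'k R). const_mp c * f"
  by unfold_locales
    (simp_all only: distrib_left distrib_right mult.assoc mult_1_left
      single_add const_mp_mult single_one
      simp_thms)

global_interpretation KR4: vector_space "\<lambda>(c::'k::field) (x::'k R ^ 4). const_mp c *s x"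
  by unfold_locales
    (simp_all only: Finite_Cartesian_Product.vec_eq_iff vector_smult_component vector_add_component
      distrib_left distrib_right mult.assoc mult_1_left
      single_add const_mp_mult single_one
      simp_thms)

global_interpretation RR4: Modules.module "\<lambda>(f::'k::field R) (x::'k R ^ 4). f *s x"
  by unfold_locales
    (simp_all only: Finite_Cartesian_Product.vec_eq_iff vector_smult_component vector_add_component
      distrib_left distrib_right mult.assoc mult_1_left
      simp_thms)


section \<open>Syzygies, base points, and the subspace associated to a syzygy\<close>

definition syz :: "'k::field R ^ 4 \<Rightarrow> ('k R ^ 4) set" where
  "syz p = {c. (\<Sum>i\<in>UNIV. c $ i * p $ i) = 0}"

text \<open>Homogeneous coordinates of the points of \<open>P\<^sup>1 \<times> P\<^sup>1\<close>.\<close>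

definition biproj_coords :: "(bivar \<Rightarrow> 'k::field) set" where
  "biproj_coords = {x. (x Vs \<noteq> 0 \<or> x Vt \<noteq> 0) \<and> (x Vu \<noteq> 0 \<or> x Vv \<noteq> 0)}"

definition basepoint_free :: "'k::field R ^ 4 \<Rightarrow> bool" where
  "basepoint_free p \<longleftrightarrow> \<not> (\<exists>x\<in>biproj_coords. \<forall>i. eval_mp x (p $ i) = 0)"

text \<open>
  For \<open>S\<close> of bidegree \<open>(0, n)\<close>, the form \<open>f\<^sub>j = \<Sum>\<^sub>i a\<^sub>i\<^sub>j p\<^sub>i\<close> in which \<open>a\<^sub>i\<^sub>j\<close> is the
  coefficient of \<open>u\<^bsup>n-j\<^esup>v\<^sup>j\<close> in the \<open>i\<close>th entry of \<open>S\<close>.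
\<close>

definition assoc_form :: "'k::field R ^ 4 \<Rightarrow> nat \<Rightarrow> 'k R ^ 4 \<Rightarrow> nat \<Rightarrow> 'k R" where
  "assoc_form p n S j =
     (\<Sum>i\<in>UNIV. const_mp (Poly_Mapping.lookup (S $ i)
        (Poly_Mapping.single Vu (n - j) + Poly_Mapping.single Vv j)) * p $ i)"

definition assoc_subspace :: "'k::field R ^ 4 \<Rightarrow> nat \<Rightarrow> 'k R ^ 4 \<Rightarrow> 'k R set" where
  "assoc_subspace p n S = KR.span (assoc_form p n S ` {0..n})"


section \<open>The implicit equation\<close>

type_synonym 'k Y = "(4, 'k) mpoly"

text \<open>
  The surface \<open>X\<^sub>U\<close> is given by the set of all homogeneous coordinates of its points.  This set
  is closed under nonzero scalars, so over an infinite field a polynomial vanishes on it iff each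
  of its homogeneous components does; the polynomials vanishing on it are the homogeneous ideal
  of \<open>X\<^sub>U\<close>.
\<close>

definition image_coords :: "'k::field R ^ 4 \<Rightarrow> (4 \<Rightarrow> 'k) set" where
  "image_coords p = {y. \<exists>x\<in>biproj_coords. \<exists>r. r \<noteq> 0 \<and> (\<forall>i. y i = r * eval_mp x (p $ i))}"

definition vanishing_ideal :: "(4 \<Rightarrow> 'k::field) set \<Rightarrow> 'k Y set" where
  "vanishing_ideal X = {G. \<forall>y\<in>X. eval_mp y G = 0}"

definition implicit_equation :: "'k::field R ^ 4 \<Rightarrow> 'k Y \<Rightarrow> bool" where
  "implicit_equation p F \<longleftrightarrow>
     Factorial_Ring.irreducible F \<and> vanishing_ideal (image_coords p) = {G. F dvd G}"


section \<open>The first differential of the approximation complex\<close>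

text \<open>
  \<open>K[y\<^sub>0,\<dots>,y\<^sub>3] \<otimes> R\<close> is modelled as the ring of polynomials in \<open>y\<^sub>0,\<dots>,y\<^sub>3\<close> with coefficients
  in \<open>R\<close>, and for a \<open>K\<close>-subspace \<open>M\<close> of \<open>R\<^sup>4\<close>, the tensor product \<open>K[y\<^sub>0,\<dots>,y\<^sub>3] \<otimes> M\<close> as the
  vectors of such polynomials whose coefficient vectors all lie in \<open>M\<close>.
\<close>

type_synonym 'k YR = "(4, 'k R) mpoly"

definition incl_Y :: "'k::field Y \<Rightarrow> 'k YR" where
  "incl_Y q = Poly_Mapping.map const_mp q"

lemma lookup_incl_Y: "Poly_Mapping.lookup (incl_Y q) m = const_mp (Poly_Mapping.lookup q m)"
  unfolding incl_Y_def by transfer (simp add: when_def)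

lemma incl_Y_0: "incl_Y 0 = 0"
  by (rule poly_mapping_eqI) (simp add: lookup_incl_Y)

lemma incl_Y_add: "incl_Y (q + r) = incl_Y q + incl_Y r"
  by (rule poly_mapping_eqI) (simp add: lookup_incl_Y lookup_add single_add)

lemma incl_Y_single: "incl_Y (Poly_Mapping.single m c) = Poly_Mapping.single m (const_mp c)"
  by (rule poly_mapping_eqI) (simp add: lookup_incl_Y lookup_single when_def)

lemma incl_Y_1: "incl_Y 1 = 1"
  using incl_Y_single[of 0 1] by simp

lemma mpoly_induct:
  assumes "P 0" and "\<And>f m c. P f \<Longrightarrow> P (f + Poly_Mapping.single m c)"
  shows "P f"
proof (induction f rule: update_induct)
  case const
  show ?case by (fact assms(1))
next
  case (update f a b)
  then have "Poly_Mapping.update a b f = f + Poly_Mapping.single a b"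
    by (intro poly_mapping_eqI)
      (metis add.left_neutral add.right_neutral lookup_add lookup_single_eq
        lookup_single_not_eq lookup_update not_in_keys_iff_lookup_eq_zero)
  with update assms(2) show ?case by simp
qed

lemma incl_Y_mult: "incl_Y (q * r) = incl_Y q * incl_Y r"
proof -
  have "incl_Y (Poly_Mapping.single k c * r) = incl_Y (Poly_Mapping.single k c) * incl_Y r" for k c
    by (induction r rule: mpoly_induct)
      (simp_all only: incl_Y_0 incl_Y_add incl_Y_single distrib_left mult_single const_mp_mult
        mult_zero_right)
  then show ?thesis
    by (induction q rule: mpoly_induct) (simp_all add: incl_Y_0 incl_Y_add distrib_right)
qed

global_interpretation YZ0: Modules.module "\<lambda>(q::'k::field Y) (h::'k YR). incl_Y q * h"
  by unfold_locales
    (simp_all only: distrib_left distrib_right mult.assoc mult_1_left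
      incl_Y_add incl_Y_mult incl_Y_1
      simp_thms)

global_interpretation YZ1: Modules.module "\<lambda>(q::'k::field Y) (z::'k YR ^ 4). incl_Y q *s z"
  by unfold_locales
    (simp_all only: Finite_Cartesian_Product.vec_eq_iff vector_smult_component vector_add_component
      distrib_left distrib_right mult.assoc mult_1_left
      incl_Y_add incl_Y_mult incl_Y_1
      simp_thms)

definition Z0_strand :: "int \<Rightarrow> int \<Rightarrow> 'k::field YR set" where
  "Z0_strand c d = {h. \<forall>m. Poly_Mapping.lookup h m \<in> bihom c d}"

definition Z1_strand :: "'k::field R ^ 4 \<Rightarrow> int \<Rightarrow> int \<Rightarrow> ('k YR ^ 4) set" where
  "Z1_strand p c d = {z. \<forall>m. (\<chi> i. Poly_Mapping.lookup (z $ i) m) \<in> syz p \<inter> bihom4 c d}"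

definition d1 :: "'k::field YR ^ 4 \<Rightarrow> 'k YR" where
  "d1 z = (\<Sum>i\<in>UNIV. z $ i * var_mp i)"

text \<open>
  The bases of the two free \<open>K[y\<^sub>0,\<dots>,y\<^sub>3]\<close>-modules are arbitrary; since the units of
  \<open>K[y\<^sub>0,\<dots>,y\<^sub>3]\<close> are the nonzero constants, the determinant of a square matrix of \<open>d1\<close> does
  not depend on them up to a nonzero scalar.
\<close>

definition d1_matrix :: "'k::field R ^ 4 \<Rightarrow> int \<Rightarrow> int \<Rightarrow> 'k Y mat \<Rightarrow> bool" where
  "d1_matrix p c d M \<longleftrightarrow> (\<exists>es gs.
     YZ1.ordered_basis es (Z1_strand p c d) \<and>
     YZ0.ordered_basis gs (Z0_strand c d) \<and>
     M \<in> carrier_mat (length gs) (length es) \<and>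
     (\<forall>j<length es. d1 (es ! j) = (\<Sum>i<length gs. incl_Y (M $$ (i, j)) * gs ! i)))"

text \<open>
  The strand of \<open>Z\<^sub>1\<close> is \<open>K[y\<^sub>0,\<dots>,y\<^sub>3] \<otimes> (syz p \<inter> bihom4 c d)\<close>, so \<open>d1\<close> is determined by \<open>T\<close> in
  bidegree \<open>(c, d)\<close> when the submodule generated by \<open>T\<close> contains all syzygies of that bidegree.
\<close>

definition determines_d1 :: "'k::field R ^ 4 \<Rightarrow> int \<Rightarrow> int \<Rightarrow> ('k R ^ 4) set \<Rightarrow> bool" where
  "determines_d1 p c d T \<longleftrightarrow> RR4.span T \<inter> bihom4 c d = syz p \<inter> bihom4 c d"

end

theory Submission
  imports Defs "HOL-Analysis.Determinants" "Berlekamp_Zassenhaus.Unique_Factorization_Poly"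
begin

text \<open>
  Restricted to the second projective line, the entries of \<open>S\<close> form a vector of polynomials in
  \<open>x = v/u\<close>; since \<open>n\<close> is minimal, they have no common zero, not even at \<open>x = \<infinity>\<close>.  The vectors
  orthogonal to \<open>S\<close> are therefore the kernel of a surjection from the trivial bundle of rank 4 to
  \<open>O(n)\<close>, and this kernel splits: it has free generators \<open>Q\<^sub>1, Q\<^sub>2, Q\<^sub>3\<close> of degrees
  \<open>\<mu>\<^sub>1 \<le> \<mu>\<^sub>2 \<le> \<mu>\<^sub>3\<close> with sum \<open>n\<close> (\<open>minimal_basis_exists\<close>).  As \<open>p\<close> is orthogonal to \<open>S\<close>, it is a
  combination \<open>p = g\<^sub>1 Q\<^sub>1 + g\<^sub>2 Q\<^sub>2 + g\<^sub>3 Q\<^sub>3\<close> with \<open>g\<^sub>i\<close> of bidegree \<open>(a, b - \<mu>\<^sub>i)\<close>, and the \<open>g\<^sub>i\<close> again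
  have no common zero.

  A vector \<open>C\<close> is a syzygy of \<open>p\<close> iff \<open>(C\<cdot>Q\<^sub>1, C\<cdot>Q\<^sub>2, C\<cdot>Q\<^sub>3)\<close> is a syzygy of \<open>(g\<^sub>1, g\<^sub>2, g\<^sub>3)\<close>.  For three
  forms without common zero, every syzygy in the relevant bidegree is a combination of the Koszul
  syzygies (\<open>koszul_exact\<close>).  The three Koszul syzygies lift to syzygies \<open>S\<^sub>1, S\<^sub>2, S\<^sub>3\<close> of \<open>p\<close> of
  bidegree \<open>(a, b - n + \<mu>\<^sub>i)\<close>: the obstruction lies in \<open>H\<^sup>1(O(b - 2n + \<mu>\<^sub>i))\<close>, which vanishes because
  \<open>b \<ge> 2n - 1\<close>.  The kernel of the map from \<open>C\<close> to its products with the \<open>Q\<^sub>i\<close> consists of the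
  multiples of \<open>S\<close>.  Hence in bidegree \<open>(2a - 1, b - 1)\<close> the syzygies of \<open>p\<close> are uniquely
  \<open>\<beta> S + \<alpha>\<^sub>1 S\<^sub>1 + \<alpha>\<^sub>2 S\<^sub>2 + \<alpha>\<^sub>3 S\<^sub>3\<close> with \<open>\<beta>\<close> of bidegree \<open>(2a - 1, b - n - 1)\<close> and \<open>\<alpha>\<^sub>i\<close> of bidegree
  \<open>(a - 1, n - \<mu>\<^sub>i - 1)\<close> (\<open>koszul_lifts\<close>, \<open>syzygy_structure\<close>), and they have dimension
  \<open>2a(b - n) + a(3n - \<mu>\<^sub>1 - \<mu>\<^sub>2 - \<mu>\<^sub>3) = 2ab\<close>.  The constant vectors orthogonal to \<open>S\<close> are the
  linear functionals on \<open>U\<close> that vanish on \<open>V\<close>, and they are the combinations of the \<open>Q\<^sub>i\<close> of degree 0;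
  so \<open>4 - dim V\<close> of the \<open>\<mu>\<^sub>i\<close> are zero, which distinguishes the three cases.  If \<open>\<mu>\<^sub>1 = \<mu>\<^sub>2 = 0\<close>, then
  \<open>\<alpha>\<^sub>3\<close> has negative degree, hence is zero, and \<open>S, S\<^sub>1, S\<^sub>2\<close> suffice.

  For the determinant, let \<open>y\<close> be a nonzero point of the affine 4-space.  If \<open>y\<close> is on the cone over
  \<open>X\<^sub>U\<close>, with preimage \<open>x\<close>, then every element of the image of \<open>d1\<close> at \<open>y\<close> vanishes at \<open>x\<close>, so the
  determinant vanishes at \<open>y\<close> (\<open>det_vanishes_on_image\<close>).  If not, then the three forms
  \<open>p\<^sub>i - (y\<^sub>i / y\<^sub>j) p\<^sub>j\<close> have no common zero; a kernel element of \<open>d1\<close> at \<open>y\<close> would be a syzygy of them in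
  bidegree \<open>(2a - 1, b - 1)\<close>, and Koszul exactness excludes this (\<open>contraction_injective\<close>).  So the
  zero set of the determinant is the cone over \<open>X\<^sub>U\<close>.  A count of monomials yields a point off \<open>X\<^sub>U\<close>,
  hence the determinant is not the zero polynomial.  By the Nullstellensatz for hypersurfaces every
  irreducible factor of the determinant divides all polynomials that vanish on \<open>X\<^sub>U\<close>.  One factor
  vanishes on \<open>X\<^sub>U\<close>, because the ideal of \<open>X\<^sub>U\<close> is prime; this factor is the implicit equation, and
  all other factors are associated to it.
\<close>

no_notation Matrix.vec_index (infixl \<open>$\<close> 100)

lemmas vec_ext_iff = Finite_Cartesian_Product.vec_eq_iff

section \<open>Polynomials in two variables and their fibres\<close>

lemma infinite_UNIV_alg_closed: "infinite (UNIV :: 'k::alg_closed_field set)"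
proof
  assume fin: "finite (UNIV :: 'k set)"
  define q :: "'k poly" where "q = (\<Prod>x\<in>UNIV. [:-x, 1:]) + 1"
  have "degree (\<Prod>x\<in>(UNIV::'k set). [:-x, 1:]) = card (UNIV :: 'k set)"
    by (subst degree_prod_eq_sum_degree) auto
  moreover have "card (UNIV :: 'k set) > 0"
    using fin by (simp add: card_gt_0_iff)
  ultimately have "degree q > 0"
    unfolding q_def by (subst degree_add_eq_left) auto
  then obtain z where "poly q z = 0"
    using alg_closed_imp_poly_has_root by blast
  moreover have "poly q z = 1"
    unfolding q_def using fin by (simp add: poly_prod)
  ultimately show False by simp
qed

lemma nonroot_exists:
  fixes q :: "'k::alg_closed_field poly"
  assumes "q \<noteq> 0"
  shows "\<exists>x. poly q x \<noteq> 0"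
  using poly_roots_finite[OF assms] infinite_UNIV_alg_closed
  by (metis (mono_tags, lifting) UNIV_eq_I mem_Collect_eq)

text \<open>
  An element of \<open>K[x][t]\<close> is viewed as a form on \<open>P\<^sup>1 \<times> P\<^sup>1\<close>, dehomogenized by \<open>s = u = 1\<close>: the outer
  variable \<open>t\<close> belongs to the first factor and the inner variable \<open>x = v\<close> to the second.  The bounds
  are integers so that, as for forms, a negative one leaves only zero.
\<close>

definition bideg_le :: "int \<Rightarrow> int \<Rightarrow> 'k::zero poly poly \<Rightarrow> bool" where
  "bideg_le c d f \<longleftrightarrow> (\<forall>i j. coeff (coeff f i) j \<noteq> 0 \<longrightarrow> int i \<le> c \<and> int j \<le> d)"

lemma bideg_leD: "bideg_le c d f \<Longrightarrow> coeff (coeff f i) j \<noteq> 0 \<Longrightarrow> int i \<le> c \<and> int j \<le> d"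
  by (auto simp: bideg_le_def)

lemma bideg_le_mono: "bideg_le c d f \<Longrightarrow> c \<le> c' \<Longrightarrow> d \<le> d' \<Longrightarrow> bideg_le c' d' f"
  unfolding bideg_le_def by (meson order_trans)

lemma bideg_le_0 [simp]: "bideg_le c d 0"
  by (simp add: bideg_le_def)

lemma bideg_le_add: "bideg_le c d f \<Longrightarrow> bideg_le c d g \<Longrightarrow> bideg_le c d (f + g)"
  by (auto simp: bideg_le_def) (metis add_0)+

lemma bideg_le_uminus: "bideg_le c d f \<Longrightarrow> bideg_le c d (- f)" for f :: "'k::ab_group_add poly poly"
  by (auto simp: bideg_le_def)

lemma bideg_le_diff: "bideg_le c d f \<Longrightarrow> bideg_le c d g \<Longrightarrow> bideg_le c d (f - g)" for f :: "'k::ab_group_add poly poly"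
  using bideg_le_add[of c d f "- g"] bideg_le_uminus[of c d g] by simp

lemma bideg_le_sum: "(\<And>i. i \<in> A \<Longrightarrow> bideg_le c d (f i)) \<Longrightarrow> bideg_le c d (sum f A)"
  by (induction A rule: infinite_finite_induct) (auto intro: bideg_le_add)

lemma bideg_le_mult:
  fixes f g :: "'k::comm_semiring_0 poly poly"
  assumes "bideg_le c d f" "bideg_le c' d' g"
  shows "bideg_le (c + c') (d + d') (f * g)"
  unfolding bideg_le_def
proof (intro allI impI)
  fix i j assume "coeff (coeff (f * g) i) j \<noteq> 0"
  then have "(\<Sum>k\<le>i. coeff (coeff f k * coeff g (i - k)) j) \<noteq> 0"
    by (simp add: coeff_mult coeff_sum)
  then obtain k where k: "k \<le> i" "coeff (coeff f k * coeff g (i - k)) j \<noteq> 0"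
    by (metis (no_types, lifting) atMost_iff sum.neutral)
  then have "(\<Sum>l\<le>j. coeff (coeff f k) l * coeff (coeff g (i - k)) (j - l)) \<noteq> 0"
    by (simp add: coeff_mult)
  then obtain l where l: "l \<le> j" "coeff (coeff f k) l * coeff (coeff g (i - k)) (j - l) \<noteq> 0"
    by (metis (no_types, lifting) atMost_iff sum.neutral)
  then have "coeff (coeff f k) l \<noteq> 0" "coeff (coeff g (i - k)) (j - l) \<noteq> 0"
    by auto
  then have "int k \<le> c \<and> int l \<le> d" "int (i - k) \<le> c' \<and> int (j - l) \<le> d'"
    using assms by (auto simp: bideg_le_def)
  then show "int i \<le> c + c' \<and> int j \<le> d + d'" using k l by linarith
qed

lemma bideg_le_iff_degree: "bideg_le (int c) d f \<longleftrightarrow> degree f \<le> c \<and> (\<forall>i j. coeff (coeff f i) j \<noteq> 0 \<longrightarrow> int j \<le> d)"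
proof
  assume "bideg_le (int c) d f"
  then show "degree f \<le> c \<and> (\<forall>i j. coeff (coeff f i) j \<noteq> 0 \<longrightarrow> int j \<le> d)"
    by (auto simp: bideg_le_def intro!: degree_le) (metis leD le_degree leading_coeff_neq_0 not_less coeff_0 poly_eqI)
next
  assume a: "degree f \<le> c \<and> (\<forall>i j. coeff (coeff f i) j \<noteq> 0 \<longrightarrow> int j \<le> d)"
  show "bideg_le (int c) d f" unfolding bideg_le_def
  proof (intro allI impI)
    fix i j assume *: "coeff (coeff f i) j \<noteq> 0"
    then have "coeff f i \<noteq> 0" by auto
    then have "i \<le> c" using a le_degree order_trans by blast
    then show "int i \<le> int c \<and> int j \<le> d" using a * by auto
  qed
qed

definition fibre :: "'k::comm_ring_1 \<Rightarrow> 'k poly poly \<Rightarrow> 'k poly" where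
  "fibre x f = map_poly (\<lambda>q. poly q x) f"

lemma coeff_fibre [simp]: "coeff (fibre x f) i = poly (coeff f i) x"
  by (simp add: fibre_def coeff_map_poly)

lemma fibre_0 [simp]: "fibre x 0 = 0" by (simp add: fibre_def)

lemma fibre_add [simp]: "fibre x (f + g) = fibre x f + fibre x g"
  by (rule poly_eqI) simp

lemma fibre_diff [simp]: "fibre x (f - g) = fibre x f - fibre x g"
  by (rule poly_eqI) simp

lemma fibre_mult [simp]: "fibre x (f * g) = fibre x f * fibre x g"
  by (rule poly_eqI) (simp add: coeff_mult poly_sum)

lemma fibre_smult [simp]: "fibre x (smult D f) = smult (poly D x) (fibre x f)"
  by (rule poly_eqI) simp

lemma degree_fibre_le: "degree (fibre x f) \<le> degree f"
  by (rule degree_le) (simp add: coeff_eq_0)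

text \<open>
  The fibre over \<open>x = \<infinity>\<close> of a form of degree \<open>m\<close> in \<open>u, v\<close>: setting \<open>u = 0\<close>, \<open>v = 1\<close> leaves the
  coefficient of \<open>v\<^sup>m\<close>.
\<close>

definition fibre_inf :: "int \<Rightarrow> 'k::comm_ring_1 poly poly \<Rightarrow> 'k poly" where
  "fibre_inf m f = map_poly (\<lambda>q. if m < 0 then 0 else coeff q (nat m)) f"

lemma coeff_fibre_inf [simp]: "coeff (fibre_inf m f) i = (if m < 0 then 0 else coeff (coeff f i) (nat m))"
  by (simp add: fibre_inf_def coeff_map_poly)

lemma fibre_inf_0 [simp]: "fibre_inf m 0 = 0" by (simp add: fibre_inf_def)

lemma fibre_inf_add [simp]: "fibre_inf m (f + g) = fibre_inf m f + fibre_inf m g"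
  by (rule poly_eqI) simp

lemma fibre_inf_diff [simp]: "fibre_inf m (f - g) = fibre_inf m f - fibre_inf m g"
  by (rule poly_eqI) simp

lemma degree_fibre_inf_le: "degree (fibre_inf m f) \<le> degree f"
  by (rule degree_le) (simp add: coeff_eq_0)

lemma fibre_inf_eq_0: "bideg_le c d f \<Longrightarrow> d < m \<Longrightarrow> fibre_inf m f = 0"
  using bideg_leD[of c d f _ "nat m"] by (intro poly_eqI) force

lemma coeff_mult_top:
  fixes p q :: "'k::comm_semiring_0 poly"
  assumes "degree p \<le> m" "degree q \<le> n"
  shows "coeff (p * q) (m + n) = coeff p m * coeff q n"
proof -
  have "coeff (p * q) (m + n) = (\<Sum>i\<le>m + n. coeff p i * coeff q (m + n - i))"
    by (simp add: coeff_mult)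
  also have "\<dots> = (\<Sum>i\<in>{m}. coeff p i * coeff q (m + n - i))"
  proof (rule sum.mono_neutral_right)
    show "\<forall>i\<in>{..m + n} - {m}. coeff p i * coeff q (m + n - i) = 0"
    proof
      fix i assume "i \<in> {..m + n} - {m}"
      then have "i > m \<or> m + n - i > n" by auto
      then show "coeff p i * coeff q (m + n - i) = 0"
        using assms by (auto simp: coeff_eq_0)
    qed
  qed auto
  finally show ?thesis by simp
qed

lemma bideg_le_neg: "bideg_le c d f \<Longrightarrow> d < 0 \<Longrightarrow> f = 0"
  by (intro poly_eqI) (use bideg_leD in fastforce)

lemma bideg_le_degree_coeff:
  assumes "bideg_le c d f" shows "degree (coeff f i) \<le> nat d"
  by (rule degree_le) (use bideg_leD[OF assms] in fastforce)

lemma fibre_inf_mult: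
  fixes f g :: "'k::comm_ring_1 poly poly"
  assumes "bideg_le c m f" "bideg_le c' n g"
  shows "fibre_inf (m + n) (f * g) = fibre_inf m f * fibre_inf n g"
proof (cases "m < 0 \<or> n < 0")
  case True
  then have "f = 0 \<or> g = 0" using assms bideg_le_neg by blast
  then show ?thesis by auto
next
  case False
  show ?thesis
  proof (rule poly_eqI)
    fix i
    have *: "coeff (coeff f k * coeff g (i - k)) (nat (m + n)) = coeff (coeff f k) (nat m) * coeff (coeff g (i - k)) (nat n)" for k
      using coeff_mult_top[OF bideg_le_degree_coeff[OF assms(1)] bideg_le_degree_coeff[OF assms(2)]] False
      by (simp add: nat_add_distrib)
    show "coeff (fibre_inf (m + n) (f * g)) i = coeff (fibre_inf m f * fibre_inf n g) i"
      using False by (simp add: coeff_mult[of f g] coeff_mult[of "fibre_inf m f"] coeff_sum *)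
  qed
qed

section \<open>Bezout identities and elimination\<close>

lemma in_lincombs:
  fixes f :: "'i::finite \<Rightarrow> 'a::comm_ring_1"
  shows "f i \<in> range (\<lambda>w. \<Sum>i\<in>UNIV. w i * f i)"
proof
  have "(\<Sum>j\<in>UNIV. (if j = i then 1 else 0) * f j) = (\<Sum>j\<in>UNIV. if j = i then f j else 0)"
    by (intro sum.cong) auto
  then show "f i = (\<Sum>j\<in>UNIV. (if j = i then 1 else 0) * f j)" by simp
qed auto

lemma lincombs_add:
  fixes f :: "'i::finite \<Rightarrow> 'a::comm_ring_1"
  assumes "u \<in> range (\<lambda>w. \<Sum>i\<in>UNIV. w i * f i)" "v \<in> range (\<lambda>w. \<Sum>i\<in>UNIV. w i * f i)"
  shows "u + v \<in> range (\<lambda>w. \<Sum>i\<in>UNIV. w i * f i)"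
proof -
  from assms obtain w w' where "u = (\<Sum>i\<in>UNIV. w i * f i)" "v = (\<Sum>i\<in>UNIV. w' i * f i)"
    by blast
  then have *: "u + v = (\<Sum>i\<in>UNIV. (w i + w' i) * f i)" by (simp add: distrib_right sum.distrib)
  show ?thesis unfolding * by (rule rangeI)
qed

lemma lincombs_mult:
  fixes f :: "'i::finite \<Rightarrow> 'a::comm_ring_1"
  assumes "u \<in> range (\<lambda>w. \<Sum>i\<in>UNIV. w i * f i)"
  shows "r * u \<in> range (\<lambda>w. \<Sum>i\<in>UNIV. w i * f i)"
proof -
  from assms obtain w where "u = (\<Sum>i\<in>UNIV. w i * f i)" by blast
  then have *: "r * u = (\<Sum>i\<in>UNIV. (r * w i) * f i)" by (simp add: sum_distrib_left mult.assoc)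
  show ?thesis unfolding * by (rule rangeI)
qed

text \<open>
  A nonzero element of least degree in the ideal of the \<open>f i\<close> is a divisor of all of them up to
  denominators, because a pseudo-remainder is again in the ideal.  Over an integral domain this
  replaces the greatest common divisor over the field of fractions.
\<close>

lemma common_pseudo_divisor:
  fixes f :: "'i::finite \<Rightarrow> 'a::idom poly"
  assumes "f i0 \<noteq> 0"
  shows "\<exists>h w. h = (\<Sum>i\<in>UNIV. w i * f i) \<and> h \<noteq> 0 \<and> (\<forall>i. \<exists>c q. c \<noteq> 0 \<and> smult c (f i) = h * q)"
proof -
  define J where "J = range (\<lambda>w. \<Sum>i\<in>UNIV. w i * f i)"
  note fJ = in_lincombs[of f, folded J_def] and Jadd = lincombs_add[of _ f, folded J_def]
    and Jmult = lincombs_mult[of _ f, folded J_def]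
  have "\<exists>h. h \<in> J \<and> h \<noteq> 0" using fJ assms by blast
  then obtain h where h: "h \<in> J" "h \<noteq> 0" and hmin: "\<And>g. g \<in> J \<Longrightarrow> g \<noteq> 0 \<Longrightarrow> degree h \<le> degree g"
    using ex_has_least_nat[of "\<lambda>h. h \<in> J \<and> h \<noteq> 0" _ degree] by blast
  have "\<exists>c q. c \<noteq> 0 \<and> smult c (f i) = h * q" for i
  proof -
    define r where "r = pseudo_mod (f i) h"
    obtain c q where cq: "c \<noteq> 0" "smult c (f i) = h * q + r"
      using pseudo_mod(1)[OF h(2), of "f i"] unfolding r_def by blast
    have "r = [:c:] * f i + (- q) * h" using cq(2) by (simp add: algebra_simps)
    then have "r \<in> J" by (simp only:) (intro Jadd Jmult fJ h(1))
    moreover have "r = 0 \<or> degree r < degree h"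
      using pseudo_mod(2)[OF h(2), of "f i"] unfolding r_def .
    ultimately have "r = 0" using hmin by fastforce
    then show ?thesis using cq by auto
  qed
  moreover obtain w where "h = (\<Sum>i\<in>UNIV. w i * f i)" using h(1) by (auto simp: J_def)
  ultimately show ?thesis using h(2) by blast
qed

lemma bezout_alg_closed:
  fixes f :: "'i::finite \<Rightarrow> 'k::alg_closed_field poly"
  assumes nz: "\<And>z. \<exists>i. poly (f i) z \<noteq> 0"
  shows "\<exists>w. (\<Sum>i\<in>UNIV. w i * f i) = 1"
proof -
  obtain i0 where "poly (f i0) 0 \<noteq> 0" using nz by blast
  then have "f i0 \<noteq> 0" by auto
  from common_pseudo_divisor[of f, OF this] obtain h w where
    h: "h = (\<Sum>i\<in>UNIV. w i * f i)" "h \<noteq> 0" and hd: "\<And>i. \<exists>c q. c \<noteq> 0 \<and> smult c (f i) = h * q"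
    by blast
  have "degree h = 0"
  proof (rule ccontr)
    assume "degree h \<noteq> 0"
    then obtain z where z: "poly h z = 0" using alg_closed_imp_poly_has_root by blast
    have "poly (f i) z = 0" for i
    proof -
      obtain c q where c: "c \<noteq> 0" "smult c (f i) = h * q" using hd by blast
      have "poly (smult c (f i)) z = 0" unfolding c(2) using z by simp
      then show ?thesis using c(1) by simp
    qed
    then show False using nz by blast
  qed
  then obtain d where d: "h = [:d:]" using degree_eq_zeroE by blast
  then have "d \<noteq> 0" using h(2) by auto
  have "(\<Sum>i\<in>UNIV. smult (1 / d) (w i) * f i) = smult (1 / d) h"
    unfolding h(1) smult_sum2 by simp
  also have "\<dots> = 1" using \<open>d \<noteq> 0\<close> by (simp add: d)
  finally show ?thesis by (rule exI[of _ "\<lambda>i. smult (1 / d) (w i)"])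
qed

text \<open>
  The common pseudo-divisor has degree 0 in \<open>t\<close>.  Otherwise, over a point \<open>x\<close> that is not a root of
  its leading coefficient or of one of the denominators, it has a root, and this root is a common zero.
\<close>

lemma elimination_ideal:
  fixes f :: "'i::finite \<Rightarrow> 'k::alg_closed_field poly poly"
  assumes nz: "\<And>x z. \<exists>i. poly (fibre x (f i)) z \<noteq> 0"
  shows "\<exists>w D. D \<noteq> 0 \<and> (\<Sum>i\<in>UNIV. w i * f i) = [:D:]"
proof -
  obtain i0 where "poly (fibre 0 (f i0)) 0 \<noteq> 0" using nz by blast
  then have "f i0 \<noteq> 0" by auto
  from common_pseudo_divisor[of f, OF this] obtain h w where
    h: "h = (\<Sum>i\<in>UNIV. w i * f i)" "h \<noteq> 0" and "\<And>i. \<exists>c q. c \<noteq> 0 \<and> smult c (f i) = h * q"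
    by blast
  then obtain c q where cq: "\<And>i. c i \<noteq> 0" "\<And>i. smult (c i) (f i) = h * q i" by metis
  have "degree h = 0"
  proof (rule ccontr)
    assume dh: "degree h \<noteq> 0"
    have "lead_coeff h * (\<Prod>i\<in>UNIV. c i) \<noteq> 0" using h(2) cq(1) by simp
    then obtain x where x: "poly (lead_coeff h * (\<Prod>i\<in>UNIV. c i)) x \<noteq> 0"
      using nonroot_exists by blast
    have ci: "poly (c i) x \<noteq> 0" for i using x by (simp add: poly_prod)
    have "coeff (fibre x h) (degree h) \<noteq> 0" using x by simp
    then have "degree (fibre x h) > 0" using dh le_degree by fastforce
    then obtain z where z: "poly (fibre x h) z = 0" using alg_closed_imp_poly_has_root by blast
    have "poly (fibre x (f i)) z = 0" for i
    proof -
      have "fibre x (smult (c i) (f i)) = fibre x (h * q i)" using cq(2) by simp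
      then have "poly (smult (poly (c i) x) (fibre x (f i))) z = 0" using z by simp
      then show ?thesis using ci by simp
    qed
    then show False using nz by blast
  qed
  then obtain D where D: "h = [:D:]" using degree_eq_zeroE by blast
  then have "D \<noteq> 0" using h(2) by auto
  then show ?thesis using h(1) D by metis
qed

section \<open>Exactness of the Koszul complex of three forms\<close>

text \<open>
  For the dehomogenizations of three forms of degree \<open>a\<close> on the projective line; the coefficient at
  \<open>a\<close> is the value at infinity.
\<close>

definition no_common_zero :: "nat \<Rightarrow> 'k::field poly \<Rightarrow> 'k poly \<Rightarrow> 'k poly \<Rightarrow> bool" where
  "no_common_zero a f1 f2 f3 \<longleftrightarrow> (\<forall>z. poly f1 z \<noteq> 0 \<or> poly f2 z \<noteq> 0 \<or> poly f3 z \<noteq> 0) \<and>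
     (coeff f1 a \<noteq> 0 \<or> coeff f2 a \<noteq> 0 \<or> coeff f3 a \<noteq> 0)"

lemma bezout3:
  fixes f1 f2 f3 :: "'k::alg_closed_field poly"
  assumes "no_common_zero a f1 f2 f3"
  shows "\<exists>w1 w2 w3. w1 * f1 + w2 * f2 + w3 * f3 = 1"
proof -
  define f where "f = (\<lambda>i::3. if i = 1 then f1 else if i = 2 then f2 else f3)"
  have "\<exists>i. poly (f i) z \<noteq> 0" for z
    using assms unfolding no_common_zero_def by (intro ccontr[of "\<exists>i. _ i"]) (auto simp: f_def forall_3)
  from bezout_alg_closed[OF this] obtain w where "(\<Sum>i\<in>UNIV. w i * f i) = 1" by blast
  then have "w 1 * f1 + w 2 * f2 + w 3 * f3 = 1" by (simp add: sum_3 f_def)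
  then show ?thesis by blast
qed

text \<open>
  The Bezout identity makes \<open>\<alpha>\<close> a polynomial multiple \<open>l f\<close>, also where the \<open>f\<^sub>i\<close> vanish.  One of the
  \<open>f\<^sub>i\<close> has degree \<open>a\<close>, since infinity is not a common zero either, so \<open>deg \<alpha> < a\<close> forces \<open>l = 0\<close>.
\<close>

lemma parallel_to_no_common_zero:
  fixes f1 f2 f3 :: "'k::alg_closed_field poly"
  assumes nz: "no_common_zero a f1 f2 f3"
    and deg: "degree \<alpha>1 < a" "degree \<alpha>2 < a" "degree \<alpha>3 < a"
    and par: "\<alpha>2 * f3 = \<alpha>3 * f2" "\<alpha>3 * f1 = \<alpha>1 * f3" "\<alpha>1 * f2 = \<alpha>2 * f1"
  shows "\<alpha>1 = 0 \<and> \<alpha>2 = 0 \<and> \<alpha>3 = 0"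
proof -
  obtain w1 w2 w3 where w: "w1 * f1 + w2 * f2 + w3 * f3 = 1" using bezout3[OF nz] by blast
  define l where "l = w1 * \<alpha>1 + w2 * \<alpha>2 + w3 * \<alpha>3"
  have "(w1 * f1 + w2 * f2 + w3 * f3) * \<alpha>1 - l * f1 = w2 * (\<alpha>1 * f2 - \<alpha>2 * f1) - w3 * (\<alpha>3 * f1 - \<alpha>1 * f3)"
    by (simp add: l_def algebra_simps)
  then have l1: "\<alpha>1 = l * f1" unfolding w par by simp
  have "(w1 * f1 + w2 * f2 + w3 * f3) * \<alpha>2 - l * f2 = w3 * (\<alpha>2 * f3 - \<alpha>3 * f2) - w1 * (\<alpha>1 * f2 - \<alpha>2 * f1)"
    by (simp add: l_def algebra_simps)
  then have l2: "\<alpha>2 = l * f2" unfolding w par by simp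
  have "(w1 * f1 + w2 * f2 + w3 * f3) * \<alpha>3 - l * f3 = w1 * (\<alpha>3 * f1 - \<alpha>1 * f3) - w2 * (\<alpha>2 * f3 - \<alpha>3 * f2)"
    by (simp add: l_def algebra_simps)
  then have l3: "\<alpha>3 = l * f3" unfolding w par by simp
  have "l = 0"
  proof (rule ccontr)
    assume l0: "l \<noteq> 0"
    have *: "\<not> degree (l * f) < a" if "coeff f a \<noteq> 0" for f
    proof -
      have "f \<noteq> 0" using that by auto
      then have "degree f \<le> degree (l * f)" using l0 by (simp add: degree_mult_eq)
      then show ?thesis using le_degree[OF that] by linarith
    qed
    show False using nz *[of f1] *[of f2] *[of f3] deg
      unfolding no_common_zero_def l1[symmetric] l2[symmetric] l3[symmetric] by blast
  qed
  then show ?thesis using l1 l2 l3 by simp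
qed

text \<open>
  Induction on the degree of \<open>D\<close>.  Over a root of \<open>D\<close> the vector \<open>\<alpha>\<close> is parallel to \<open>g\<close>, hence zero
  by the previous lemma, so the linear factor can be cancelled from \<open>D\<close> and all of \<open>\<alpha>\<close>.
\<close>

lemma divide_out_denominator:
  fixes g1 g2 g3 c1 c2 c3 \<alpha>1 \<alpha>2 \<alpha>3 :: "'k::alg_closed_field poly poly" and D :: "'k poly"
  assumes fib: "\<And>x. no_common_zero a (fibre x g1) (fibre x g2) (fibre x g3)"
    and "D \<noteq> 0"
    and "degree \<alpha>1 < a" "degree \<alpha>2 < a" "degree \<alpha>3 < a"
    and "smult D c1 = \<alpha>2 * g3 - \<alpha>3 * g2" "smult D c2 = \<alpha>3 * g1 - \<alpha>1 * g3"
        "smult D c3 = \<alpha>1 * g2 - \<alpha>2 * g1"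
  shows "\<exists>\<alpha>1 \<alpha>2 \<alpha>3 :: 'k poly poly. degree \<alpha>1 < a \<and> degree \<alpha>2 < a \<and> degree \<alpha>3 < a \<and>
    c1 = \<alpha>2 * g3 - \<alpha>3 * g2 \<and> c2 = \<alpha>3 * g1 - \<alpha>1 * g3 \<and> c3 = \<alpha>1 * g2 - \<alpha>2 * g1"
proof -
  have main: "\<exists>\<alpha>1 \<alpha>2 \<alpha>3 :: 'k poly poly. degree \<alpha>1 < a \<and> degree \<alpha>2 < a \<and> degree \<alpha>3 < a \<and>
    c1 = \<alpha>2 * g3 - \<alpha>3 * g2 \<and> c2 = \<alpha>3 * g1 - \<alpha>1 * g3 \<and> c3 = \<alpha>1 * g2 - \<alpha>2 * g1"
    if "degree D = n" "D \<noteq> 0" "degree \<alpha>1 < a" "degree \<alpha>2 < a" "degree \<alpha>3 < a"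
    "smult D c1 = \<alpha>2 * g3 - \<alpha>3 * g2" "smult D c2 = \<alpha>3 * g1 - \<alpha>1 * g3"
        "smult D c3 = \<alpha>1 * g2 - \<alpha>2 * g1" for n and D :: "'k poly" and \<alpha>1 \<alpha>2 \<alpha>3 :: "'k poly poly"
    using that
  proof (induction n arbitrary: D \<alpha>1 \<alpha>2 \<alpha>3 rule: less_induct)
    case (less n)
    show ?case
    proof (cases "degree D = 0")
      case True
      then obtain d where d: "D = [:d:]" using degree_eq_zeroE by blast
      then have d0: "d \<noteq> 0" using less.prems by auto
      define u where "u = [:1/d:]"
      have uD: "u * D = 1" using d0 by (simp add: d u_def)
      have "degree (smult u \<alpha>1) < a" "degree (smult u \<alpha>2) < a" "degree (smult u \<alpha>3) < a"
        using less.prems(3-5) degree_smult_le le_less_trans by blast+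
      moreover have *: "c = smult u \<beta> * g - smult u \<beta>' * g'" if "smult D c = \<beta> * g - \<beta>' * g'" for c \<beta> \<beta>' g g'
      proof -
        have "smult u (smult D c) = c" by (simp only: smult_smult uD smult_1_left)
        then show ?thesis by (simp only: that smult_diff_right mult_smult_left)
      qed
      have "c1 = smult u \<alpha>2 * g3 - smult u \<alpha>3 * g2" "c2 = smult u \<alpha>3 * g1 - smult u \<alpha>1 * g3"
        "c3 = smult u \<alpha>1 * g2 - smult u \<alpha>2 * g1"
        using *[OF less.prems(6)] *[OF less.prems(7)] *[OF less.prems(8)] .
      ultimately show ?thesis by blast
    next
      case False
      then obtain x where x: "poly D x = 0" using alg_closed_imp_poly_has_root by blast
      then obtain D' where D': "D = [:-x,1:] * D'" by (auto simp: poly_eq_0_iff_dvd elim: dvdE)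
      have "fibre x (smult D c1) = 0" "fibre x (smult D c2) = 0" "fibre x (smult D c3) = 0"
        using x by simp_all
      then have par: "fibre x \<alpha>2 * fibre x g3 = fibre x \<alpha>3 * fibre x g2"
        "fibre x \<alpha>3 * fibre x g1 = fibre x \<alpha>1 * fibre x g3" "fibre x \<alpha>1 * fibre x g2 = fibre x \<alpha>2 * fibre x g1"
        unfolding less.prems(6-8) by simp_all
      have "degree (fibre x \<alpha>1) < a" "degree (fibre x \<alpha>2) < a" "degree (fibre x \<alpha>3) < a"
        using less.prems(3-5) le_less_trans[OF degree_fibre_le] by blast+
      then have "fibre x \<alpha>1 = 0 \<and> fibre x \<alpha>2 = 0 \<and> fibre x \<alpha>3 = 0"
        using par by (rule parallel_to_no_common_zero[OF fib[of x]])
      moreover have "\<exists>\<beta>. \<alpha> = smult [:-x,1:] \<beta> \<and> degree \<beta> \<le> degree \<alpha>" if "fibre x \<alpha> = 0" for \<alpha> :: "'k poly poly"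
      proof -
        define \<beta> where "\<beta> = map_poly (\<lambda>q. q div [:-x,1:]) \<alpha>"
        have cb: "coeff \<beta> i = coeff \<alpha> i div [:-x,1:]" for i by (simp add: \<beta>_def coeff_map_poly)
        have "poly (coeff \<alpha> i) x = 0" for i using that coeff_fibre[of x \<alpha> i] by simp
        then have "[:-x,1:] dvd coeff \<alpha> i" for i using poly_eq_0_iff_dvd by blast
        then have "[:-x,1:] * (coeff \<alpha> i div [:-x,1:]) = coeff \<alpha> i" for i by (rule dvd_mult_div_cancel)
        then have "\<alpha> = smult [:-x,1:] \<beta>" by (intro poly_eqI[of \<alpha>]) (simp only: coeff_smult cb)
        moreover have "degree \<beta> \<le> degree \<alpha>" by (rule degree_le) (simp add: cb coeff_eq_0)
        ultimately show ?thesis by blast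
      qed
      ultimately obtain \<beta>1 \<beta>2 \<beta>3 where
        b: "\<alpha>1 = smult [:-x,1:] \<beta>1" "\<alpha>2 = smult [:-x,1:] \<beta>2" "\<alpha>3 = smult [:-x,1:] \<beta>3"
        "degree \<beta>1 \<le> degree \<alpha>1" "degree \<beta>2 \<le> degree \<alpha>2" "degree \<beta>3 \<le> degree \<alpha>3" by meson
      have canc: "u = v" if "smult [:-x,1:] u = smult [:-x,1:] v" for u v :: "'k poly poly"
      proof (rule poly_eqI)
        fix i
        have "[:-x,1:] * coeff u i = [:-x,1:] * coeff v i"
          using arg_cong[OF that, of "\<lambda>w. coeff w i"] by (simp only: coeff_smult)
        moreover have "[:-x,1:] \<noteq> 0" by simp
        ultimately show "coeff u i = coeff v i" using mult_left_cancel by blast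
      qed
      have D'0: "D' \<noteq> 0" using D' less.prems by auto
      then have dl: "degree D' < n" unfolding less.prems(1)[symmetric] D' by (subst degree_mult_eq) auto
      have dd: "degree \<beta>1 < a" "degree \<beta>2 < a" "degree \<beta>3 < a"
        using b less.prems le_less_trans by blast+
      have *: "smult D' c = \<beta> * g - \<beta>' * g'"
        if "smult D c = smult [:-x,1:] \<beta> * g - smult [:-x,1:] \<beta>' * g'" for c \<beta> \<beta>' g g'
      proof (rule canc)
        have "smult [:-x,1:] (smult D' c) = smult D c" unfolding D' by (rule smult_smult)
        also have "\<dots> = smult [:-x,1:] (\<beta> * g - \<beta>' * g')"
          unfolding that smult_diff_right mult_smult_left ..
        finally show "smult [:-x,1:] (smult D' c) = smult [:-x,1:] (\<beta> * g - \<beta>' * g')" .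
      qed
      have eqs: "smult D' c1 = \<beta>2 * g3 - \<beta>3 * g2" "smult D' c2 = \<beta>3 * g1 - \<beta>1 * g3"
        "smult D' c3 = \<beta>1 * g2 - \<beta>2 * g1"
        using less.prems(6-8) unfolding b(1-3) by (blast intro: *)+
      show ?thesis using less.IH[OF dl refl D'0 dd eqs] .
    qed
  qed
  show ?thesis by (rule main[OF refl assms(2-)])
qed

text \<open>
  Adding a multiple of \<open>g\<close> to \<open>\<alpha>\<close> does not change the Koszul syzygy.  So \<open>\<alpha>1\<close> may be reduced modulo
  \<open>g1\<close>, at the cost of a larger denominator, and then the equations for \<open>c2\<close> and \<open>c3\<close> bound the degrees
  of \<open>\<alpha>3\<close> and \<open>\<alpha>2\<close>.
\<close>

lemma syzygy_mod_leading:
  fixes g1 g2 g3 c1 c2 c3 \<alpha>1 \<alpha>2 \<alpha>3 :: "'k::alg_closed_field poly poly" and D :: "'k poly"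
  assumes a: "a \<ge> 1" and dg: "degree g1 = a" "degree g2 \<le> a" "degree g3 \<le> a"
    and dc: "degree c1 \<le> 2 * a - 1" "degree c2 \<le> 2 * a - 1" "degree c3 \<le> 2 * a - 1"
    and D: "D \<noteq> 0" and eq: "smult D c1 = \<alpha>2 * g3 - \<alpha>3 * g2" "smult D c2 = \<alpha>3 * g1 - \<alpha>1 * g3"
        "smult D c3 = \<alpha>1 * g2 - \<alpha>2 * g1"
  shows "\<exists>(D :: 'k poly) (\<alpha>1 :: 'k poly poly) (\<alpha>2 :: 'k poly poly) (\<alpha>3 :: 'k poly poly). D \<noteq> 0 \<and> degree \<alpha>1 < a \<and> degree \<alpha>2 < a \<and> degree \<alpha>3 < a \<and>
    smult D c1 = \<alpha>2 * g3 - \<alpha>3 * g2 \<and> smult D c2 = \<alpha>3 * g1 - \<alpha>1 * g3 \<and> smult D c3 = \<alpha>1 * g2 - \<alpha>2 * g1"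
proof -
  have g0: "g1 \<noteq> 0" using dg(1) a by auto
  define r where "r = pseudo_mod \<alpha>1 g1"
  obtain e q where e: "e \<noteq> 0" "smult e \<alpha>1 = g1 * q + r"
    using pseudo_mod(1)[OF g0, of \<alpha>1] unfolding r_def by blast
  have "r = 0 \<or> degree r < a" using pseudo_mod(2)[OF g0, of \<alpha>1] dg(1) unfolding r_def by simp
  then have dr: "degree r < a" using a by auto
  define \<beta>2 \<beta>3 where "\<beta>2 = smult e \<alpha>2 - q * g2" and "\<beta>3 = smult e \<alpha>3 - q * g3"
  have r_eq: "r = smult e \<alpha>1 - q * g1" using e(2) by (simp add: algebra_simps)
  have eqs: "smult (e * D) c1 = \<beta>2 * g3 - \<beta>3 * g2" "smult (e * D) c2 = \<beta>3 * g1 - r * g3"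
    "smult (e * D) c3 = r * g2 - \<beta>2 * g1"
    unfolding smult_smult[symmetric] eq
    by (simp_all add: r_eq \<beta>2_def \<beta>3_def smult_diff_right algebra_simps)
  have small: "degree \<beta> < a" if "degree (\<beta> * g1) \<le> 2 * a - 1" for \<beta>
  proof (cases "\<beta> = 0")
    case False
    then show ?thesis using that g0 dg(1) a by (simp add: degree_mult_eq)
  qed (use a in auto)
  have rg: "degree (r * g) \<le> 2 * a - 1" if "degree g \<le> a" for g
    using degree_mult_le[of r g] dr that by linarith
  have sm: "degree (smult E c) \<le> 2 * a - 1" if "degree c \<le> 2 * a - 1" for E c
    using that degree_smult_le order_trans by blast
  have "\<beta>3 * g1 = smult (e * D) c2 + r * g3" using eqs by simp
  then have "degree (\<beta>3 * g1) \<le> 2 * a - 1" by (simp only:) (intro degree_add_le sm rg dc dg)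
  moreover have "\<beta>2 * g1 = r * g2 - smult (e * D) c3" using eqs by simp
  then have "degree (\<beta>2 * g1) \<le> 2 * a - 1" by (simp only:) (intro degree_diff_le sm rg dc dg)
  ultimately have "degree \<beta>3 < a" "degree \<beta>2 < a" using small by blast+
  moreover have "e * D \<noteq> 0" using e D by simp
  ultimately show ?thesis using dr eqs by blast
qed

text \<open>
  From \<open>w\<cdot>g = D\<close> and \<open>c\<cdot>g = 0\<close> the identity \<open>(w \<times> c) \<times> g = (w\<cdot>g) c - (c\<cdot>g) w\<close> for the cross product
  gives \<open>D c = \<alpha> \<times> g\<close> with \<open>\<alpha> = w \<times> c\<close>.  It remains to lower the degree of \<open>\<alpha>\<close> in \<open>t\<close> and to
  remove the denominator \<open>D\<close>.
\<close>

lemma koszul_exact_generic: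
  fixes g1 g2 g3 c1 c2 c3 :: "'k::alg_closed_field poly poly"
  assumes a: "a \<ge> 1" and fib: "\<And>x. no_common_zero a (fibre x g1) (fibre x g2) (fibre x g3)"
    and dg: "degree g1 \<le> a" "degree g2 \<le> a" "degree g3 \<le> a"
    and dc: "degree c1 \<le> 2 * a - 1" "degree c2 \<le> 2 * a - 1" "degree c3 \<le> 2 * a - 1"
    and syz: "c1 * g1 + c2 * g2 + c3 * g3 = 0"
  shows "\<exists>\<alpha>1 \<alpha>2 \<alpha>3 :: 'k poly poly. degree \<alpha>1 < a \<and> degree \<alpha>2 < a \<and> degree \<alpha>3 < a \<and>
    c1 = \<alpha>2 * g3 - \<alpha>3 * g2 \<and> c2 = \<alpha>3 * g1 - \<alpha>1 * g3 \<and> c3 = \<alpha>1 * g2 - \<alpha>2 * g1"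
proof -
  define g where "g = (\<lambda>i::3. if i = 1 then g1 else if i = 2 then g2 else g3)"
  have "\<exists>i. poly (fibre x (g i)) z \<noteq> 0" for x z
    using fib[of x] unfolding no_common_zero_def by (intro ccontr[of "\<exists>i. _ i"]) (auto simp: g_def forall_3)
  from elimination_ideal[OF this] obtain w D where D: "D \<noteq> 0" "(\<Sum>i\<in>UNIV. w i * g i) = [:D:]" by blast
  then have wg: "w 1 * g1 + w 2 * g2 + w 3 * g3 = [:D:]" by (simp add: sum_3 g_def)
  define \<alpha>1 \<alpha>2 \<alpha>3 where "\<alpha>1 = w 2 * c3 - w 3 * c2" and "\<alpha>2 = w 3 * c1 - w 1 * c3" and "\<alpha>3 = w 1 * c2 - w 2 * c1"
  have 1: "smult D c1 = \<alpha>2 * g3 - \<alpha>3 * g2"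
  proof -
    have "smult D c1 = c1 * [:D:] - w 1 * (c1 * g1 + c2 * g2 + c3 * g3)" by (simp add: syz)
    also have "\<dots> = \<alpha>2 * g3 - \<alpha>3 * g2" by (simp add: \<alpha>2_def \<alpha>3_def algebra_simps flip: wg)
    finally show ?thesis .
  qed
  have 2: "smult D c2 = \<alpha>3 * g1 - \<alpha>1 * g3"
  proof -
    have "smult D c2 = c2 * [:D:] - w 2 * (c1 * g1 + c2 * g2 + c3 * g3)" by (simp add: syz)
    also have "\<dots> = \<alpha>3 * g1 - \<alpha>1 * g3" by (simp add: \<alpha>1_def \<alpha>3_def algebra_simps flip: wg)
    finally show ?thesis .
  qed
  have 3: "smult D c3 = \<alpha>1 * g2 - \<alpha>2 * g1"
  proof -
    have "smult D c3 = c3 * [:D:] - w 3 * (c1 * g1 + c2 * g2 + c3 * g3)" by (simp add: syz)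
    also have "\<dots> = \<alpha>1 * g2 - \<alpha>2 * g1" by (simp add: \<alpha>1_def \<alpha>2_def algebra_simps flip: wg)
    finally show ?thesis .
  qed
  have "degree g1 = a \<or> degree g2 = a \<or> degree g3 = a"
    using fib[of 0] dg unfolding no_common_zero_def by (metis coeff_0 coeff_fibre le_antisym le_degree poly_0)
  then have "\<exists>(D :: 'k poly) (\<alpha>1 :: 'k poly poly) (\<alpha>2 :: 'k poly poly) (\<alpha>3 :: 'k poly poly). D \<noteq> 0 \<and> degree \<alpha>1 < a \<and> degree \<alpha>2 < a \<and> degree \<alpha>3 < a \<and>
    smult D c1 = \<alpha>2 * g3 - \<alpha>3 * g2 \<and> smult D c2 = \<alpha>3 * g1 - \<alpha>1 * g3 \<and> smult D c3 = \<alpha>1 * g2 - \<alpha>2 * g1"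
  proof (elim disjE)
    assume "degree g1 = a"
    from syzygy_mod_leading[OF a this dg(2,3) dc D(1) 1 2 3] show ?thesis .
  next
    assume "degree g2 = a"
    from syzygy_mod_leading[OF a this dg(3,1) dc(2,3,1) D(1) 2 3 1] show ?thesis by blast
  next
    assume "degree g3 = a"
    from syzygy_mod_leading[OF a this dg(1,2) dc(3,1,2) D(1) 3 1 2] show ?thesis by blast
  qed
  then show ?thesis using divide_out_denominator[OF fib] by metis
qed

lemma bideg_le_degree: "bideg_le (int c) d f \<Longrightarrow> degree f \<le> c"
  by (simp add: bideg_le_iff_degree)

text \<open>
  What is left is the degree in \<open>x\<close>.  As long as the bound for \<open>\<alpha>\<close> exceeds the intended one, the fibre
  of \<open>\<alpha> \<times> g = c\<close> at infinity is zero, so the leading part of \<open>\<alpha>\<close> is parallel to that of \<open>g\<close> and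
  vanishes.  The degree \<open>2a - 1\<close> in \<open>t\<close> makes this work: \<open>\<alpha>\<close> has degree \<open>a - 1\<close>, too small for a
  nonzero multiple of \<open>g\<close>.
\<close>

lemma koszul_exact:
  fixes g1 g2 g3 c1 c2 c3 :: "'k::alg_closed_field poly poly"
  assumes a: "a \<ge> 1" and fib: "\<And>x. no_common_zero a (fibre x g1) (fibre x g2) (fibre x g3)"
    and inf: "no_common_zero a (fibre_inf e1 g1) (fibre_inf e2 g2) (fibre_inf e3 g3)"
    and bg: "bideg_le (int a) e1 g1" "bideg_le (int a) e2 g2" "bideg_le (int a) e3 g3"
    and bc: "bideg_le (2 * int a - 1) (e - e1) c1" "bideg_le (2 * int a - 1) (e - e2) c2" "bideg_le (2 * int a - 1) (e - e3) c3"
    and syz: "c1 * g1 + c2 * g2 + c3 * g3 = 0"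
  shows "\<exists>\<alpha>1 \<alpha>2 \<alpha>3 :: 'k poly poly. bideg_le (int a - 1) (e - e2 - e3) \<alpha>1 \<and> bideg_le (int a - 1) (e - e1 - e3) \<alpha>2 \<and>
    bideg_le (int a - 1) (e - e1 - e2) \<alpha>3 \<and>
    c1 = \<alpha>2 * g3 - \<alpha>3 * g2 \<and> c2 = \<alpha>3 * g1 - \<alpha>1 * g3 \<and> c3 = \<alpha>1 * g2 - \<alpha>2 * g1"
proof -
  have a2: "2 * int a - 1 = int (2 * a - 1)" "int a - 1 = int (a - 1)" using a by auto
  have dg: "degree g1 \<le> a" "degree g2 \<le> a" "degree g3 \<le> a" using bg bideg_le_degree by blast+
  have dc: "degree c1 \<le> 2 * a - 1" "degree c2 \<le> 2 * a - 1" "degree c3 \<le> 2 * a - 1"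
    using bc unfolding a2 using bideg_le_degree by blast+
  obtain \<alpha>1 \<alpha>2 \<alpha>3 where d\<alpha>: "degree \<alpha>1 < a" "degree \<alpha>2 < a" "degree \<alpha>3 < a" and
    eq: "c1 = \<alpha>2 * g3 - \<alpha>3 * g2" "c2 = \<alpha>3 * g1 - \<alpha>1 * g3" "c3 = \<alpha>1 * g2 - \<alpha>2 * g1"
    using koszul_exact_generic[OF a fib dg dc syz] by blast
  \<comment> \<open>Some bound on the degree in \<open>x\<close> exists; it is lowered to \<open>e\<close> step by step.\<close>
  define B where "B m \<longleftrightarrow> bideg_le (int a - 1) (m - e2 - e3) \<alpha>1 \<and> bideg_le (int a - 1) (m - e1 - e3) \<alpha>2 \<and>
    bideg_le (int a - 1) (m - e1 - e2) \<alpha>3" for m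
  have step': "B (m - 1)" if Bm: "B m" and me: "m > e" for m
  proof -
    have b: "bideg_le (int a - 1) (m - e2 - e3) \<alpha>1" "bideg_le (int a - 1) (m - e1 - e3) \<alpha>2" "bideg_le (int a - 1) (m - e1 - e2) \<alpha>3"
      using Bm by (auto simp: B_def)
    define t1 t2 t3 where "t1 = fibre_inf (m - e2 - e3) \<alpha>1" and "t2 = fibre_inf (m - e1 - e3) \<alpha>2" and "t3 = fibre_inf (m - e1 - e2) \<alpha>3"
    have "fibre_inf (m - e1) c1 = t2 * fibre_inf e3 g3 - t3 * fibre_inf e2 g2"
      using fibre_inf_mult[OF b(2) bg(3)] fibre_inf_mult[OF b(3) bg(2)] by (simp add: eq t2_def t3_def)
    moreover have "fibre_inf (m - e2) c2 = t3 * fibre_inf e1 g1 - t1 * fibre_inf e3 g3"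
      using fibre_inf_mult[OF b(3) bg(1)] fibre_inf_mult[OF b(1) bg(3)] by (simp add: eq t1_def t3_def)
    moreover have "fibre_inf (m - e3) c3 = t1 * fibre_inf e2 g2 - t2 * fibre_inf e1 g1"
      using fibre_inf_mult[OF b(1) bg(2)] fibre_inf_mult[OF b(2) bg(1)] by (simp add: eq t1_def t2_def)
    moreover have "fibre_inf (m - e1) c1 = 0" "fibre_inf (m - e2) c2 = 0" "fibre_inf (m - e3) c3 = 0"
      using bc me by (auto intro: fibre_inf_eq_0)
    ultimately have par: "t2 * fibre_inf e3 g3 = t3 * fibre_inf e2 g2" "t3 * fibre_inf e1 g1 = t1 * fibre_inf e3 g3"
      "t1 * fibre_inf e2 g2 = t2 * fibre_inf e1 g1" by simp_all
    have dt: "degree t1 < a" "degree t2 < a" "degree t3 < a"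
      unfolding t1_def t2_def t3_def using d\<alpha> le_less_trans[OF degree_fibre_inf_le] by blast+
    have "t1 = 0 \<and> t2 = 0 \<and> t3 = 0" by (rule parallel_to_no_common_zero[OF inf dt par])
    moreover have "bideg_le (int a - 1) (M - 1) \<alpha>" if "bideg_le (int a - 1) M \<alpha>" "fibre_inf M \<alpha> = 0" for M and \<alpha> :: "'k poly poly"
      unfolding bideg_le_def
    proof (intro allI impI)
      fix i j assume nz: "coeff (coeff \<alpha> i) j \<noteq> 0"
      then have *: "int i \<le> int a - 1" "int j \<le> M" using that(1) bideg_leD by blast+
      moreover have "int j \<noteq> M"
      proof
        assume "int j = M"
        then have "coeff (fibre_inf M \<alpha>) i = coeff (coeff \<alpha> i) j" by auto
        then show False using that(2) nz by simp
      qed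
      ultimately show "int i \<le> int a - 1 \<and> int j \<le> M - 1" by simp
    qed
    ultimately have "bideg_le (int a - 1) (m - e2 - e3 - 1) \<alpha>1" "bideg_le (int a - 1) (m - e1 - e3 - 1) \<alpha>2" "bideg_le (int a - 1) (m - e1 - e2 - 1) \<alpha>3"
      using b unfolding t1_def t2_def t3_def by blast+
    moreover have "m - e2 - e3 - 1 = m - 1 - e2 - e3" "m - e1 - e3 - 1 = m - 1 - e1 - e3" "m - e1 - e2 - 1 = m - 1 - e1 - e2"
      by simp_all
    ultimately show ?thesis unfolding B_def by simp
  qed
  have "\<exists>N. bideg_le (int a - 1) N \<alpha>" if "degree \<alpha> < a" for \<alpha> :: "'k poly poly"
  proof -
    define N where "N = (\<Sum>i\<le>degree \<alpha>. degree (coeff \<alpha> i))"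
    have "bideg_le (int (a - 1)) (int N) \<alpha>"
      unfolding bideg_le_iff_degree
    proof (intro conjI allI impI)
      show "degree \<alpha> \<le> a - 1" using that by simp
      fix i j assume "coeff (coeff \<alpha> i) j \<noteq> 0"
      then have "coeff \<alpha> i \<noteq> 0" and j: "j \<le> degree (coeff \<alpha> i)" by (auto intro: le_degree)
      then have "i \<le> degree \<alpha>" by (simp add: le_degree)
      then have "degree (coeff \<alpha> i) \<le> N" unfolding N_def by (intro member_le_sum) auto
      then show "int j \<le> int N" using j by simp
    qed
    then show ?thesis using a2 by metis
  qed
  then obtain N1 N2 N3 where N: "bideg_le (int a - 1) N1 \<alpha>1" "bideg_le (int a - 1) N2 \<alpha>2" "bideg_le (int a - 1) N3 \<alpha>3"
    using d\<alpha> by meson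
  define M where "M = max e (max (N1 + e2 + e3) (max (N2 + e1 + e3) (N3 + e1 + e2)))"
  have "N1 \<le> M - e2 - e3" "N2 \<le> M - e1 - e3" "N3 \<le> M - e1 - e2" by (auto simp: M_def)
  then have "B M" unfolding B_def using N bideg_le_mono by blast
  moreover have "B e" if "B M" "M \<ge> e" for M using that(2,1)
  proof (induction rule: int_ge_induct)
    case (step i)
    have "B (i + 1 - 1)" by (rule step') (use step in auto)
    then show ?case using step by simp
  qed
  ultimately have "B e" by (auto simp: M_def)
  then show ?thesis using eq unfolding B_def by blast
qed

section \<open>A minimal basis of the vectors orthogonal to a given one\<close>

definition deg_le :: "int \<Rightarrow> 'k::zero poly \<Rightarrow> bool" where
  "deg_le d q \<longleftrightarrow> (\<forall>j. coeff q j \<noteq> 0 \<longrightarrow> int j \<le> d)"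

lemma deg_le_0 [simp]: "deg_le d 0" by (simp add: deg_le_def)

lemma deg_le_mono: "deg_le d q \<Longrightarrow> d \<le> d' \<Longrightarrow> deg_le d' q"
  unfolding deg_le_def by (meson order_trans)

lemma deg_le_iff_degree: "deg_le (int d) q \<longleftrightarrow> degree q \<le> d"
  unfolding deg_le_def
proof
  assume "\<forall>j. coeff q j \<noteq> 0 \<longrightarrow> int j \<le> int d"
  then show "degree q \<le> d" by (intro degree_le) (metis leD of_nat_less_iff)
next
  assume "degree q \<le> d"
  then show "\<forall>j. coeff q j \<noteq> 0 \<longrightarrow> int j \<le> int d"
    by (auto dest: le_degree)
qed

lemma deg_le_neg: "deg_le d q \<Longrightarrow> d < 0 \<Longrightarrow> q = 0"
  unfolding deg_le_def by (intro poly_eqI) force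

lemma deg_le_degree: "deg_le d q \<Longrightarrow> degree q \<le> nat d"
  unfolding deg_le_def by (intro degree_le) force

lemma deg_le_step: "deg_le e q \<Longrightarrow> (e \<ge> 0 \<Longrightarrow> coeff q (nat e) = 0) \<Longrightarrow> deg_le (e - 1) q"
  unfolding deg_le_def by (metis int_one_le_iff_zero_less nat_int of_nat_0_le_iff order_le_less zle_diff1_eq)

lemma deg_le_coeff_mult:
  fixes p q :: "'k::comm_semiring_0 poly"
  assumes "deg_le d p" "degree q \<le> m" "d + int m \<ge> 0"
  shows "coeff (p * q) (nat (d + int m)) = (if d < 0 then 0 else coeff p (nat d)) * coeff q m"
proof (cases "d < 0")
  case True
  then have "p = 0" using deg_le_neg assms by blast
  then show ?thesis using True by simp
next
  case False
  then have "nat (d + int m) = nat d + m" by simp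
  then show ?thesis using False coeff_mult_top[OF deg_le_degree[OF assms(1)] assms(2)] by simp
qed

definition dot :: "'a::comm_ring_1 ^ 4 \<Rightarrow> 'a ^ 4 \<Rightarrow> 'a" where
  "dot x y = (\<Sum>k\<in>UNIV. x $ k * y $ k)"

lemma dot_commute: "dot x y = dot y x"
  by (simp add: dot_def mult.commute)

lemma dot_add_right: "dot x (y + z) = dot x y + dot x z"
  by (simp add: dot_def distrib_left sum.distrib)

lemma dot_diff_right: "dot x (y - z) = dot x y - dot x z"
  by (simp add: dot_def right_diff_distrib sum_subtractf)

lemma dot_smult_right: "dot x (c *s y) = c * dot x y"
  by (simp add: dot_def sum_distrib_left mult_ac)

lemma dot_0_right [simp]: "dot x 0 = 0" by (simp add: dot_def)

lemma dot_sum_right: "dot x (sum f A) = (\<Sum>i\<in>A. dot x (f i))"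
  by (induction A rule: infinite_finite_induct) (auto simp: dot_add_right)

lemma dot_axis: "dot x (axis i 1) = x $ i"
proof -
  have "dot x (axis i 1) = (\<Sum>k\<in>UNIV. if k = i then x $ k else 0)"
    unfolding dot_def by (intro sum.cong) (auto simp: axis_def)
  then show ?thesis by simp
qed

lemma vec_axis_expansion: "(w :: 'a::comm_ring_1 ^ 4) = (\<Sum>i\<in>UNIV. w $ i *s axis i 1)"
proof (rule vec_ext_iff[THEN iffD2], intro allI)
  fix k
  have "(\<Sum>i\<in>UNIV. w $ i *s axis i 1) $ k = (\<Sum>i\<in>UNIV. if i = k then w $ i else 0)"
    unfolding sum_component by (intro sum.cong) (auto simp: axis_def)
  then show "w $ k = (\<Sum>i\<in>UNIV. w $ i *s axis i 1) $ k" by simp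
qed

definition vdegree :: "'k::zero poly ^ 4 \<Rightarrow> nat" where
  "vdegree q = Max (range (\<lambda>k. degree (q $ k)))"

lemma vdegree_ge: "degree (q $ k) \<le> vdegree q"
  unfolding vdegree_def by (intro Max_ge) auto

lemma vdegree_le: "(\<And>k. degree (q $ k) \<le> d) \<Longrightarrow> vdegree q \<le> d"
  unfolding vdegree_def by (subst Max_le_iff) auto

definition vtop :: "nat \<Rightarrow> 'k::zero poly ^ 4 \<Rightarrow> 'k ^ 4" where
  "vtop m q = (\<chi> k. coeff (q $ k) m)"

text \<open>
  The shift by one lets the replacement of a constant vector by zero decrease the size.
\<close>

definition vsize :: "'k::zero poly ^ 4 \<Rightarrow> nat" where
  "vsize q = (if q = 0 then 0 else Suc (vdegree q))"

lemma coeff_dot_top: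
  assumes "\<And>k. degree (x $ k) \<le> m" "\<And>k. degree (y $ k) \<le> n"
  shows "coeff (dot x y) (m + n) = dot (vtop m x) (vtop n y)"
  using assms by (simp add: dot_def coeff_sum vtop_def coeff_mult_top)

definition generates :: "'k::field poly ^ 4 \<Rightarrow> (4 \<Rightarrow> 'k poly ^ 4) \<Rightarrow> bool" where
  "generates S Q \<longleftrightarrow> (\<forall>i. dot S (Q i) = 0) \<and>
     (\<forall>w. dot S w = 0 \<longrightarrow> (\<exists>c. w = (\<Sum>i\<in>UNIV. c i *s Q i)))"

text \<open>
  If \<open>S\<cdot>E = 1\<close>, then \<open>w \<mapsto> w - (S\<cdot>w) E\<close> is a projection onto the vectors orthogonal to \<open>S\<close>; the
  images of the four unit vectors generate them.
\<close>

lemma generates_exists: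
  assumes "dot S E = (1 :: 'k::field poly)"
  shows "generates S (\<lambda>i. axis i 1 - S $ i *s E)"
  unfolding generates_def
proof (intro conjI allI impI)
  fix i show "dot S (axis i 1 - S $ i *s E) = 0"
    by (simp add: dot_diff_right dot_axis dot_smult_right assms)
next
  fix w assume w: "dot S w = 0"
  have "(\<Sum>i\<in>UNIV. w $ i *s (axis i 1 - S $ i *s E)) = (\<Sum>i\<in>UNIV. w $ i *s axis i 1) - (\<Sum>i\<in>UNIV. (S $ i * w $ i) *s E)"
    by (simp add: vec_ext_iff sum_subtractf right_diff_distrib mult_ac)
  also have "(\<Sum>i\<in>UNIV. (S $ i * w $ i) *s E) = dot S w *s E"
    by (simp add: dot_def vec_ext_iff sum_distrib_right)
  finally have "w = (\<Sum>i\<in>UNIV. w $ i *s (axis i 1 - S $ i *s E))"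
    using w vec_axis_expansion[of w] by simp
  then show "\<exists>c. w = (\<Sum>i\<in>UNIV. c i *s (axis i 1 - S $ i *s E))" by (rule exI[of _ "($) w"])
qed

lemma sum_split_at:
  fixes f :: "4 \<Rightarrow> 'a::comm_monoid_add"
  shows "(\<Sum>i\<in>UNIV. f i) = f j + (\<Sum>i\<in>UNIV - {j}. f i)"
  by (rule sum.remove) auto

lemma generates_update:
  fixes S :: "'k::field poly ^ 4"
  assumes gen: "generates S Q" and "\<kappa> \<noteq> 0"
    and q: "q = y0 + [:\<kappa>:] *s Q j" and sv: "y0 = (\<Sum>i\<in>UNIV - {j}. d i *s Q i)"
  shows "generates S (Q(j := q))"
  unfolding generates_def
proof (intro conjI allI impI)
  have Q0: "dot S (Q i) = 0" for i using gen by (simp add: generates_def)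
  fix i show "dot S ((Q(j := q)) i) = 0"
    by (simp add: q sv Q0 dot_add_right dot_sum_right dot_smult_right)
next
  fix w assume "dot S w = 0"
  then obtain c where c: "w = (\<Sum>i\<in>UNIV. c i *s Q i)" using gen by (auto simp: generates_def)
  define e where "e = (\<lambda>i. if i = j then smult (1/\<kappa>) (c j) else c i - smult (1/\<kappa>) (c j) * d i)"
  have "(\<Sum>i\<in>UNIV. e i *s (Q(j := q)) i) = e j *s q + (\<Sum>i\<in>UNIV - {j}. e i *s Q i)"
    by (simp add: sum_split_at[of _ j])
  also have "(\<Sum>i\<in>UNIV - {j}. e i *s Q i) = (\<Sum>i\<in>UNIV - {j}. c i *s Q i - e j *s (d i *s Q i))"
    by (rule sum.cong) (auto simp: e_def vec_ext_iff algebra_simps)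
  also have "\<dots> = (\<Sum>i\<in>UNIV - {j}. c i *s Q i) - e j *s y0"
    by (simp add: sv vec_ext_iff sum_subtractf sum_distrib_left)
  also have "e j *s q + ((\<Sum>i\<in>UNIV - {j}. c i *s Q i) - e j *s y0) = (e j * [:\<kappa>:]) *s Q j + (\<Sum>i\<in>UNIV - {j}. c i *s Q i)"
    by (simp add: q vec_ext_iff algebra_simps)
  also have "e j * [:\<kappa>:] = c j" using assms(2) by (simp add: e_def)
  also have "c j *s Q j + (\<Sum>i\<in>UNIV - {j}. c i *s Q i) = w"
    unfolding c by (simp add: sum_split_at[of "\<lambda>i. c i *s Q i" j])
  finally show "\<exists>c. w = (\<Sum>i\<in>UNIV. c i *s (Q(j := q)) i)" by metis
qed

text \<open>
  A relation between the leading coefficient vectors allows a combination of the generators, with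
  monomials as coefficients, whose leading terms cancel.  Replacing by it a generator of largest degree
  among those involved decreases the total size.
\<close>

lemma minimal_generators_independent:
  fixes S :: "'k::field poly ^ 4"
  assumes gen: "generates S Q"
    and min: "\<And>Q'. generates S Q' \<Longrightarrow> (\<Sum>i\<in>UNIV. vsize (Q i)) \<le> (\<Sum>i\<in>UNIV. vsize (Q' i))"
    and dep: "(\<Sum>i\<in>UNIV. \<kappa> i *s vtop (vdegree (Q i)) (Q i)) = 0" and nz: "\<And>i. Q i = 0 \<Longrightarrow> \<kappa> i = 0"
  shows "\<kappa> i = 0"
proof (rule ccontr)
  assume "\<kappa> i \<noteq> 0"
  define X where "X = {i. \<kappa> i \<noteq> 0}"
  have "X \<noteq> {}" using \<open>\<kappa> i \<noteq> 0\<close> by (auto simp: X_def)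
  then have "Max ((\<lambda>i. vdegree (Q i)) ` X) \<in> (\<lambda>i. vdegree (Q i)) ` X" by (intro Max_in) auto
  then obtain j where jX: "j \<in> X" and jM: "vdegree (Q j) = Max ((\<lambda>i. vdegree (Q i)) ` X)" by auto
  have j: "\<kappa> j \<noteq> 0" using jX by (simp add: X_def)
  have jmax: "vdegree (Q i) \<le> vdegree (Q j)" if "\<kappa> i \<noteq> 0" for i
    unfolding jM using that by (intro Max_ge) (auto simp: X_def)
  \<comment> \<open>The combination \<open>q\<close> has the generator \<open>Q j\<close> with a nonzero constant coefficient, and its
    terms of degree \<open>vdegree (Q j)\<close> cancel.\<close>
  define d where "d = (\<lambda>i. monom (\<kappa> i) (vdegree (Q j) - vdegree (Q i)))"
  define q where "q = (\<Sum>i\<in>UNIV - {j}. d i *s Q i) + [:\<kappa> j:] *s Q j"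
  have gen': "generates S (Q(j := q))"
    by (rule generates_update[OF gen j _ refl]) (simp add: q_def)
  have q': "q = (\<Sum>i\<in>UNIV. d i *s Q i)"
    by (simp add: q_def sum_split_at[of _ j] d_def monom_0 add.commute)
  have dq: "coeff (q $ k) m = 0" if "m \<ge> vdegree (Q j)" for k m
  proof -
    have "coeff (d i * Q i $ k) m = (if m = vdegree (Q j) then \<kappa> i * coeff (Q i $ k) (vdegree (Q i)) else 0)" for i
    proof (cases "\<kappa> i = 0")
      case True then show ?thesis by (simp add: d_def)
    next
      case False
      then have le: "vdegree (Q i) \<le> vdegree (Q j)" by (rule jmax)
      have "coeff (d i * Q i $ k) m = \<kappa> i * coeff (Q i $ k) (m - (vdegree (Q j) - vdegree (Q i)))"
        using that by (auto simp: d_def coeff_monom_mult)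
      moreover have "m - (vdegree (Q j) - vdegree (Q i)) = vdegree (Q i)" if "m = vdegree (Q j)" using that le by simp
      moreover have "coeff (Q i $ k) (m - (vdegree (Q j) - vdegree (Q i))) = 0" if "m \<noteq> vdegree (Q j)"
      proof -
        have "m - (vdegree (Q j) - vdegree (Q i)) > vdegree (Q i)" using le that \<open>m \<ge> vdegree (Q j)\<close> by linarith
        then show ?thesis using vdegree_ge[of "Q i" k] by (intro coeff_eq_0) linarith
      qed
      ultimately show ?thesis by auto
    qed
    then have "coeff (q $ k) m = (\<Sum>i\<in>UNIV. if m = vdegree (Q j) then \<kappa> i * coeff (Q i $ k) (vdegree (Q i)) else 0)"
      by (simp add: q' coeff_sum)
    also have "\<dots> = (if m = vdegree (Q j) then (\<Sum>i\<in>UNIV. \<kappa> i *s vtop (vdegree (Q i)) (Q i)) $ k else 0)"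
      by (simp add: vtop_def)
    also have "\<dots> = 0" by (simp add: dep)
    finally show ?thesis .
  qed
  have "Q j \<noteq> 0" using j nz by blast
  have "vsize q < vsize (Q j)"
  proof (cases "q = 0")
    case True then show ?thesis using \<open>Q j \<noteq> 0\<close> by (simp add: vsize_def)
  next
    case False
    then obtain k where "q $ k \<noteq> 0" by (metis vec_ext_iff zero_index)
    then have "lead_coeff (q $ k) \<noteq> 0" by simp
    then have "degree (q $ k) < vdegree (Q j)" using dq[of "degree (q $ k)" k] by (meson not_le_imp_less)
    then have pos: "vdegree (Q j) > 0" by simp
    have "degree (q $ k) \<le> vdegree (Q j) - 1" for k
      by (rule degree_le) (use dq in auto)
    then have "vdegree q \<le> vdegree (Q j) - 1" by (rule vdegree_le)
    then show ?thesis using pos \<open>Q j \<noteq> 0\<close> False by (simp add: vsize_def)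
  qed
  moreover have "(\<Sum>i\<in>UNIV. vsize ((Q(j := q)) i)) = vsize q + (\<Sum>i\<in>UNIV - {j}. vsize (Q i))"
    by (simp add: sum_split_at[of _ j])
  moreover have "(\<Sum>i\<in>UNIV. vsize (Q i)) = vsize (Q j) + (\<Sum>i\<in>UNIV - {j}. vsize (Q i))"
    by (rule sum_split_at)
  ultimately show False using min[OF gen'] by linarith
qed

lemma degree_coeff_prod:
  fixes f :: "'i \<Rightarrow> 'k::comm_ring_1 poly"
  assumes "finite A" "\<And>i. i \<in> A \<Longrightarrow> degree (f i) \<le> d i"
  shows "degree (\<Prod>i\<in>A. f i) \<le> (\<Sum>i\<in>A. d i) \<and>
    coeff (\<Prod>i\<in>A. f i) (\<Sum>i\<in>A. d i) = (\<Prod>i\<in>A. coeff (f i) (d i))"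
  using assms
proof (induction A rule: finite_induct)
  case (insert x A)
  then have IH: "degree (\<Prod>i\<in>A. f i) \<le> (\<Sum>i\<in>A. d i)" "coeff (\<Prod>i\<in>A. f i) (\<Sum>i\<in>A. d i) = (\<Prod>i\<in>A. coeff (f i) (d i))"
    by auto
  have dx: "degree (f x) \<le> d x" using insert.prems by simp
  have "degree (f x * (\<Prod>i\<in>A. f i)) \<le> d x + (\<Sum>i\<in>A. d i)"
    using degree_mult_le[of "f x" "\<Prod>i\<in>A. f i"] dx IH(1) by linarith
  then show ?case using insert.hyps coeff_mult_top[OF dx IH(1)] IH(2) by simp
qed simp

text \<open>
  The matrix of the leading row vectors decides whether the degree of the determinant is the sum of
  the row degrees.
\<close>

lemma degree_coeff_det:
  fixes A :: "'k::comm_ring_1 poly ^ 4 ^ 4"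
  assumes "\<And>i j. degree (A $ i $ j) \<le> d i"
  shows "degree (Determinants.det A) \<le> (\<Sum>i\<in>UNIV. d i)"
    and "coeff (Determinants.det A) (\<Sum>i\<in>UNIV. d i) = Determinants.det (\<chi> i j. coeff (A $ i $ j) (d i))"
proof -
  let ?N = "\<Sum>i\<in>UNIV. d i"
  have *: "degree (\<Prod>i\<in>UNIV. A $ i $ p i) \<le> ?N" "coeff (\<Prod>i\<in>UNIV. A $ i $ p i) ?N = (\<Prod>i\<in>UNIV. coeff (A $ i $ p i) (d i))" for p
    using degree_coeff_prod[of UNIV "\<lambda>i. A $ i $ p i" d] assms by auto
  have of_int: "(of_int z :: 'k poly) * q = smult (of_int z) q" for z q
    by (simp add: of_int_poly)
  show "degree (Determinants.det A) \<le> ?N"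
    unfolding Determinants.det_def of_int
    by (intro degree_sum_le order_trans[OF degree_smult_le *(1)]) simp
  show "coeff (Determinants.det A) ?N = Determinants.det (\<chi> i j. coeff (A $ i $ j) (d i))"
    unfolding Determinants.det_def of_int by (simp add: coeff_sum *)
qed

lemma invertible_rowsI:
  fixes L :: "'k::field ^ 4 ^ 4"
  assumes "\<And>c. (\<Sum>i\<in>UNIV. c i *s (L $ i)) = 0 \<Longrightarrow> (\<And>i. c i = 0)"
  shows "invertible L"
proof -
  have "\<exists>B. L ** B = Finite_Cartesian_Product.mat 1"
    unfolding matrix_right_invertible_independent_rows using assms by (auto simp: Finite_Cartesian_Product.row_def vec_nth_inverse)
  then show ?thesis by (simp add: invertible_right_inverse)
qed

lemma invertible_kernel:
  fixes L :: "'k::field ^ 4 ^ 4"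
  assumes "invertible L" "\<And>i. dot (L $ i) x = 0"
  shows "x = 0"
proof -
  have "L *v x = 0" using assms(2) by (simp add: vec_ext_iff matrix_vector_mult_def dot_def)
  moreover obtain B where "B ** L = Finite_Cartesian_Product.mat 1" using assms(1) invertible_left_inverse by blast
  ultimately show ?thesis by (metis matrix_left_invertible_ker)
qed

lemma sorted_enumeration_4:
  fixes l :: 4 and f :: "4 \<Rightarrow> nat"
  shows "\<exists>i1 i2 i3. distinct [l, i1, i2, i3] \<and> (UNIV :: 4 set) = {l, i1, i2, i3} \<and> f i1 \<le> f i2 \<and> f i2 \<le> f i3"
proof -
  obtain ys where ys: "set ys = UNIV - {l}" "distinct ys" using finite_distinct_list[of "UNIV - {l}"] by auto
  define xs where "xs = sort_key f ys"
  have xs: "set xs = UNIV - {l}" "distinct xs" "sorted (map f xs)" using ys by (auto simp: xs_def)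
  have "length xs = card (UNIV - {l})" using xs distinct_card by metis
  then have "length xs = 3" by simp
  then obtain i1 i2 i3 where "xs = [i1, i2, i3]"
    by (metis (no_types, opaque_lifting) length_0_conv length_Suc_conv numeral_3_eq_3)
  then have "UNIV - {l} = {i1, i2, i3}" "distinct [i1, i2, i3]" "f i1 \<le> f i2" "f i2 \<le> f i3" using xs by auto
  moreover have "distinct [l, i1, i2, i3]" "insert l (UNIV - {l}) = UNIV"
    using calculation by auto
  ultimately show ?thesis by metis
qed

definition vdeg_le :: "int \<Rightarrow> 'k::zero poly ^ 4 \<Rightarrow> bool" where
  "vdeg_le d w \<longleftrightarrow> (\<forall>k. deg_le d (w $ k))"

text \<open>
  A splitting \<open>O(-m1) \<oplus> O(-m2) \<oplus> O(-m3)\<close> of the kernel bundle of \<open>S : O\<^sup>4 \<rightarrow> O(n)\<close> on the projective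
  line, in terms of global sections.  The three quantified clauses say that sections of the kernel are
  combinations of the \<open>Q\<^sub>i\<close> with the expected degrees, that the vectors orthogonal to all \<open>Q\<^sub>i\<close> are the
  multiples of \<open>S\<close>, and that the dual map \<open>O(d)\<^sup>4 \<rightarrow> \<Oplus> O(d + m\<^sub>i)\<close> is surjective on sections when the
  first cohomology of its kernel \<open>O(d - n)\<close> vanishes, that is for \<open>d \<ge> n - 1\<close>.
\<close>

definition minimal_basis_of ::
  "'k::field poly ^ 4 \<Rightarrow> nat \<Rightarrow> 'k poly ^ 4 \<Rightarrow> 'k poly ^ 4 \<Rightarrow> 'k poly ^ 4 \<Rightarrow> nat \<Rightarrow> nat \<Rightarrow> nat \<Rightarrow> bool" where
  "minimal_basis_of S n Q1 Q2 Q3 m1 m2 m3 \<longleftrightarrow>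
     m1 \<le> m2 \<and> m2 \<le> m3 \<and> m1 + m2 + m3 = n \<and>
     vdeg_le (int m1) Q1 \<and> vdeg_le (int m2) Q2 \<and> vdeg_le (int m3) Q3 \<and>
     dot S Q1 = 0 \<and> dot S Q2 = 0 \<and> dot S Q3 = 0 \<and>
     (\<forall>w d. dot S w = 0 \<longrightarrow> vdeg_le d w \<longrightarrow> (\<exists>c1 c2 c3. w = c1 *s Q1 + c2 *s Q2 + c3 *s Q3 \<and>
        deg_le (d - int m1) c1 \<and> deg_le (d - int m2) c2 \<and> deg_le (d - int m3) c3)) \<and>
     (\<forall>c d. dot c Q1 = 0 \<longrightarrow> dot c Q2 = 0 \<longrightarrow> dot c Q3 = 0 \<longrightarrow> vdeg_le d c \<longrightarrow>
        (\<exists>e. c = e *s S \<and> deg_le (d - int n) e)) \<and>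
     (\<forall>r1 r2 r3 d. int n - 1 \<le> d \<longrightarrow> deg_le (d + int m1) r1 \<longrightarrow> deg_le (d + int m2) r2 \<longrightarrow> deg_le (d + int m3) r3 \<longrightarrow>
        (\<exists>c. vdeg_le d c \<and> dot c Q1 = r1 \<and> dot c Q2 = r2 \<and> dot c Q3 = r3))"

text \<open>
  Take four generators of least total size.  Their leading vectors are orthogonal to the nonzero
  leading vector of \<open>S\<close>, so they are dependent and one generator is zero.  The other three have
  independent leading vectors, hence the degree of a combination is the largest degree of a summand.
  Together with a vector \<open>E\<close> such that \<open>S\<cdot>E = 1\<close> they form a basis of the whole free module, whose
  determinant is a constant; comparison with the leading coefficients gives the sum of the degrees.
\<close>

lemma minimal_basis_exists:
  fixes S :: "'k::alg_closed_field poly ^ 4"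
  assumes degS: "\<And>k. degree (S $ k) \<le> n" and noroot: "\<And>z. \<exists>k. poly (S $ k) z \<noteq> 0"
    and topS: "\<exists>k. coeff (S $ k) n \<noteq> 0"
  shows "\<exists>Q1 Q2 Q3 m1 m2 m3. minimal_basis_of S n Q1 Q2 Q3 m1 m2 m3"
proof -
  obtain w where "(\<Sum>i\<in>UNIV. w i * S $ i) = 1" using bezout_alg_closed[of "($) S"] noroot by auto
  then have "dot S (\<chi> i. w i) = 1" by (simp add: dot_def mult.commute)
  then obtain E where E: "dot S E = 1" by blast
  obtain kS where kS: "coeff (S $ kS) n \<noteq> 0" using topS by blast
  define T where "T = vtop n S"
  have TkS: "T $ kS \<noteq> 0" using kS by (simp add: T_def vtop_def)
  obtain Q where gen: "generates S Q"
    and min: "\<And>Q'. generates S Q' \<Longrightarrow> (\<Sum>i\<in>UNIV. vsize (Q i)) \<le> (\<Sum>i\<in>UNIV. vsize (Q' i))"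
    using ex_has_least_nat[of "generates S" _ "\<lambda>Q. \<Sum>i\<in>UNIV. vsize (Q i)"] generates_exists[OF E] by blast
  have SQ: "dot S (Q i) = 0" for i using gen by (simp add: generates_def)
  define m where "m = (\<lambda>i. vdegree (Q i))"
  define lc where "lc = (\<lambda>i. vtop (m i) (Q i))"
  have degQ: "degree (Q i $ k) \<le> m i" for i k by (simp add: m_def vdegree_ge)
  have lcT: "dot (lc i) T = 0" for i
    using coeff_dot_top[of "Q i" "m i" S n] degQ degS SQ[of i] by (simp add: lc_def T_def dot_commute)
  have indep: "\<kappa> i = 0" if "(\<Sum>i\<in>UNIV. \<kappa> i *s lc i) = 0" "\<And>i. Q i = 0 \<Longrightarrow> \<kappa> i = 0" for \<kappa> i
    using minimal_generators_independent[OF gen min] that by (simp add: lc_def m_def)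
  have "\<exists>l. Q l = 0"
  proof (rule ccontr)
    assume *: "\<nexists>l. Q l = 0"
    have "invertible (\<chi> i. lc i)" by (rule invertible_rowsI) (use indep * in auto)
    then have "T = 0" by (rule invertible_kernel) (simp add: lcT)
    then show False using TkS by simp
  qed
  then obtain l where l: "Q l = 0" by blast
  \<comment> \<open>The row of the zero generator is replaced by \<open>E\<close>: the rows of \<open>A\<close> are a basis of the free
    module, with \<open>C\<close> below containing the coordinates of the unit vectors.\<close>
  define A where "A = (\<chi> i. if i = l then E else Q i)"
  have decomp: "\<exists>c. w = dot S w *s E + (\<Sum>i\<in>UNIV - {l}. c i *s Q i)" for w
  proof -
    have "dot S (w - dot S w *s E) = 0" by (simp add: dot_diff_right dot_smult_right E)
    then obtain c where c: "w - dot S w *s E = (\<Sum>i\<in>UNIV. c i *s Q i)" using gen by (auto simp: generates_def)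
    have "(\<Sum>i\<in>UNIV. c i *s Q i) = (\<Sum>i\<in>UNIV - {l}. c i *s Q i)" by (simp add: sum_split_at[of _ l] l)
    then have "w = dot S w *s E + (\<Sum>i\<in>UNIV - {l}. c i *s Q i)" using c by (simp add: algebra_simps)
    then show ?thesis by blast
  qed
  have "\<forall>k. \<exists>c. axis k 1 = S $ k *s E + (\<Sum>i\<in>UNIV - {l}. c i *s Q i)"
  proof
    fix k show "\<exists>c. axis k 1 = S $ k *s E + (\<Sum>i\<in>UNIV - {l}. c i *s Q i)"
      using decomp[of "axis k 1"] by (simp only: dot_axis)
  qed
  from choice[OF this] obtain C where C': "\<forall>k. axis k 1 = S $ k *s E + (\<Sum>i\<in>UNIV - {l}. C k i *s Q i)" ..
  note C = C'[rule_format]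
  have CA: "(\<chi> k i. if i = l then S $ k else C k i) ** A = Finite_Cartesian_Product.mat 1"
  proof (rule vec_ext_iff[THEN iffD2], intro allI, rule vec_ext_iff[THEN iffD2], intro allI)
    fix k j
    have "((\<chi> k i. if i = l then S $ k else C k i) ** A) $ k $ j = (\<Sum>i\<in>UNIV. (if i = l then S $ k else C k i) * A $ i $ j)"
      by (simp add: matrix_matrix_mult_def)
    also have "\<dots> = S $ k * E $ j + (\<Sum>i\<in>UNIV - {l}. C k i * Q i $ j)"
      unfolding sum_split_at[of _ l] by (simp add: A_def)
    also have "\<dots> = (axis k 1 :: 'k poly ^ 4) $ j" unfolding C by simp
    also have "\<dots> = Finite_Cartesian_Product.mat 1 $ k $ j" by (auto simp: axis_def Finite_Cartesian_Product.mat_def)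
    finally show "((\<chi> k i. if i = l then S $ k else C k i) ** A) $ k $ j = Finite_Cartesian_Product.mat 1 $ k $ j" .
  qed
  have "Determinants.det (\<chi> k i. if i = l then S $ k else C k i) * Determinants.det A = 1"
    using arg_cong[OF CA, of Determinants.det] by (simp only: Determinants.det_mul Determinants.det_I)
  then have "1 = Determinants.det A * Determinants.det (\<chi> k i. if i = l then S $ k else C k i)" by (simp add: mult.commute)
  then have "Determinants.det A dvd 1" by (rule dvdI)
  then obtain c0 where c0: "Determinants.det A = [:c0:]" "c0 dvd 1"
    unfolding is_unit_poly_iff by blast
  have c0nz: "c0 \<noteq> 0"
  proof
    assume "c0 = 0"
    then have "0 dvd (1::'k)" using c0(2) by (simp only:)
    then show False by simp
  qed
  have Qnz: "Q i \<noteq> 0" if "i \<noteq> l" for i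
  proof
    assume "Q i = 0"
    then have "A = (\<chi> j. if j = i then 0 else A $ j)"
      using that by (auto simp: A_def vec_ext_iff)
    then have "Determinants.det A = 0" using Determinants.det_row_0[of i "($) A"] by simp
    then show False using c0 c0nz by simp
  qed
  have indep': "\<kappa> i = 0" if "(\<Sum>i\<in>UNIV - {l}. \<kappa> i *s lc i) = 0" "i \<noteq> l" for \<kappa> i
  proof -
    have "(if i = l then 0 else \<kappa> i) = 0"
    proof (rule indep)
      have "(\<Sum>i\<in>UNIV. (if i = l then 0 else \<kappa> i) *s lc i) = (\<Sum>i\<in>UNIV - {l}. \<kappa> i *s lc i)"
        unfolding sum_split_at[of _ l] by simp
      then show "(\<Sum>i\<in>UNIV. (if i = l then 0 else \<kappa> i) *s lc i) = 0" using that by simp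
      show "(if i = l then 0 else \<kappa> i) = 0" if "Q i = 0" for i using Qnz that by auto
    qed
    then show ?thesis using that by simp
  qed
  \<comment> \<open>The leading vectors are completed by a unit vector that is not orthogonal to the leading
    vector \<open>T\<close> of \<open>S\<close>.\<close>
  define L where "L = (\<chi> i. if i = l then axis kS 1 else lc i)"
  have invL: "invertible L"
  proof (rule invertible_rowsI)
    fix c i assume c: "(\<Sum>i\<in>UNIV. c i *s L $ i) = 0"
    have c': "c l *s axis kS 1 + (\<Sum>i\<in>UNIV - {l}. c i *s lc i) = 0"
      using c unfolding sum_split_at[of _ l] by (simp add: L_def)
    have "dot T (c l *s axis kS 1 + (\<Sum>i\<in>UNIV - {l}. c i *s lc i)) = c l * T $ kS"
      by (simp add: dot_add_right dot_smult_right dot_axis dot_sum_right lcT[unfolded dot_commute[of _ T]])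
    then have cl: "c l = 0" using c' TkS by simp
    then have "(\<Sum>i\<in>UNIV - {l}. c i *s lc i) = 0" using c' by simp
    then show "c i = 0" using indep' cl by (cases "i = l") auto
  qed
  have det_row: "Determinants.det (\<chi> i. if i = l then v else A $ i) = dot S v * Determinants.det A" for v
  proof -
    obtain c where c: "v = dot S v *s E + (\<Sum>i\<in>UNIV - {l}. c i *s Q i)" using decomp by blast
    define e where "e = (\<lambda>i. if i = l then dot S v else c i)"
    have v: "v = (\<Sum>i\<in>UNIV. e i *s A $ i)"
      unfolding sum_split_at[of _ l] using c by (simp add: e_def A_def)
    have "Determinants.det (\<chi> i. if i = l then v else A $ i) = (\<Sum>j\<in>UNIV. Determinants.det (\<chi> i. if i = l then e j *s A $ j else A $ i))"
      unfolding v by (rule Determinants.det_linear_row_sum) simp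
    also have "\<dots> = (\<Sum>j\<in>UNIV. e j * Determinants.det (\<chi> i. if i = l then A $ j else A $ i))"
      by (simp add: Determinants.det_row_mul)
    also have "\<dots> = e l * Determinants.det A"
    proof -
      have "Determinants.det (\<chi> i. if i = l then A $ j else A $ i) = 0" if "j \<noteq> l" for j
        by (rule Determinants.det_identical_rows[of l j]) (use that in \<open>auto simp: Finite_Cartesian_Product.row_def\<close>)
      moreover have "(\<chi> i. if i = l then A $ l else A $ i) = A"
        by (simp add: vec_ext_iff)
      ultimately show ?thesis unfolding sum_split_at[of _ l] by simp
    qed
    finally show ?thesis by (simp add: e_def)
  qed
  define N where "N = (\<Sum>i\<in>UNIV - {l}. m i)"
  have "N = n"
  proof -
    \<comment> \<open>The determinant of \<open>B\<close> is a constant multiple of \<open>S $ kS\<close>, which has degree \<open>n\<close>; its row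
      degrees sum to \<open>N\<close>, and the leading rows are those of the invertible matrix \<open>L\<close>.\<close>
    define B where "B = (\<chi> i. if i = l then axis kS (1 :: 'k poly) else A $ i)"
    define b where "b = (\<lambda>i. if i = l then 0 else m i)"
    have degB: "degree (B $ i $ j) \<le> b i" for i j
      by (auto simp: B_def b_def A_def degQ axis_def)
    have sb: "(\<Sum>i\<in>UNIV. b i) = N" unfolding sum_split_at[of _ l] by (simp add: b_def N_def)
    have "(\<chi> i j. coeff (B $ i $ j) (b i)) = L"
      by (simp add: vec_ext_iff B_def b_def L_def A_def lc_def vtop_def axis_def)
    then have d: "degree (Determinants.det B) \<le> N" "coeff (Determinants.det B) N = Determinants.det L"
      using degree_coeff_det[of B b, OF degB] unfolding sb by simp_all
    have detB: "Determinants.det B = smult c0 (S $ kS)"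
      unfolding B_def det_row dot_axis c0 by simp
    have "Determinants.det L \<noteq> 0" using invL invertible_det_nz by blast
    then have "coeff (S $ kS) N \<noteq> 0" using d(2) detB by auto
    then have "N \<le> n" using degS[of kS] le_degree order_trans by blast
    moreover have "n \<le> degree (Determinants.det B)" unfolding detB using kS c0nz by (simp add: le_degree)
    then have "n \<le> N" using d(1) by simp
    ultimately show ?thesis by simp
  qed
  \<comment> \<open>No cancellation of leading terms: a combination of degree \<open>d\<close> has coefficients of degree at
    most \<open>d - m i\<close>.\<close>
  have predict: "deg_le (d - int (m i)) (c i)" if w: "w = (\<Sum>i\<in>UNIV - {l}. c i *s Q i)" and vbw: "vdeg_le d w" and il: "i \<noteq> l" for w d c i
  proof -
    define P where "P e \<longleftrightarrow> (\<forall>i\<in>UNIV - {l}. deg_le (e - int (m i)) (c i))" for e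
    have step: "P (e - 1)" if P: "P e" and ed: "e > d" for e
    proof (cases "e < 0")
      case True
      have "c i = 0" if "i \<noteq> l" for i using P that True by (auto simp: P_def intro!: deg_le_neg[of "e - int (m i)"])
      then show ?thesis by (simp add: P_def)
    next
      case False
      define \<kappa> where "\<kappa> = (\<lambda>i. if e - int (m i) < 0 then 0 else coeff (c i) (nat (e - int (m i))))"
      have "(\<Sum>i\<in>UNIV - {l}. \<kappa> i *s lc i) = 0"
      proof (rule vec_ext_iff[THEN iffD2], intro allI)
        fix k
        have "deg_le d (w $ k)" using vbw by (simp add: vdeg_le_def)
        then have "coeff (w $ k) (nat e) = 0" using False ed unfolding deg_le_def
          by (metis int_nat_eq linorder_not_less)
        moreover have "coeff (c i * Q i $ k) (nat e) = \<kappa> i * lc i $ k" if "i \<in> UNIV - {l}" for i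
          using deg_le_coeff_mult[of "e - int (m i)" "c i" "Q i $ k" "m i"] P that degQ False
          by (simp add: P_def \<kappa>_def lc_def vtop_def)
        ultimately show "(\<Sum>i\<in>UNIV - {l}. \<kappa> i *s lc i) $ k = 0 $ k" by (simp add: w coeff_sum)
      qed
      then have \<kappa>0: "\<kappa> i = 0" if "i \<noteq> l" for i using indep' that by blast
      show ?thesis unfolding P_def
      proof
        fix i assume i: "i \<in> UNIV - {l}"
        have "deg_le (e - int (m i) - 1) (c i)"
          by (rule deg_le_step) (use P i \<kappa>0[of i] in \<open>auto simp: P_def \<kappa>_def split: if_splits\<close>)
        then show "deg_le (e - 1 - int (m i)) (c i)" by (simp add: algebra_simps)
      qed
    qed
    define M where "M = max d (int (\<Sum>i\<in>UNIV. m i + degree (c i)))"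
    have "P M" unfolding P_def
    proof
      fix i assume "i \<in> UNIV - {l}"
      have "m i + degree (c i) \<le> (\<Sum>i\<in>UNIV. m i + degree (c i))" by (rule member_le_sum) auto
      then have "int (degree (c i)) \<le> M - int (m i)" unfolding M_def by linarith
      moreover have "deg_le (int (degree (c i))) (c i)" by (simp add: deg_le_iff_degree)
      ultimately show "deg_le (M - int (m i)) (c i)" using deg_le_mono by blast
    qed
    moreover have "P d" if "P M" "M \<ge> d" for M using that(2,1)
    proof (induction rule: int_ge_induct)
      case (step i)
      have "P (i + 1 - 1)" by (rule \<open>\<And>e. P e \<Longrightarrow> e > d \<Longrightarrow> P (e - 1)\<close>) (use step in auto)
      then show ?case using step by simp
    qed
    ultimately have "P d" by (simp add: M_def)
    then show ?thesis using il by (simp add: P_def)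
  qed
  have gens: "\<exists>c. w = (\<Sum>i\<in>UNIV - {l}. c i *s Q i) \<and> (\<forall>i\<in>UNIV - {l}. deg_le (d - int (m i)) (c i))"
    if "dot S w = 0" "vdeg_le d w" for w d
  proof -
    obtain c where "w = (\<Sum>i\<in>UNIV - {l}. c i *s Q i)" using decomp[of w] \<open>dot S w = 0\<close> by auto
    then show ?thesis using predict that by blast
  qed
  have via: "dot c (axis k 1) = S $ k * dot c E + (\<Sum>i\<in>UNIV - {l}. C k i * dot c (Q i))" for c k
    unfolding C[of k] by (simp add: dot_add_right dot_sum_right dot_smult_right)
  have ker: "\<exists>e. c = e *s S \<and> deg_le (d - int n) e" if c: "\<And>i. i \<noteq> l \<Longrightarrow> dot c (Q i) = 0" and vbc: "vdeg_le d c" for c d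
  proof -
    define e where "e = dot c E"
    have ce: "c $ k = e * S $ k" for k
      using via[of c k] c by (simp add: dot_axis e_def mult.commute)
    have "deg_le (d - int n) e"
    proof (cases "e = 0")
      case False
      have "S $ kS \<noteq> 0" using kS by auto
      moreover have "degree (S $ kS) = n" using kS degS[of kS] le_degree by (meson le_antisym)
      ultimately have "degree (c $ kS) = degree e + n" "c $ kS \<noteq> 0" using False by (auto simp: ce degree_mult_eq)
      then have "int (degree e + n) \<le> d" using vbc unfolding vdeg_le_def deg_le_def by (metis leading_coeff_0_iff)
      then have "int (degree e) \<le> d - int n" by simp
      then show ?thesis using deg_le_mono deg_le_iff_degree by blast
    qed simp
    moreover have "c = e *s S" by (simp add: vec_ext_iff ce)
    ultimately show ?thesis by blast
  qed
  have lift: "\<exists>c. vdeg_le d c \<and> (\<forall>i\<in>UNIV - {l}. dot c (Q i) = r i)"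
    if nd: "int n - 1 \<le> d" and r: "\<And>i. i \<noteq> l \<Longrightarrow> deg_le (d + int (m i)) (r i)" for r d
  proof -
    define c' where "c' = (\<chi> k. \<Sum>i\<in>UNIV - {l}. C k i * r i)"
    have c'Q: "dot c' (Q j) = r j" if jl: "j \<noteq> l" for j
    proof -
      define e where "e = (\<lambda>i. \<Sum>k\<in>UNIV. Q j $ k * C k i)"
      have "Q j = (\<Sum>k\<in>UNIV. Q j $ k *s axis k 1)" by (rule vec_axis_expansion)
      also have "\<dots> = (\<Sum>k\<in>UNIV. (S $ k * Q j $ k) *s E) + (\<Sum>k\<in>UNIV. \<Sum>i\<in>UNIV - {l}. (Q j $ k * C k i) *s Q i)"
        unfolding C by (simp add: vec_ext_iff distrib_left sum.distrib sum_distrib_left mult_ac)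
      also have "(\<Sum>k\<in>UNIV. (S $ k * Q j $ k) *s E) = dot S (Q j) *s E"
        by (simp add: dot_def vec_ext_iff sum_distrib_right)
      also have "(\<Sum>k\<in>UNIV. \<Sum>i\<in>UNIV - {l}. (Q j $ k * C k i) *s Q i) = (\<Sum>i\<in>UNIV - {l}. e i *s Q i)"
        by (subst sum.swap) (simp add: e_def vec_ext_iff sum_distrib_right)
      finally have Qj: "Q j = (\<Sum>i\<in>UNIV - {l}. e i *s Q i)" by (simp add: SQ)
      have "(\<Sum>i\<in>UNIV - {l}. (if i = j then 1 else 0) *s Q i) = (\<Sum>i\<in>UNIV - {l}. if i = j then Q i else 0)"
        by (rule sum.cong) auto
      also have "\<dots> = Q j" using jl by simp
      finally have Qj': "(\<Sum>i\<in>UNIV - {l}. (if i = j then 1 else 0) *s Q i) = Q j" .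
      have "0 = (\<Sum>i\<in>UNIV - {l}. (e i - (if i = j then 1 else 0)) *s Q i)"
        using Qj Qj' by (simp add: vec.scale_left_diff_distrib sum_subtractf vector_sub_rdistrib)
      then have "deg_le (-1 - int (m i)) (e i - (if i = j then 1 else 0))" if "i \<noteq> l" for i
        by (rule predict) (use that in \<open>auto simp: vdeg_le_def\<close>)
      then have e: "e i = (if i = j then 1 else 0)" if "i \<noteq> l" for i
        using deg_le_neg[of "-1 - int (m i)" "e i - (if i = j then 1 else 0)"] that by simp
      have "dot c' (Q j) = (\<Sum>k\<in>UNIV. \<Sum>i\<in>UNIV - {l}. Q j $ k * C k i * r i)"
        unfolding dot_def c'_def by (intro sum.cong) (simp_all add: sum_distrib_left sum_distrib_right mult_ac)
      also have "\<dots> = (\<Sum>i\<in>UNIV - {l}. e i * r i)"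
        by (subst sum.swap) (simp add: e_def sum_distrib_right)
      also have "\<dots> = (\<Sum>i\<in>UNIV - {l}. if i = j then r i else 0)"
        by (rule sum.cong) (use e in auto)
      also have "\<dots> = r j" using jl by simp
      finally show ?thesis .
    qed
    \<comment> \<open>A multiple of \<open>S\<close> may be subtracted. With the entry at \<open>kS\<close> reduced to degree less than \<open>n
      \<le> d + 1\<close>, invertibility of \<open>L\<close> bounds all other entries by \<open>d\<close>.\<close>
    define c where "c = c' - (c' $ kS div S $ kS) *s S"
    have cQ: "dot c (Q i) = r i" if "i \<noteq> l" for i
      using c'Q[OF that] SQ[of i] by (simp add: c_def dot_commute[of _ "Q i"] dot_diff_right dot_smult_right)
    have ckS: "c $ kS = c' $ kS mod S $ kS" by (simp add: c_def minus_div_mult_eq_mod)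
    have SkS: "S $ kS \<noteq> 0" "degree (S $ kS) = n" using kS degS[of kS] le_degree by (auto intro: le_antisym)
    have ckS0: "coeff (c $ kS) j = 0" if "j \<ge> n" for j
    proof (cases "c $ kS = 0")
      case False
      then have "degree (c $ kS) < n" using degree_mod_less'[OF SkS(1), of "c' $ kS"] SkS(2) by (simp add: ckS)
      then show ?thesis using that by (intro coeff_eq_0) simp
    qed simp
    have step: "vdeg_le (e - 1) c" if ve: "vdeg_le e c" and ed: "e > d" for e
    proof (cases "e < 0")
      case True
      then have "c $ k = 0" for k using ve deg_le_neg unfolding vdeg_le_def by blast
      then show ?thesis by (simp add: vdeg_le_def)
    next
      case False
      have dc: "degree (c $ k) \<le> nat e" for k using ve deg_le_degree unfolding vdeg_le_def by blast
      have "vtop (nat e) c = 0"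
      proof (rule invertible_kernel[OF invL])
        fix i
        show "dot (L $ i) (vtop (nat e) c) = 0"
        proof (cases "i = l")
          case True
          then have "dot (L $ i) (vtop (nat e) c) = coeff (c $ kS) (nat e)"
            by (simp add: L_def dot_commute[of "axis kS 1"] dot_axis vtop_def)
          also have "\<dots> = 0" using nd ed by (intro ckS0) linarith
          finally show ?thesis .
        next
          case il: False
          have "dot (L $ i) (vtop (nat e) c) = coeff (dot (Q i) c) (m i + nat e)"
            using coeff_dot_top[of "Q i" "m i" c "nat e"] degQ dc il by (simp add: L_def lc_def)
          also have "\<dots> = coeff (r i) (m i + nat e)" using cQ[OF il] by (simp add: dot_commute)
          also have "\<dots> = 0"
            using r[OF il] ed False unfolding deg_le_def by (metis add.commute int_nat_eq linorder_not_le nat_le_eq_zle of_nat_add add_le_cancel_right linorder_not_less)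
          finally show ?thesis .
        qed
      qed
      then have "coeff (c $ k) (nat e) = 0" for k by (simp add: vtop_def vec_ext_iff)
      then show ?thesis using ve unfolding vdeg_le_def by (auto intro: deg_le_step)
    qed
    have "vdeg_le (max d (int (vdegree c))) c"
      unfolding vdeg_le_def using vdegree_ge deg_le_iff_degree deg_le_mono by (metis max.cobounded2)
    moreover have "vdeg_le d c" if "vdeg_le M c" "M \<ge> d" for M using that(2,1)
    proof (induction rule: int_ge_induct)
      case (step i)
      have "vdeg_le (i + 1 - 1) c" by (rule \<open>\<And>e. vdeg_le e c \<Longrightarrow> e > d \<Longrightarrow> vdeg_le (e - 1) c\<close>) (use step in auto)
      then show ?case using step by simp
    qed
    ultimately have "vdeg_le d c" by simp
    then show ?thesis using cQ by blast
  qed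
  obtain i1 i2 i3 where i: "distinct [l, i1, i2, i3]" "(UNIV :: 4 set) = {l, i1, i2, i3}"
    "m i1 \<le> m i2" "m i2 \<le> m i3"
    using sorted_enumeration_4[of l m] by blast
  have UL: "UNIV - {l} = {i1, i2, i3}" using i(1,2) by auto
  have sum3: "(\<Sum>i\<in>UNIV - {l}. f i) = f i1 + f i2 + f i3" for f :: "4 \<Rightarrow> 'b::comm_monoid_add"
    unfolding UL using i(1) by (simp add: add.assoc)
  have neq: "i1 \<noteq> l" "i2 \<noteq> l" "i3 \<noteq> l" "i1 \<noteq> i2" "i1 \<noteq> i3" "i2 \<noteq> i3" using i(1) by auto
  have vbQ: "vdeg_le (int (m i)) (Q i)" for i by (simp add: vdeg_le_def deg_le_iff_degree degQ)
  have "minimal_basis_of S n (Q i1) (Q i2) (Q i3) (m i1) (m i2) (m i3)"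
    unfolding minimal_basis_of_def
  proof (intro conjI allI impI)
    show "m i1 + m i2 + m i3 = n" using \<open>N = n\<close> by (simp add: N_def sum3)
  next
    fix w d assume "dot S w = 0" "vdeg_le d w"
    from gens[OF this] obtain c where "w = (\<Sum>i\<in>UNIV - {l}. c i *s Q i)" "\<forall>i\<in>UNIV - {l}. deg_le (d - int (m i)) (c i)" by blast
    then have "w = c i1 *s Q i1 + c i2 *s Q i2 + c i3 *s Q i3" "deg_le (d - int (m i1)) (c i1)"
      "deg_le (d - int (m i2)) (c i2)" "deg_le (d - int (m i3)) (c i3)"
      unfolding sum3 using neq by blast+
    then show "\<exists>c1 c2 c3. w = c1 *s Q i1 + c2 *s Q i2 + c3 *s Q i3 \<and>
        deg_le (d - int (m i1)) c1 \<and> deg_le (d - int (m i2)) c2 \<and> deg_le (d - int (m i3)) c3" by blast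
  next
    fix c d assume c: "dot c (Q i1) = 0" "dot c (Q i2) = 0" "dot c (Q i3) = 0" "vdeg_le d c"
    have "dot c (Q i) = 0" if "i \<noteq> l" for i
    proof -
      have "i \<in> {i1, i2, i3}" using that UL by blast
      then show ?thesis using c by auto
    qed
    then show "\<exists>e. c = e *s S \<and> deg_le (d - int n) e" using ker c(4) by blast
  next
    fix r1 r2 r3 :: "'k poly" and d assume nd: "int n - 1 \<le> d" and r: "deg_le (d + int (m i1)) r1" "deg_le (d + int (m i2)) r2" "deg_le (d + int (m i3)) r3"
    define r where "r = (\<lambda>i. if i = i1 then r1 else if i = i2 then r2 else r3)"
    have "deg_le (d + int (m i)) (r i)" if "i \<noteq> l" for i
    proof -
      have "i \<in> {i1, i2, i3}" using that UL by blast
      then show ?thesis using r neq by (auto simp: r_def)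
    qed
    from lift[OF nd this] obtain c where "vdeg_le d c" "\<forall>i\<in>UNIV - {l}. dot c (Q i) = r i" by blast
    then show "\<exists>c. vdeg_le d c \<and> dot c (Q i1) = r1 \<and> dot c (Q i2) = r2 \<and> dot c (Q i3) = r3"
      using neq by (intro exI[of _ c]) (simp add: UL r_def)
  qed (use i SQ vbQ in auto)
  then show ?thesis by blast
qed

section \<open>Substitution in polynomials\<close>

lemma comm_ring_homI:
  fixes h :: "'a::comm_ring_1 \<Rightarrow> 'b::comm_ring_1"
  assumes "\<And>x y. h (x + y) = h x + h y" "\<And>x y. h (x * y) = h x * h y" "h 1 = 1"
  shows "comm_ring_hom h"
proof -
  have "h 0 + h 0 = h 0" using assms(1)[of 0 0] by simp
  then have "h 0 = 0" by simp
  then show ?thesis using assms by unfold_locales auto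
qed

abbreviation "lk \<equiv> Poly_Mapping.lookup"

definition monom_val :: "('v \<Rightarrow> 'r::comm_ring_1) \<Rightarrow> ('v \<Rightarrow>\<^sub>0 nat) \<Rightarrow> 'r" where
  "monom_val x m = (\<Prod>i\<in>Poly_Mapping.keys m. x i ^ lk m i)"

lemma monom_val_superset:
  assumes "finite A" "Poly_Mapping.keys m \<subseteq> A"
  shows "monom_val x m = (\<Prod>i\<in>A. x i ^ lk m i)"
  unfolding monom_val_def using assms
  by (intro prod.mono_neutral_left) (auto simp: in_keys_iff)

lemma monom_val_0 [simp]: "monom_val x 0 = 1" by (simp add: monom_val_def)

lemma monom_val_add: "monom_val x (m + m') = monom_val x m * monom_val x m'"
proof -
  let ?A = "Poly_Mapping.keys m \<union> Poly_Mapping.keys m'"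
  have "monom_val x (m + m') = (\<Prod>i\<in>?A. x i ^ lk (m + m') i)"
    using Poly_Mapping.keys_add[of m m'] by (intro monom_val_superset) auto
  also have "\<dots> = (\<Prod>i\<in>?A. x i ^ lk m i) * (\<Prod>i\<in>?A. x i ^ lk m' i)"
    by (simp add: lookup_add power_add prod.distrib)
  also have "\<dots> = monom_val x m * monom_val x m'" by (simp add: monom_val_superset[of ?A])
  finally show ?thesis .
qed

lemma monom_val_single: "monom_val x (Poly_Mapping.single i k) = x i ^ k"
  by (cases "k = 0") (simp_all add: monom_val_def)

text \<open>
  The ring homomorphism that extends \<open>h\<close> and sends the variables to \<open>x\<close>.
\<close>

definition subst_mp :: "('k::comm_ring_1 \<Rightarrow> 'r::comm_ring_1) \<Rightarrow> ('v \<Rightarrow> 'r) \<Rightarrow> ('v, 'k) mpoly \<Rightarrow> 'r" where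
  "subst_mp h x f = (\<Sum>m\<in>Poly_Mapping.keys f. h (lk f m) * monom_val x m)"

lemma eval_mp_subst_mp: "eval_mp x = subst_mp (\<lambda>c. c) x"
  by (simp add: fun_eq_iff eval_mp_def subst_mp_def monom_val_def)

lemma subst_mp_superset:
  assumes "h 0 = 0" "finite A" "Poly_Mapping.keys f \<subseteq> A"
  shows "subst_mp h x f = (\<Sum>m\<in>A. h (lk f m) * monom_val x m)"
  unfolding subst_mp_def using assms
  by (intro sum.mono_neutral_left) (auto simp: in_keys_iff)

lemma subst_mp_single: "h 0 = 0 \<Longrightarrow> subst_mp h x (Poly_Mapping.single m c) = h c * monom_val x m"
  by (cases "c = 0") (simp_all add: subst_mp_def)

lemma subst_mp_hom:
  assumes "comm_ring_hom h"
  shows "comm_ring_hom (subst_mp h x)"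
proof (rule comm_ring_homI)
  interpret comm_ring_hom h by fact
  have add: "subst_mp h x (f + g) = subst_mp h x f + subst_mp h x g" for f g
  proof -
    let ?A = "Poly_Mapping.keys f \<union> Poly_Mapping.keys g"
    have "subst_mp h x (f + g) = (\<Sum>m\<in>?A. h (lk (f + g) m) * monom_val x m)"
      using Poly_Mapping.keys_add[of f g] by (intro subst_mp_superset) auto
    also have "\<dots> = (\<Sum>m\<in>?A. h (lk f m) * monom_val x m) + (\<Sum>m\<in>?A. h (lk g m) * monom_val x m)"
      by (simp add: lookup_add hom_add distrib_right sum.distrib)
    also have "\<dots> = subst_mp h x f + subst_mp h x g" by (simp add: subst_mp_superset[of h ?A])
    finally show ?thesis .
  qed
  show "subst_mp h x (f + g) = subst_mp h x f + subst_mp h x g" for f g by (rule add)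
  have z: "subst_mp h x 0 = 0" by (simp add: subst_mp_def)
  have s: "subst_mp h x (Poly_Mapping.single m c * g) = subst_mp h x (Poly_Mapping.single m c) * subst_mp h x g" for m c g
    by (induction g rule: mpoly_induct)
      (simp_all add: z add distrib_left mult_single subst_mp_single hom_mult monom_val_add mult_ac)
  show "subst_mp h x (f * g) = subst_mp h x f * subst_mp h x g" for f g
    by (induction f rule: mpoly_induct) (simp_all add: z add distrib_right s)
  show "subst_mp h x 1 = 1"
    by (simp add: subst_mp_single flip: single_one)
qed

lemma eval_mp_hom: "comm_ring_hom (eval_mp (x :: 'v \<Rightarrow> 'k::comm_ring_1))"
  unfolding eval_mp_subst_mp by (rule subst_mp_hom) (rule comm_ring_homI, simp_all)

lemma var_power: "(var_mp i :: ('v, 'k::comm_ring_1) mpoly) ^ k = Poly_Mapping.single (Poly_Mapping.single i k) 1"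
  by (induction k) (simp_all add: mult_single single_one flip: single_add)

lemma monom_val_var: "monom_val var_mp m = (Poly_Mapping.single m 1 :: ('v, 'k::comm_ring_1) mpoly)"
proof -
  have "(\<Prod>i\<in>A. Poly_Mapping.single (f i) (1::'k)) = Poly_Mapping.single (\<Sum>i\<in>A. f i) 1"
    if "finite A" for A :: "'v set" and f :: "'v \<Rightarrow> 'v \<Rightarrow>\<^sub>0 nat"
    using that by (induction A rule: finite_induct) (simp_all add: mult_single)
  then have "monom_val var_mp m = Poly_Mapping.single (\<Sum>i\<in>Poly_Mapping.keys m. Poly_Mapping.single i (lk m i)) (1::'k)"
    unfolding monom_val_def var_power by simp
  also have "(\<Sum>i\<in>Poly_Mapping.keys m. Poly_Mapping.single i (lk m i)) = m"
  proof (rule poly_mapping_eqI)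
    fix k
    have "lk (\<Sum>i\<in>Poly_Mapping.keys m. Poly_Mapping.single i (lk m i)) k
      = (\<Sum>i\<in>Poly_Mapping.keys m. if i = k then lk m i else 0)"
      by (simp add: lookup_sum lookup_single when_def)
    then show "lk (\<Sum>i\<in>Poly_Mapping.keys m. Poly_Mapping.single i (lk m i)) k = lk m k"
      by (simp add: in_keys_iff)
  qed
  finally show ?thesis .
qed

lemma poly_mapping_sum_single: "f = (\<Sum>m\<in>Poly_Mapping.keys f. Poly_Mapping.single m (lk f m))"
proof (rule poly_mapping_eqI)
  fix k
  have "lk (\<Sum>m\<in>Poly_Mapping.keys f. Poly_Mapping.single m (lk f m)) k
    = (\<Sum>m\<in>Poly_Mapping.keys f. if m = k then lk f m else 0)"
    by (simp add: lookup_sum lookup_single when_def)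
  then show "lk f k = lk (\<Sum>m\<in>Poly_Mapping.keys f. Poly_Mapping.single m (lk f m)) k"
    by (simp add: in_keys_iff)
qed

lemma subst_mp_unique:
  fixes \<theta> :: "('v, 'k::comm_ring_1) mpoly \<Rightarrow> 'r::comm_ring_1"
  assumes "comm_ring_hom \<theta>" "\<And>c. \<theta> (const_mp c) = h c" "\<And>i. \<theta> (var_mp i) = x i"
  shows "\<theta> f = subst_mp h x f"
proof -
  interpret comm_ring_hom \<theta> by fact
  have h0: "h 0 = 0" using assms(2)[of 0] by simp
  have m: "\<theta> (Poly_Mapping.single m c) = h c * monom_val x m" for m c
  proof -
    have "Poly_Mapping.single m c = const_mp c * monom_val var_mp m"
      by (simp only: monom_val_var mult_single add_0 mult_1_right)
    then have "\<theta> (Poly_Mapping.single m c) = h c * \<theta> (monom_val var_mp m)" by (simp add: hom_mult assms)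
    also have "\<theta> (monom_val var_mp m) = monom_val x m"
      unfolding monom_val_def by (simp only: hom_prod hom_power assms)
    finally show ?thesis .
  qed
  have "\<theta> f = (\<Sum>m\<in>Poly_Mapping.keys f. \<theta> (Poly_Mapping.single m (lk f m)))"
    by (subst poly_mapping_sum_single) (rule hom_sum)
  then show ?thesis by (simp add: m subst_mp_def)
qed

text \<open>
  The counterpart of \<open>subst_mp\<close> for univariate polynomials, used for nested polynomial rings.
\<close>

definition poly_hom :: "('a::comm_ring_1 \<Rightarrow> 'b::comm_ring_1) \<Rightarrow> 'b \<Rightarrow> 'a poly \<Rightarrow> 'b" where
  "poly_hom h x P = poly (map_poly h P) x"

lemma map_poly_add_hom:
  assumes "comm_ring_hom h" shows "map_poly h (p + q) = map_poly h p + map_poly h q"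
proof -
  interpret comm_ring_hom h by fact
  show ?thesis by (rule poly_eqI) (simp add: coeff_map_poly hom_add)
qed

lemma map_poly_mult_hom:
  assumes "comm_ring_hom h" shows "map_poly h (p * q) = map_poly h p * map_poly h q"
proof -
  interpret comm_ring_hom h by fact
  show ?thesis by (rule poly_eqI) (simp add: coeff_map_poly coeff_mult hom_sum hom_mult)
qed

lemma poly_hom_hom:
  assumes "comm_ring_hom h" shows "comm_ring_hom (poly_hom h x)"
proof (rule comm_ring_homI)
  interpret comm_ring_hom h by fact
  show "poly_hom h x 1 = 1" by (simp add: poly_hom_def)
qed (simp_all add: poly_hom_def map_poly_add_hom[OF assms] map_poly_mult_hom[OF assms])

lemma poly_hom_const: "comm_ring_hom h \<Longrightarrow> poly_hom h x [:c:] = h c"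
proof -
  assume "comm_ring_hom h"
  then interpret comm_ring_hom h .
  have "map_poly h [:c:] = [:h c:]" by (rule poly_eqI) (simp add: coeff_map_poly coeff_pCons split: nat.split)
  then show ?thesis by (simp add: poly_hom_def)
qed

lemma poly_hom_X: "comm_ring_hom h \<Longrightarrow> poly_hom h x [:0, 1:] = x"
proof -
  assume "comm_ring_hom h"
  then interpret comm_ring_hom h .
  show ?thesis by (simp add: poly_hom_def map_poly_pCons)
qed

lemma poly_hom_eqI:
  fixes \<theta> \<theta>' :: "'a::comm_ring_1 poly \<Rightarrow> 'b::comm_ring_1"
  assumes "comm_ring_hom \<theta>" "comm_ring_hom \<theta>'" "\<And>c. \<theta> [:c:] = \<theta>' [:c:]" "\<theta> [:0, 1:] = \<theta>' [:0, 1:]"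
  shows "\<theta> P = \<theta>' P"
proof -
  interpret a: comm_ring_hom \<theta> by fact
  interpret b: comm_ring_hom \<theta>' by fact
  show ?thesis
  proof (induction P)
    case (pCons c P)
    have "pCons c P = [:c:] + [:0, 1:] * P" by simp
    then show ?case using pCons by (simp only: a.hom_add b.hom_add a.hom_mult b.hom_mult assms(3,4))
  qed simp
qed

lemma hom_comp: "comm_ring_hom f \<Longrightarrow> comm_ring_hom g \<Longrightarrow> comm_ring_hom (\<lambda>x. f (g x))"
proof -
  assume "comm_ring_hom f" "comm_ring_hom g"
  then interpret f: comm_ring_hom f + g: comm_ring_hom g by auto
  show ?thesis by (rule comm_ring_homI) (simp_all add: f.hom_add g.hom_add f.hom_mult g.hom_mult)
qed

lemma hom_const_poly: "comm_ring_hom h \<Longrightarrow> comm_ring_hom (\<lambda>x. [:h x:])"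
proof -
  assume "comm_ring_hom h"
  then interpret comm_ring_hom h .
  show ?thesis by (rule comm_ring_homI) (simp_all add: hom_add hom_mult)
qed

lemma hom_id: "comm_ring_hom (\<lambda>x. x)" by (rule comm_ring_homI) simp_all

lemma hom_const_mp: "comm_ring_hom const_mp"
  by (rule comm_ring_homI) (simp_all add: single_add mult_single single_one)

section \<open>The Nullstellensatz for a hypersurface\<close>

text \<open>
  \<open>Ev\<close> plays the role of the \<open>K\<close>-points of a scheme with coordinate ring \<open>'t\<close>.  The property passes
  from \<open>'t\<close> to \<open>'t poly\<close>, which yields the case of an affine space by induction on the dimension.
\<close>

definition nullstellensatz :: "('t::ufd \<Rightarrow> 'k::field) set \<Rightarrow> bool" where
  "nullstellensatz Ev \<longleftrightarrow> (\<forall>e\<in>Ev. comm_ring_hom e) \<and> (\<forall>f. f \<noteq> 0 \<longrightarrow> (\<exists>e\<in>Ev. e f \<noteq> 0)) \<and>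
     (\<forall>F H. Factorial_Ring.irreducible F \<longrightarrow> (\<forall>e\<in>Ev. e F = 0 \<longrightarrow> e H = 0) \<longrightarrow> F dvd H)"

lemma nullstellensatz_base: "nullstellensatz {\<lambda>c :: 'k::field. c}"
  unfolding nullstellensatz_def
proof (intro conjI allI impI ballI)
  fix F H :: 'k assume "Factorial_Ring.irreducible F"
  then have "F \<noteq> 0" "\<not> F dvd 1" by (auto simp: Factorial_Ring.irreducible_def)
  then show "F dvd H" by (simp add: dvd_field_iff)
qed (use hom_id in auto)

text \<open>
  If \<open>F\<close> does not contain the new variable, the statement is the one for \<open>'t\<close>, applied to each
  coefficient of \<open>H\<close>.  Otherwise let \<open>F\<close> not divide \<open>H\<close>.  As \<open>F\<close> is prime, the ideal of \<open>F\<close> and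
  \<open>H\<close> contains a nonzero constant \<open>D\<close>.  Over a point where neither \<open>D\<close> nor the leading coefficient of
  \<open>F\<close> vanishes, \<open>F\<close> has a root, and it is a root of \<open>H\<close> as well, hence of \<open>D\<close>.
\<close>

lemma nullstellensatz_step:
  fixes Ev :: "('t::ufd \<Rightarrow> 'k::alg_closed_field) set"
  assumes "nullstellensatz Ev"
  shows "nullstellensatz {poly_hom e z | e z. e \<in> Ev}"
proof -
  have hom: "comm_ring_hom e" if "e \<in> Ev" for e using assms that by (auto simp: nullstellensatz_def)
  have nv: "\<exists>e\<in>Ev. e f \<noteq> 0" if "f \<noteq> 0" for f using assms that by (auto simp: nullstellensatz_def)
  have ns: "F dvd H" if "Factorial_Ring.irreducible F" "\<And>e. e \<in> Ev \<Longrightarrow> e F = 0 \<Longrightarrow> e H = 0" for F H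
    using assms that by (auto simp: nullstellensatz_def)
  have cmp: "coeff (map_poly e f) i = e (coeff f i)" if "e \<in> Ev" for e f i
  proof -
    interpret comm_ring_hom e by (rule hom) (rule that)
    show ?thesis by (simp add: coeff_map_poly)
  qed
  show ?thesis
    unfolding nullstellensatz_def
  proof (intro conjI allI impI ballI)
    fix e assume "e \<in> {poly_hom e z | e z. e \<in> Ev}"
    then show "comm_ring_hom e" using hom poly_hom_hom by auto
  next
    fix f :: "'t poly" assume "f \<noteq> 0"
    then have "lead_coeff f \<noteq> 0" by simp
    then obtain e where e: "e \<in> Ev" "e (lead_coeff f) \<noteq> 0" using nv by blast
    have "coeff (map_poly e f) (degree f) \<noteq> 0" using cmp[OF e(1)] e(2) by simp
    then have "map_poly e f \<noteq> 0" by auto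
    then obtain z where "poly (map_poly e f) z \<noteq> 0" using nonroot_exists by blast
    then show "\<exists>e\<in>{poly_hom e z | e z. e \<in> Ev}. e f \<noteq> 0"
      using e(1) by (intro bexI[of _ "poly_hom e z"]) (auto simp: poly_hom_def)
  next
    fix F H :: "'t poly"
    assume irr: "Factorial_Ring.irreducible F" and van': "\<forall>e\<in>{poly_hom e z | e z. e \<in> Ev}. e F = 0 \<longrightarrow> e H = 0"
    have van: "poly (map_poly e H) z = 0" if "e \<in> Ev" "poly (map_poly e F) z = 0" for e z
    proof -
      have "poly_hom e z \<in> {poly_hom e z | e z. e \<in> Ev}" using that(1) by blast
      then have "poly_hom e z F = 0 \<longrightarrow> poly_hom e z H = 0" using van' by blast
      then show ?thesis using that(2) by (simp add: poly_hom_def)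
    qed
    have F0: "F \<noteq> 0" using irr by auto
    show "F dvd H"
    proof (cases "degree F = 0")
      case True
      then obtain f where f: "F = [:f:]" using degree_eq_zeroE by blast
      have irrf: "Factorial_Ring.irreducible f" using irr unfolding f irreducible_const_poly_iff .
      have "f dvd coeff H i" for i
      proof (rule ns[OF irrf])
        fix e assume e: "e \<in> Ev" "e f = 0"
        interpret comm_ring_hom e by (rule hom) (rule e(1))
        have "map_poly e F = 0"
          by (rule poly_eqI) (simp add: cmp[OF e(1)] f coeff_pCons e(2) split: nat.split)
        then have "poly (map_poly e H) z = 0" for z using van[OF e(1)] by simp
        then have "map_poly e H = 0" using nonroot_exists by blast
        then show "e (coeff H i) = 0" using cmp[OF e(1), of H i] by simp
      qed
      then show ?thesis unfolding f by (simp add: const_poly_dvd_iff)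
    next
      case False
      show ?thesis
      proof (rule ccontr)
        assume nd: "\<not> F dvd H"
        obtain h w where h: "h = (\<Sum>i\<in>UNIV. w i * (if i then F else H))" "h \<noteq> 0"
          and hd: "\<And>i. \<exists>c q. c \<noteq> 0 \<and> smult c (if i then F else H) = h * q"
          using common_pseudo_divisor[of "\<lambda>i. if i then F else H" True] F0 by auto
        obtain c q where c: "c \<noteq> 0" "smult c F = h * q" using hd[of True] by auto
        obtain c' q' where c': "c' \<noteq> 0" "smult c' H = h * q'" using hd[of False] by auto
        have prime: "prime_elem F" using irr by simp
        \<comment> \<open>If \<open>F\<close> divides \<open>h\<close>, it divides a constant multiple of \<open>H\<close>; if it divides \<open>q\<close>, then \<open>h\<close>
          divides a constant. In both cases degrees show that \<open>h\<close> is a constant.\<close>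
        have "F dvd h * q" using c(2) by (metis dvd_smult dvd_refl)
        then consider "F dvd h" | "F dvd q" using prime by (auto simp: prime_elem_dvd_mult_iff)
        then have "degree h = 0"
        proof cases
          case 1
          then have "F dvd smult c' H" unfolding c'(2) by (rule dvd_mult2)
          then have "F dvd [:c':] * H" by simp
          then have "F dvd [:c':]" using nd unfolding prime_elem_dvd_mult_iff[OF prime] by blast
          moreover have "[:c':] \<noteq> 0" using c' by simp
          ultimately have "degree F \<le> degree [:c':]" by (rule dvd_imp_degree_le)
          then show ?thesis using False by simp
        next
          case 2
          then obtain g where g: "q = F * g" unfolding dvd_def by blast
          have "F * (h * g) = F * [:c:]" using c(2) g by (simp add: mult_ac)
          then have "h * g = [:c:]" using F0 mult_left_cancel by blast
          moreover have "[:c:] \<noteq> 0" using c by simp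
          ultimately have "degree h \<le> degree [:c:]" by (metis dvd_imp_degree_le dvd_triv_left)
          then show ?thesis by simp
        qed
        then obtain D where D: "h = [:D:]" using degree_eq_zeroE by blast
        have "D * lead_coeff F \<noteq> 0" using D h(2) F0 by auto
        then obtain e where e: "e \<in> Ev" "e (D * lead_coeff F) \<noteq> 0" using nv by blast
        interpret comm_ring_hom e by (rule hom) (rule e(1))
        have eD: "e D \<noteq> 0" "e (lead_coeff F) \<noteq> 0" using e(2) by (auto simp: hom_mult)
        have "coeff (map_poly e F) (degree F) \<noteq> 0" using cmp[OF e(1)] eD by simp
        then have "degree (map_poly e F) > 0" using False le_degree by fastforce
        then obtain z where z: "poly (map_poly e F) z = 0" using alg_closed_imp_poly_has_root by blast
        interpret l: comm_ring_hom "poly_hom e z" by (rule poly_hom_hom) (rule hom[OF e(1)])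
        have "poly_hom e z F = 0" "poly_hom e z H = 0" using z van[OF e(1) z] by (simp_all add: poly_hom_def)
        moreover have "h = w False * H + w True * F" by (simp add: h(1) UNIV_bool)
        ultimately have "poly_hom e z h = 0" by (simp add: l.hom_add l.hom_mult)
        moreover have "poly_hom e z h = e D" unfolding D by (rule poly_hom_const) (rule hom[OF e(1)])
        ultimately show False using eD by simp
      qed
    qed
  qed
qed

text \<open>
  The polynomial ring in four variables as an iterated univariate one: factorization is transported
  along this isomorphism.
\<close>

type_synonym 'k tower = "'k poly poly poly poly"

definition tower_const :: "'k::comm_ring_1 \<Rightarrow> 'k tower" where
  "tower_const c = [:[:[:[:c:]:]:]:]"

definition tower_var :: "4 \<Rightarrow> 'k::comm_ring_1 tower" where
  "tower_var i = (if i = 1 then [:[:[:[:0, 1:]:]:]:] else if i = 2 then [:[:[:0, 1:]:]:]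
     else if i = 3 then [:[:0, 1:]:] else [:0, 1:])"

lemma tower_vars: "tower_var 1 = [:[:[:[:0, 1:]:]:]:]" "tower_var 2 = [:[:[:0, 1:]:]:]"
    "tower_var 3 = [:[:0, 1:]:]" "tower_var 4 = [:0, 1:]"
  by (simp_all add: tower_var_def)

definition to_tower :: "'k::comm_ring_1 Y \<Rightarrow> 'k tower" where
  "to_tower = subst_mp tower_const tower_var"

definition eval_tower :: "('k::comm_ring_1 \<Rightarrow> 'r::comm_ring_1) \<Rightarrow> (4 \<Rightarrow> 'r) \<Rightarrow> 'k tower \<Rightarrow> 'r" where
  "eval_tower h y = poly_hom (poly_hom (poly_hom (poly_hom h (y 1)) (y 2)) (y 3)) (y 4)"

lemma tower_const_hom: "comm_ring_hom tower_const"
  unfolding tower_const_def by (intro hom_const_poly hom_id)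

lemma to_tower_hom: "comm_ring_hom to_tower"
  unfolding to_tower_def by (rule subst_mp_hom[OF tower_const_hom])

lemma eval_tower_hom: "comm_ring_hom h \<Longrightarrow> comm_ring_hom (eval_tower h y)"
  unfolding eval_tower_def by (intro poly_hom_hom)

lemma eval_tower_const: "comm_ring_hom h \<Longrightarrow> eval_tower h y (tower_const c) = h c"
  by (simp add: eval_tower_def tower_const_def poly_hom_const poly_hom_hom)

lemma eval_tower_var: "comm_ring_hom h \<Longrightarrow> eval_tower h y (tower_var i) = y i"
proof -
  assume h: "comm_ring_hom h"
  have "eval_tower h y (tower_var 1) = y 1" "eval_tower h y (tower_var 2) = y 2"
    "eval_tower h y (tower_var 3) = y 3" "eval_tower h y (tower_var 4) = y 4"
    unfolding eval_tower_def tower_vars by (simp_all only: poly_hom_const poly_hom_X poly_hom_hom h)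
  then show ?thesis using exhaust_4[of i] by metis
qed

lemma to_tower_const: "to_tower (const_mp c) = tower_const c"
proof -
  interpret comm_ring_hom "tower_const :: 'a \<Rightarrow> 'a tower" by (rule tower_const_hom)
  show ?thesis by (simp add: to_tower_def subst_mp_single)
qed

lemma to_tower_var: "to_tower (var_mp i) = tower_var i"
proof -
  interpret comm_ring_hom "tower_const :: 'a \<Rightarrow> 'a tower" by (rule tower_const_hom)
  show ?thesis by (simp add: to_tower_def subst_mp_single monom_val_single)
qed

lemma eval_tower_to_tower: "comm_ring_hom h \<Longrightarrow> eval_tower h y (to_tower f) = subst_mp h y f"
proof (rule subst_mp_unique[of "\<lambda>f. eval_tower h y (to_tower f)"])
  assume h: "comm_ring_hom h"
  show "comm_ring_hom (\<lambda>f. eval_tower h y (to_tower f))" by (rule hom_comp[OF eval_tower_hom[OF h] to_tower_hom])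
  show "eval_tower h y (to_tower (const_mp c)) = h c" for c
    by (simp only: to_tower_const eval_tower_const[OF h])
  show "eval_tower h y (to_tower (var_mp i)) = y i" for i
    by (simp only: to_tower_var eval_tower_var[OF h])
qed

definition of_tower :: "'k::comm_ring_1 tower \<Rightarrow> 'k Y" where
  "of_tower = eval_tower const_mp var_mp"

lemma of_tower_hom: "comm_ring_hom of_tower"
  unfolding of_tower_def by (rule eval_tower_hom[OF hom_const_mp])

lemma of_tower_to_tower: "of_tower (to_tower f) = f"
proof -
  have "of_tower (to_tower f) = subst_mp const_mp var_mp f"
    unfolding of_tower_def by (rule eval_tower_to_tower[OF hom_const_mp])
  also have "\<dots> = f" by (rule subst_mp_unique[OF hom_id, symmetric]) simp_all
  finally show ?thesis .
qed

lemma to_tower_of_tower: "to_tower (of_tower P) = P"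
proof -
  note h = hom_comp[OF to_tower_hom of_tower_hom]
  have v: "to_tower (of_tower (tower_var i)) = tower_var i" for i
    by (simp only: of_tower_def eval_tower_var[OF hom_const_mp] to_tower_var)
  have c: "to_tower (of_tower (tower_const c)) = tower_const c" for c :: 'a
    by (simp only: of_tower_def eval_tower_const[OF hom_const_mp] to_tower_const)
  note c1 = hom_const_poly[OF hom_id]
  note c2 = hom_const_poly[OF c1]
  note c3 = hom_const_poly[OF c2]
  have 1: "to_tower (of_tower [:[:[:p:]:]:]) = [:[:[:p:]:]:]" for p :: "'a poly"
    by (rule poly_hom_eqI[OF hom_comp[OF h c3] c3]) (rule c[unfolded tower_const_def], rule v[of 1, unfolded tower_vars])
  have 2: "to_tower (of_tower [:[:p:]:]) = [:[:p:]:]" for p :: "'a poly poly"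
    by (rule poly_hom_eqI[OF hom_comp[OF h c2] c2]) (rule 1, rule v[of 2, unfolded tower_vars])
  have 3: "to_tower (of_tower [:p:]) = [:p:]" for p :: "'a poly poly poly"
    by (rule poly_hom_eqI[OF hom_comp[OF h c1] c1]) (rule 2, rule v[of 3, unfolded tower_vars])
  show ?thesis
    by (rule poly_hom_eqI[OF h hom_id]) (rule 3, rule v[of 4, unfolded tower_vars])
qed

lemma to_tower_dvd_iff: "to_tower f dvd to_tower g \<longleftrightarrow> f dvd g"
proof
  interpret t: comm_ring_hom "to_tower :: 'a Y \<Rightarrow> _" by (rule to_tower_hom)
  interpret o: comm_ring_hom "of_tower :: 'a tower \<Rightarrow> _" by (rule of_tower_hom)
  show "f dvd g \<Longrightarrow> to_tower f dvd to_tower g" by (auto elim!: dvdE simp: t.hom_mult)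
  assume "to_tower f dvd to_tower g"
  then obtain q where "to_tower g = to_tower f * q" by (auto elim: dvdE)
  then have "of_tower (to_tower g) = of_tower (to_tower f) * of_tower q" by (simp only: o.hom_mult)
  then show "f dvd g" by (simp add: of_tower_to_tower)
qed

lemma to_tower_eq_0_iff: "to_tower f = 0 \<longleftrightarrow> f = 0"
proof -
  interpret t: comm_ring_hom "to_tower :: 'a Y \<Rightarrow> _" by (rule to_tower_hom)
  interpret o: comm_ring_hom "of_tower :: 'a tower \<Rightarrow> _" by (rule of_tower_hom)
  show ?thesis using of_tower_to_tower[of f] by (metis t.hom_zero o.hom_zero)
qed

lemma to_tower_unit_iff: "to_tower f dvd 1 \<longleftrightarrow> f dvd 1"
proof -
  interpret t: comm_ring_hom "to_tower :: 'a Y \<Rightarrow> _" by (rule to_tower_hom)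
  show ?thesis using to_tower_dvd_iff[of f 1] by simp
qed

lemma to_tower_irreducible_iff: "Factorial_Ring.irreducible (to_tower f) \<longleftrightarrow> Factorial_Ring.irreducible f"
proof -
  interpret t: comm_ring_hom "to_tower :: 'a Y \<Rightarrow> _" by (rule to_tower_hom)
  have "(\<forall>a b. to_tower f = a * b \<longrightarrow> a dvd 1 \<or> b dvd 1) \<longleftrightarrow> (\<forall>a b. f = a * b \<longrightarrow> a dvd 1 \<or> b dvd 1)"
    (is "?L \<longleftrightarrow> ?R")
  proof
    assume L: ?L
    show ?R
    proof (intro allI impI)
      fix a b assume "f = a * b"
      then have "to_tower f = to_tower a * to_tower b" by (simp add: t.hom_mult)
      then show "a dvd 1 \<or> b dvd 1" using L to_tower_unit_iff by blast
    qed
  next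
    assume R: ?R
    show ?L
    proof (intro allI impI)
      fix a b assume "to_tower f = a * b"
      then have "to_tower f = to_tower (of_tower a * of_tower b)" by (simp add: t.hom_mult to_tower_of_tower)
      then have "f = of_tower a * of_tower b" by (metis of_tower_to_tower)
      then have "of_tower a dvd 1 \<or> of_tower b dvd 1" using R by blast
      then show "a dvd 1 \<or> b dvd 1" by (metis to_tower_unit_iff to_tower_of_tower)
    qed
  qed
  then show ?thesis unfolding Factorial_Ring.irreducible_def by (simp add: to_tower_eq_0_iff to_tower_unit_iff)
qed

lemma nullstellensatz_tower: "nullstellensatz (range (eval_tower (\<lambda>c :: 'k::alg_closed_field. c)))"
proof -
  have "range (eval_tower (\<lambda>c :: 'k. c)) = {poly_hom e4 z4 | e4 z4. e4 \<in> {poly_hom e3 z3 | e3 z3. e3 \<in> {poly_hom e2 z2 | e2 z2. e2 \<in>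
      {poly_hom e1 z1 | e1 z1. e1 \<in> {\<lambda>c. c}}}}}" (is "_ = ?R")
  proof (intro equalityI subsetI)
    fix e assume "e \<in> ?R"
    then obtain z1 z2 z3 z4 where e: "e = poly_hom (poly_hom (poly_hom (poly_hom (\<lambda>c. c) z1) z2) z3) z4" by auto
    define y where "y = (\<lambda>i::4. if i = 1 then z1 else if i = 2 then z2 else if i = 3 then z3 else z4)"
    have "e = eval_tower (\<lambda>c. c) y" by (simp add: e eval_tower_def y_def)
    then show "e \<in> range (eval_tower (\<lambda>c :: 'k. c))" by simp
  qed (auto simp: eval_tower_def)
  then show ?thesis by (simp only: nullstellensatz_base nullstellensatz_step)
qed

lemma Y_nonzero_eval:
  fixes f :: "'k::alg_closed_field Y"
  assumes "f \<noteq> 0" shows "\<exists>y. eval_mp y f \<noteq> 0"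
proof -
  have "to_tower f \<noteq> 0" using assms by (simp add: to_tower_eq_0_iff)
  then obtain y where "eval_tower (\<lambda>c :: 'k. c) y (to_tower f) \<noteq> 0"
    using nullstellensatz_tower unfolding nullstellensatz_def by (metis rangeE)
  then show ?thesis by (auto simp: eval_tower_to_tower[OF hom_id] eval_mp_subst_mp)
qed

lemma Y_hypersurface_nullstellensatz:
  fixes F H :: "'k::alg_closed_field Y"
  assumes "Factorial_Ring.irreducible F" "\<And>y. eval_mp y F = 0 \<Longrightarrow> eval_mp y H = 0"
  shows "F dvd H"
proof -
  have "\<forall>e\<in>range (eval_tower (\<lambda>c :: 'k. c)). e (to_tower F) = 0 \<longrightarrow> e (to_tower H) = 0"
    using assms(2) by (auto simp: eval_tower_to_tower[OF hom_id] eval_mp_subst_mp)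
  moreover have "Factorial_Ring.irreducible (to_tower F)" using assms by (simp add: to_tower_irreducible_iff)
  ultimately have "to_tower F dvd to_tower H" using nullstellensatz_tower unfolding nullstellensatz_def by blast
  then show ?thesis by (simp add: to_tower_dvd_iff)
qed

lemma Y_unit_const:
  fixes f :: "'k::field Y"
  assumes "f dvd 1" shows "\<exists>r. r \<noteq> 0 \<and> f = const_mp r"
proof -
  have "to_tower f dvd 1" using assms by (simp add: to_tower_unit_iff)
  then obtain p where p: "to_tower f = [:p:]" "p dvd 1" unfolding is_unit_poly_iff by blast
  then obtain q where q: "p = [:q:]" "q dvd 1" unfolding is_unit_poly_iff by blast
  then obtain w where w: "q = [:w:]" "w dvd 1" unfolding is_unit_poly_iff by blast
  then obtain r where r: "w = [:r:]" "r dvd 1" unfolding is_unit_poly_iff by blast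
  have "to_tower f = to_tower (const_mp r)" by (simp only: p q w r to_tower_const tower_const_def)
  then have "of_tower (to_tower f) = of_tower (to_tower (const_mp r))" by (simp only:)
  then have f: "f = const_mp r" by (simp only: of_tower_to_tower)
  have "r \<noteq> 0"
  proof
    assume "r = 0"
    then have "0 dvd (1::'k)" using r(2) by (simp only:)
    then show False by simp
  qed
  then show ?thesis using f by blast
qed

text \<open>
  \<open>P\<close> stands for membership in a prime ideal.
\<close>

lemma Y_prime_factor:
  fixes G :: "'k::field Y"
  assumes "G \<noteq> 0" "P G" "\<And>A B. P (A * B) \<Longrightarrow> P A \<or> P B" "\<And>u. u dvd 1 \<Longrightarrow> \<not> P u"
  shows "\<exists>F. Factorial_Ring.irreducible F \<and> F dvd G \<and> P F"
proof -
  interpret o: comm_ring_hom "of_tower :: 'k tower \<Rightarrow> _" by (rule of_tower_hom)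
  have "to_tower G \<noteq> 0" "\<not> to_tower G dvd 1" using assms by (auto simp: to_tower_eq_0_iff to_tower_unit_iff)
  then obtain A where A: "mset_factors A (to_tower G)" using mset_factors_exist by blast
  have "\<exists>f\<in>#A. P (of_tower f)" if "P (of_tower (prod_mset A))" for A
    using that
  proof (induction A)
    case empty then show ?case using assms(4)[of 1] by simp
  next
    case (add x A)
    then have "P (of_tower x * of_tower (prod_mset A))" by (simp add: o.hom_mult)
    then show ?case using assms(3) add.IH by auto
  qed
  moreover have "of_tower (prod_mset A) = G" using mset_factorsD(3)[OF A] by (simp add: of_tower_to_tower)
  ultimately obtain f where f: "f \<in># A" "P (of_tower f)" using assms(2) by auto
  have "Factorial_Ring.irreducible f" using mset_factorsD(1)[OF A f(1)] .
  then have "Factorial_Ring.irreducible (of_tower f)"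
    using to_tower_irreducible_iff[of "of_tower f"] by (simp add: to_tower_of_tower)
  moreover have "f dvd to_tower G" using f(1) mset_factorsD(3)[OF A] dvd_prod_mset by metis
  then have "of_tower f dvd G" using to_tower_dvd_iff[of "of_tower f" G] by (simp add: to_tower_of_tower)
  ultimately show ?thesis using f(2) by blast
qed

lemma Y_power_of_irreducible:
  fixes G F :: "'k::field Y"
  assumes G: "G \<noteq> 0" "\<not> G dvd 1" and F: "Factorial_Ring.irreducible F"
    and assoc: "\<And>P. Factorial_Ring.irreducible P \<Longrightarrow> P dvd G \<Longrightarrow> F dvd P"
  shows "\<exists>r k. r \<noteq> 0 \<and> k > 0 \<and> G = const_mp r * F ^ k"
proof -
  interpret o: comm_ring_hom "of_tower :: 'k tower \<Rightarrow> _" by (rule of_tower_hom)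
  have "to_tower G \<noteq> 0" "\<not> to_tower G dvd 1" using assms by (auto simp: to_tower_eq_0_iff to_tower_unit_iff)
  then obtain A where A: "mset_factors A (to_tower G)" using mset_factors_exist by blast
  have *: "\<exists>r. r \<noteq> 0 \<and> of_tower f = const_mp r * F" if "f \<in># A" for f
  proof -
    have "Factorial_Ring.irreducible f" using mset_factorsD(1)[OF A that] .
    then have irr: "Factorial_Ring.irreducible (of_tower f)"
      using to_tower_irreducible_iff[of "of_tower f"] by (simp add: to_tower_of_tower)
    have "f dvd to_tower G" using that mset_factorsD(3)[OF A] dvd_prod_mset by metis
    then have "of_tower f dvd G" using to_tower_dvd_iff[of "of_tower f" G] by (simp add: to_tower_of_tower)
    then have "F dvd of_tower f" using assoc irr by blast
    then obtain u where u: "of_tower f = F * u" by (auto elim: dvdE)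
    have "\<not> F dvd 1" using F by (simp add: Factorial_Ring.irreducible_def)
    then have "u dvd 1" using irr u unfolding Factorial_Ring.irreducible_def by blast
    then obtain r where "r \<noteq> 0" "u = const_mp r" using Y_unit_const by blast
    then show ?thesis using u by (auto simp: mult.commute)
  qed
  have "\<exists>r. r \<noteq> 0 \<and> of_tower (prod_mset B) = const_mp r * F ^ size B" if "B \<subseteq># A" for B
    using that
  proof (induction B)
    case empty
    show ?case by (intro exI[of _ 1]) (simp add: single_one)
  next
    case (add x B)
    then have "x \<in># A" "B \<subseteq># A" by (auto dest: mset_subset_eq_insertD simp: subset_mset.less_imp_le)
    then obtain r r' where r: "r \<noteq> 0" "r' \<noteq> 0" "of_tower x = const_mp r * F" "of_tower (prod_mset B) = const_mp r' * F ^ size B"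
      using * add.IH by blast
    have "of_tower (prod_mset (add_mset x B)) = (const_mp r * const_mp r') * F ^ size (add_mset x B)"
      by (simp add: o.hom_mult r mult_ac)
    also have "const_mp r * const_mp r' = (const_mp (r * r') :: 'k Y)" by (simp add: mult_single)
    finally show ?case using r by (intro exI[of _ "r * r'"]) simp
  qed
  from this[of A] obtain r where "r \<noteq> 0" "of_tower (prod_mset A) = const_mp r * F ^ size A" by auto
  moreover have "of_tower (prod_mset A) = G" using mset_factorsD(3)[OF A] by (simp add: of_tower_to_tower)
  moreover have "size A > 0" using mset_factorsD(2)[OF A] by (simp add: nonempty_has_size)
  ultimately show ?thesis by metis
qed

section \<open>Lifting the Koszul syzygies\<close>

text \<open>
  The vectors \<open>Q\<^sub>i\<close> have entries in \<open>K[x]\<close>.  Statements over \<open>K[x]\<close> extend to \<open>K[x][t]\<close> by applying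
  them to the coefficient of each power of \<open>t\<close>; the vector of these coefficients is a layer.
\<close>

definition pdot :: "'k::comm_ring_1 poly poly ^ 4 \<Rightarrow> 'k poly ^ 4 \<Rightarrow> 'k poly poly" where
  "pdot C Q = (\<Sum>k\<in>UNIV. C $ k * [:Q $ k:])"

definition layer :: "nat \<Rightarrow> 'k::zero poly poly ^ 4 \<Rightarrow> 'k poly ^ 4" where
  "layer i C = (\<chi> k. coeff (C $ k) i)"

definition stack :: "nat \<Rightarrow> (nat \<Rightarrow> 'k::comm_monoid_add poly) \<Rightarrow> 'k poly poly" where
  "stack a v = (\<Sum>i\<le>a. monom (v i) i)"

definition vbideg_le :: "int \<Rightarrow> int \<Rightarrow> 'k::zero poly poly ^ 4 \<Rightarrow> bool" where
  "vbideg_le c d C \<longleftrightarrow> (\<forall>k. bideg_le c d (C $ k))"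

lemma coeff_stack: "coeff (stack a v) i = (if i \<le> a then v i else 0)"
proof -
  have "coeff (stack a v) i = (\<Sum>j\<le>a. if j = i then v j else 0)"
    unfolding stack_def coeff_sum by (intro sum.cong) auto
  then show ?thesis by simp
qed

lemma coeff_pdot: "coeff (pdot C Q) i = dot (layer i C) Q"
  by (simp add: pdot_def dot_def layer_def coeff_sum mult.commute)

lemma bideg_le_iff_deg_le: "bideg_le (int a) d f \<longleftrightarrow> degree f \<le> a \<and> (\<forall>i. deg_le d (coeff f i))"
  by (simp add: bideg_le_iff_degree deg_le_def)

lemma bideg_le_stack:
  assumes "\<And>i. i \<le> a \<Longrightarrow> deg_le d (v i)"
  shows "bideg_le (int a) d (stack a v)"
proof -
  have "degree (stack a v) \<le> a" by (rule degree_le) (simp add: coeff_stack)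
  then show ?thesis using assms by (simp add: bideg_le_iff_deg_le coeff_stack)
qed

lemma layer_beyond: "vbideg_le (int a) d C \<Longrightarrow> i > a \<Longrightarrow> layer i C = 0"
  by (auto simp: vbideg_le_def layer_def bideg_le_iff_deg_le vec_ext_iff intro!: coeff_eq_0 intro: le_less_trans)

lemma vdeg_le_layer: "vbideg_le (int a) d C \<Longrightarrow> vdeg_le d (layer i C)"
  by (simp add: vbideg_le_def vdeg_le_def layer_def bideg_le_iff_deg_le)

lemma bideg_le_const: "deg_le d q \<Longrightarrow> bideg_le 0 d [:q:]"
  using bideg_le_iff_deg_le[of 0 d "[:q:]"] by (simp add: coeff_pCons split: nat.split)

lemma bideg_le_pdot:
  assumes "vbideg_le c d C" "vdeg_le m Q" shows "bideg_le c (d + m) (pdot C Q)"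
  unfolding pdot_def
proof (rule bideg_le_sum)
  fix k
  have "bideg_le (c + 0) (d + m) (C $ k * [:Q $ k:])"
    using assms by (intro bideg_le_mult bideg_le_const) (auto simp: vbideg_le_def vdeg_le_def)
  then show "bideg_le c (d + m) (C $ k * [:Q $ k:])" by simp
qed

context
  fixes S Q1 Q2 Q3 :: "'k::field poly ^ 4" and n m1 m2 m3 :: nat
  assumes mb: "minimal_basis_of S n Q1 Q2 Q3 m1 m2 m3"
begin

lemma mb_sum: "int m1 + int m2 + int m3 = int n"
  using mb unfolding minimal_basis_of_def by (metis of_nat_add)

lemma mb_vb: "vdeg_le (int m1) Q1" "vdeg_le (int m2) Q2" "vdeg_le (int m3) Q3"
  using mb unfolding minimal_basis_of_def by blast+

lemma mb_dot: "dot S Q1 = 0" "dot S Q2 = 0" "dot S Q3 = 0"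
  using mb unfolding minimal_basis_of_def by blast+

lemma mb_gens: "dot S w = 0 \<Longrightarrow> vdeg_le d w \<Longrightarrow> \<exists>c1 c2 c3. w = c1 *s Q1 + c2 *s Q2 + c3 *s Q3 \<and>
        deg_le (d - int m1) c1 \<and> deg_le (d - int m2) c2 \<and> deg_le (d - int m3) c3"
  using mb unfolding minimal_basis_of_def by blast

lemma mb_ker: "dot c Q1 = 0 \<Longrightarrow> dot c Q2 = 0 \<Longrightarrow> dot c Q3 = 0 \<Longrightarrow> vdeg_le d c \<Longrightarrow>
        \<exists>e. c = e *s S \<and> deg_le (d - int n) e"
  using mb unfolding minimal_basis_of_def by blast

lemma mb_lift: "int n - 1 \<le> d \<Longrightarrow> deg_le (d + int m1) r1 \<Longrightarrow> deg_le (d + int m2) r2 \<Longrightarrow> deg_le (d + int m3) r3 \<Longrightarrow>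
        \<exists>c. vdeg_le d c \<and> dot c Q1 = r1 \<and> dot c Q2 = r2 \<and> dot c Q3 = r3"
  using mb unfolding minimal_basis_of_def by blast

lemma minimal_basis_decompose:
  assumes w: "vbideg_le (int a) d w" "pdot w S = 0"
  shows "\<exists>c1 c2 c3. (\<forall>k. w $ k = c1 * [:Q1 $ k:] + c2 * [:Q2 $ k:] + c3 * [:Q3 $ k:]) \<and>
    bideg_le (int a) (d - int m1) c1 \<and> bideg_le (int a) (d - int m2) c2 \<and> bideg_le (int a) (d - int m3) c3"
proof -
  have "\<exists>c. layer i w = fst c *s Q1 + fst (snd c) *s Q2 + snd (snd c) *s Q3 \<and>
        deg_le (d - int m1) (fst c) \<and> deg_le (d - int m2) (fst (snd c)) \<and> deg_le (d - int m3) (snd (snd c))" for i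
  proof -
    have "dot S (layer i w) = 0" using coeff_pdot[of w S i] w(2) by (simp add: dot_commute)
    from mb_gens[OF this vdeg_le_layer[OF w(1)]] obtain c1 c2 c3 where "layer i w = c1 *s Q1 + c2 *s Q2 + c3 *s Q3"
      "deg_le (d - int m1) c1" "deg_le (d - int m2) c2" "deg_le (d - int m3) c3" by blast
    then show ?thesis by (intro exI[of _ "(c1, c2, c3)"]) simp
  qed
  then obtain c where c: "\<And>i. layer i w = fst (c i) *s Q1 + fst (snd (c i)) *s Q2 + snd (snd (c i)) *s Q3"
    "\<And>i. deg_le (d - int m1) (fst (c i))" "\<And>i. deg_le (d - int m2) (fst (snd (c i)))" "\<And>i. deg_le (d - int m3) (snd (snd (c i)))"
    by metis
  have "w $ k = stack a (\<lambda>i. fst (c i)) * [:Q1 $ k:] + stack a (\<lambda>i. fst (snd (c i))) * [:Q2 $ k:] + stack a (\<lambda>i. snd (snd (c i))) * [:Q3 $ k:]" for k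
  proof (rule poly_eqI)
    fix i
    have "coeff (w $ k) i = layer i w $ k" by (simp add: layer_def)
    also have "\<dots> = (if i \<le> a then layer i w $ k else 0)" using layer_beyond[OF w(1), of i] by auto
    finally show "coeff (w $ k) i = coeff (stack a (\<lambda>i. fst (c i)) * [:Q1 $ k:] + stack a (\<lambda>i. fst (snd (c i))) * [:Q2 $ k:] + stack a (\<lambda>i. snd (snd (c i))) * [:Q3 $ k:]) i"
      by (simp add: coeff_stack c(1) mult.commute)
  qed
  moreover have "bideg_le (int a) (d - int m1) (stack a (\<lambda>i. fst (c i)))" "bideg_le (int a) (d - int m2) (stack a (\<lambda>i. fst (snd (c i))))"
    "bideg_le (int a) (d - int m3) (stack a (\<lambda>i. snd (snd (c i))))"
    by (intro bideg_le_stack c)+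
  ultimately show ?thesis by blast
qed

lemma minimal_basis_orthogonal:
  assumes c: "vbideg_le (int a) d c" "pdot c Q1 = 0" "pdot c Q2 = 0" "pdot c Q3 = 0"
  shows "\<exists>e. (\<forall>k. c $ k = e * [:S $ k:]) \<and> bideg_le (int a) (d - int n) e"
proof -
  have "\<exists>e. layer i c = e *s S \<and> deg_le (d - int n) e" for i
  proof -
    have "dot (layer i c) Q1 = 0" "dot (layer i c) Q2 = 0" "dot (layer i c) Q3 = 0"
      using coeff_pdot[of c _ i] c(2-4) by (metis coeff_0)+
    then show ?thesis using mb_ker vdeg_le_layer[OF c(1)] by blast
  qed
  then obtain e where e: "\<And>i. layer i c = e i *s S" "\<And>i. deg_le (d - int n) (e i)" by metis
  have "c $ k = stack a e * [:S $ k:]" for k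
  proof (rule poly_eqI)
    fix i
    have "coeff (c $ k) i = layer i c $ k" by (simp add: layer_def)
    also have "\<dots> = (if i \<le> a then layer i c $ k else 0)" using layer_beyond[OF c(1), of i] by auto
    finally show "coeff (c $ k) i = coeff (stack a e * [:S $ k:]) i"
      by (simp add: coeff_stack e(1) mult.commute)
  qed
  then show ?thesis using bideg_le_stack[of a "d - int n" e] e(2) by blast
qed

lemma minimal_basis_lift:
  assumes nd: "int n - 1 \<le> d" and r: "bideg_le (int a) (d + int m1) r1" "bideg_le (int a) (d + int m2) r2" "bideg_le (int a) (d + int m3) r3"
  shows "\<exists>c. vbideg_le (int a) d c \<and> pdot c Q1 = r1 \<and> pdot c Q2 = r2 \<and> pdot c Q3 = r3"
proof -
  have "\<exists>c. vdeg_le d c \<and> dot c Q1 = coeff r1 i \<and> dot c Q2 = coeff r2 i \<and> dot c Q3 = coeff r3 i" for i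
    using r by (intro mb_lift nd) (auto simp: bideg_le_iff_deg_le)
  then obtain c where c: "\<And>i. vdeg_le d (c i)" "\<And>i. dot (c i) Q1 = coeff r1 i" "\<And>i. dot (c i) Q2 = coeff r2 i" "\<And>i. dot (c i) Q3 = coeff r3 i"
    by metis
  define C where "C = (\<chi> k. stack a (\<lambda>i. c i $ k))"
  have "vbideg_le (int a) d C" using c(1) by (auto simp: vbideg_le_def C_def vdeg_le_def intro: bideg_le_stack)
  moreover have lay: "layer i C = (if i \<le> a then c i else 0)" for i
    by (simp add: layer_def C_def coeff_stack vec_ext_iff)
  have "pdot C Q = r" if "bideg_le (int a) d' r" "\<And>i. dot (c i) Q = coeff r i" for Q r d'
  proof (rule poly_eqI)
    fix i
    show "coeff (pdot C Q) i = coeff r i"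
    proof (cases "i \<le> a")
      case True then show ?thesis using that(2) by (simp add: coeff_pdot lay)
    next
      case False
      then have "coeff r i = 0" using that(1) by (intro coeff_eq_0) (simp add: bideg_le_iff_deg_le)
      then show ?thesis using False by (simp add: coeff_pdot lay dot_def)
    qed
  qed
  then have "pdot C Q1 = r1" "pdot C Q2 = r2" "pdot C Q3 = r3" using r c by blast+
  ultimately show ?thesis by blast
qed

end

lemma fibre_const [simp]: "fibre x [:q:] = [:poly q x:]"
  by (rule poly_eqI) (simp add: coeff_pCons split: nat.split)

lemma fibre_inf_const: "fibre_inf (int m) [:q:] = [:coeff q m:]"
  by (rule poly_eqI) (simp add: coeff_pCons split: nat.split)

lemma fibre_inf_mult_const:
  assumes "bideg_le c (b - int m) g" "deg_le (int m) q"
  shows "fibre_inf b (g * [:q:]) = fibre_inf (b - int m) g * [:coeff q m:]"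
  using fibre_inf_mult[OF assms(1) bideg_le_const[OF assms(2)]] by (simp add: fibre_inf_const)

text \<open>
  For four forms of degree \<open>a\<close> on a fibre, again with the value at infinity as the coefficient at \<open>a\<close>.
\<close>

definition no_common_zero4 :: "nat \<Rightarrow> (4 \<Rightarrow> 'k::field poly) \<Rightarrow> bool" where
  "no_common_zero4 a f \<longleftrightarrow> (\<forall>z. \<exists>k. poly (f k) z \<noteq> 0) \<and> (\<exists>k. coeff (f k) a \<noteq> 0)"

lemma no_common_zero_of_combination:
  assumes "no_common_zero4 a f" "\<And>k. f k = g1 * [:c1 k:] + g2 * [:c2 k:] + g3 * [:c3 k:]"
  shows "no_common_zero a g1 g2 g3"
proof -
  have p: "poly (f k) z = poly g1 z * c1 k + poly g2 z * c2 k + poly g3 z * c3 k" for k z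
    by (simp add: assms(2) mult.commute)
  have c: "coeff (f k) a = coeff g1 a * c1 k + coeff g2 a * c2 k + coeff g3 a * c3 k" for k
    by (simp add: assms(2) mult.commute)
  have "poly g1 z \<noteq> 0 \<or> poly g2 z \<noteq> 0 \<or> poly g3 z \<noteq> 0" for z
  proof -
    obtain k where "poly (f k) z \<noteq> 0" using assms(1) unfolding no_common_zero4_def by blast
    then show ?thesis unfolding p by auto
  qed
  moreover obtain k where "coeff (f k) a \<noteq> 0" using assms(1) unfolding no_common_zero4_def by blast
  then have "coeff g1 a \<noteq> 0 \<or> coeff g2 a \<noteq> 0 \<or> coeff g3 a \<noteq> 0" unfolding c by auto
  ultimately show ?thesis unfolding no_common_zero_def by blast
qed

lemma fibre_all_0:
  fixes f :: "'k::alg_closed_field poly poly"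
  assumes "\<And>x. fibre x f = 0" shows "f = 0"
proof (rule poly_eqI)
  fix i
  have "poly (coeff f i) x = 0" for x using assms[of x] coeff_fibre[of x f i] by simp
  then show "coeff f i = coeff 0 i" using nonroot_exists[of "coeff f i"] by auto
qed

definition comb4 :: "'k::comm_ring_1 poly ^ 4 \<Rightarrow> 'k poly poly ^ 4 \<Rightarrow> 'k poly poly ^ 4 \<Rightarrow> 'k poly poly ^ 4 \<Rightarrow>
    'k poly poly \<Rightarrow> 'k poly poly \<Rightarrow> 'k poly poly \<Rightarrow> 'k poly poly \<Rightarrow> 'k poly poly ^ 4" where
  "comb4 S L1 L2 L3 \<beta> \<alpha>1 \<alpha>2 \<alpha>3 = (\<chi> k. \<beta> * [:S $ k:] + \<alpha>1 * L1 $ k + \<alpha>2 * L2 $ k + \<alpha>3 * L3 $ k)"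

lemma pdot_comb4:
  "pdot (comb4 S L1 L2 L3 \<beta> \<alpha>1 \<alpha>2 \<alpha>3) Q = \<beta> * [:dot S Q:] + \<alpha>1 * pdot L1 Q + \<alpha>2 * pdot L2 Q + \<alpha>3 * pdot L3 Q"
proof -
  have s: "[:dot S Q:] = (\<Sum>k\<in>UNIV. [:S $ k:] * [:Q $ k:])"
  proof -
    have "[:sum f A:] = (\<Sum>k\<in>A. [:f k:])" for f :: "4 \<Rightarrow> 'a poly" and A
      by (rule poly_eqI) (simp add: coeff_sum coeff_pCons split: nat.split)
    moreover have "[:S $ k:] * [:Q $ k:] = [:S $ k * Q $ k:]" for k by simp
    ultimately show ?thesis by (simp only: dot_def)
  qed
  show ?thesis unfolding pdot_def s comb4_def
    by (simp only: vec_lambda_beta sum_distrib_left sum.distrib[symmetric] distrib_right mult.assoc)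
qed

text \<open>
  With \<open>P = g\<^sub>1 Q\<^sub>1 + g\<^sub>2 Q\<^sub>2 + g\<^sub>3 Q\<^sub>3\<close>, a vector \<open>C\<close> is a syzygy of \<open>P\<close> iff its products with the \<open>Q\<^sub>i\<close> are a
  syzygy of the \<open>g\<^sub>i\<close>.  The vectors \<open>L\<^sub>i\<close> are chosen with products the Koszul syzygies of the \<open>g\<^sub>i\<close>.  They
  exist in degree \<open>b - n + m\<^sub>i\<close> since this is at least \<open>n - 1\<close>, by \<open>b \<ge> 2n - 1\<close>.  Koszul exactness writes
  the products of any \<open>C\<close> as a combination of those of the \<open>L\<^sub>i\<close>, and the difference is orthogonal to
  all \<open>Q\<^sub>i\<close>, so it is a multiple of \<open>S\<close>.
\<close>

lemma koszul_lifts: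
  fixes P :: "'k::alg_closed_field poly poly ^ 4" and S :: "'k poly ^ 4" and a b n :: nat
  assumes a: "a \<ge> 1" and P: "vbideg_le (int a) (int b) P"
    and fib: "\<And>x. no_common_zero4 a (\<lambda>k. fibre x (P $ k))" and inf: "no_common_zero4 a (\<lambda>k. fibre_inf (int b) (P $ k))"
    and SP: "pdot P S = 0" and S0: "S \<noteq> 0"
    and mb: "minimal_basis_of S n Q1 Q2 Q3 m1 m2 m3" and bn: "2 * int n - 1 \<le> int b"
  shows "\<exists>L1 L2 L3. vbideg_le (int a) (int b - int n + int m1) L1 \<and> vbideg_le (int a) (int b - int n + int m2) L2 \<and>
     vbideg_le (int a) (int b - int n + int m3) L3 \<and>
     (\<Sum>k\<in>UNIV. L1 $ k * P $ k) = 0 \<and> (\<Sum>k\<in>UNIV. L2 $ k * P $ k) = 0 \<and> (\<Sum>k\<in>UNIV. L3 $ k * P $ k) = 0 \<and>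
     (\<forall>C. vbideg_le (2 * int a - 1) (int b - 1) C \<longrightarrow> (\<Sum>k\<in>UNIV. C $ k * P $ k) = 0 \<longrightarrow>
        (\<exists>\<beta> \<alpha>1 \<alpha>2 \<alpha>3. bideg_le (2 * int a - 1) (int b - 1 - int n) \<beta> \<and> bideg_le (int a - 1) (int n - int m1 - 1) \<alpha>1 \<and>
           bideg_le (int a - 1) (int n - int m2 - 1) \<alpha>2 \<and> bideg_le (int a - 1) (int n - int m3 - 1) \<alpha>3 \<and>
           C = comb4 S L1 L2 L3 \<beta> \<alpha>1 \<alpha>2 \<alpha>3)) \<and>
     (\<forall>\<beta> \<alpha>1 \<alpha>2 \<alpha>3. degree \<alpha>1 < a \<longrightarrow> degree \<alpha>2 < a \<longrightarrow> degree \<alpha>3 < a \<longrightarrow>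
        comb4 S L1 L2 L3 \<beta> \<alpha>1 \<alpha>2 \<alpha>3 = 0 \<longrightarrow> \<beta> = 0 \<and> \<alpha>1 = 0 \<and> \<alpha>2 = 0 \<and> \<alpha>3 = 0)"
proof -
  note msum = mb_sum[OF mb] and mvb = mb_vb[OF mb]
  obtain g1 g2 g3 where g: "\<And>k. P $ k = g1 * [:Q1 $ k:] + g2 * [:Q2 $ k:] + g3 * [:Q3 $ k:]"
    and bg: "bideg_le (int a) (int b - int m1) g1" "bideg_le (int a) (int b - int m2) g2" "bideg_le (int a) (int b - int m3) g3"
    using minimal_basis_decompose[OF mb P SP] by blast
  have gfib: "no_common_zero a (fibre x g1) (fibre x g2) (fibre x g3)" for x
    by (rule no_common_zero_of_combination[OF fib[of x]]) (simp only: g fibre_add fibre_mult fibre_const)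
  have ginf: "no_common_zero a (fibre_inf (int b - int m1) g1) (fibre_inf (int b - int m2) g2) (fibre_inf (int b - int m3) g3)"
  proof (rule no_common_zero_of_combination[OF inf])
    fix k
    show "fibre_inf (int b) (P $ k) = fibre_inf (int b - int m1) g1 * [:coeff (Q1 $ k) m1:] + fibre_inf (int b - int m2) g2 * [:coeff (Q2 $ k) m2:]
      + fibre_inf (int b - int m3) g3 * [:coeff (Q3 $ k) m3:]"
      using mvb by (simp only: g fibre_inf_add fibre_inf_mult_const[OF bg(1)] fibre_inf_mult_const[OF bg(2)] fibre_inf_mult_const[OF bg(3)] vdeg_le_def)
  qed
  have neg: "bideg_le c d (- f)" if "bideg_le c d f" for c d and f :: "'k poly poly" using that by (rule bideg_le_uminus)
  have "\<exists>c. vbideg_le (int a) (int b - int n + int m1) c \<and> pdot c Q1 = 0 \<and> pdot c Q2 = - g3 \<and> pdot c Q3 = g2"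
    using bn msum bg by (intro minimal_basis_lift[OF mb]) (auto intro!: neg elim!: bideg_le_mono)
  then obtain L1 where L1: "vbideg_le (int a) (int b - int n + int m1) L1" "pdot L1 Q1 = 0" "pdot L1 Q2 = - g3" "pdot L1 Q3 = g2" by blast
  have "\<exists>c. vbideg_le (int a) (int b - int n + int m2) c \<and> pdot c Q1 = g3 \<and> pdot c Q2 = 0 \<and> pdot c Q3 = - g1"
    using bn msum bg by (intro minimal_basis_lift[OF mb]) (auto intro!: neg elim!: bideg_le_mono)
  then obtain L2 where L2: "vbideg_le (int a) (int b - int n + int m2) L2" "pdot L2 Q1 = g3" "pdot L2 Q2 = 0" "pdot L2 Q3 = - g1" by blast
  have "\<exists>c. vbideg_le (int a) (int b - int n + int m3) c \<and> pdot c Q1 = - g2 \<and> pdot c Q2 = g1 \<and> pdot c Q3 = 0"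
    using bn msum bg by (intro minimal_basis_lift[OF mb]) (auto intro!: neg elim!: bideg_le_mono)
  then obtain L3 where L3: "vbideg_le (int a) (int b - int n + int m3) L3" "pdot L3 Q1 = - g2" "pdot L3 Q2 = g1" "pdot L3 Q3 = 0" by blast
  have CP: "(\<Sum>k\<in>UNIV. C $ k * P $ k) = pdot C Q1 * g1 + pdot C Q2 * g2 + pdot C Q3 * g3" for C
    unfolding g pdot_def sum_distrib_right sum.distrib[symmetric]
    by (intro sum.cong refl) (simp only: distrib_left mult_ac)
  have LP: "(\<Sum>k\<in>UNIV. L1 $ k * P $ k) = 0" "(\<Sum>k\<in>UNIV. L2 $ k * P $ k) = 0" "(\<Sum>k\<in>UNIV. L3 $ k * P $ k) = 0"
    unfolding CP L1 L2 L3 by simp_all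
  have dots: "pdot (comb4 S L1 L2 L3 \<beta> \<alpha>1 \<alpha>2 \<alpha>3) Q1 = \<alpha>2 * g3 - \<alpha>3 * g2"
    "pdot (comb4 S L1 L2 L3 \<beta> \<alpha>1 \<alpha>2 \<alpha>3) Q2 = \<alpha>3 * g1 - \<alpha>1 * g3"
    "pdot (comb4 S L1 L2 L3 \<beta> \<alpha>1 \<alpha>2 \<alpha>3) Q3 = \<alpha>1 * g2 - \<alpha>2 * g1" for \<beta> \<alpha>1 \<alpha>2 \<alpha>3
    by (simp_all add: pdot_comb4 mb_dot[OF mb] L1 L2 L3)
  have decomp: "\<exists>\<beta> \<alpha>1 \<alpha>2 \<alpha>3. bideg_le (2 * int a - 1) (int b - 1 - int n) \<beta> \<and> bideg_le (int a - 1) (int n - int m1 - 1) \<alpha>1 \<and>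
           bideg_le (int a - 1) (int n - int m2 - 1) \<alpha>2 \<and> bideg_le (int a - 1) (int n - int m3 - 1) \<alpha>3 \<and>
           C = comb4 S L1 L2 L3 \<beta> \<alpha>1 \<alpha>2 \<alpha>3"
    if C: "vbideg_le (2 * int a - 1) (int b - 1) C" and CP0: "(\<Sum>k\<in>UNIV. C $ k * P $ k) = 0" for C
  proof -
    \<comment> \<open>With \<open>e = 2b - 1\<close> the product of \<open>C\<close> and \<open>Q\<^sub>i\<close> has degree \<open>e - (b - m\<^sub>i)\<close> in \<open>x\<close>, as
      \<open>koszul_exact\<close> requires.\<close>
    let ?e = "2 * int b - 1"
    have b1: "bideg_le (2 * int a - 1) (?e - (int b - int m1)) (pdot C Q1)"
      "bideg_le (2 * int a - 1) (?e - (int b - int m2)) (pdot C Q2)"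
      "bideg_le (2 * int a - 1) (?e - (int b - int m3)) (pdot C Q3)"
      using bideg_le_pdot[OF C mvb(1)] bideg_le_pdot[OF C mvb(2)] bideg_le_pdot[OF C mvb(3)] by (auto elim!: bideg_le_mono)
    obtain \<alpha>1 \<alpha>2 \<alpha>3 where b\<alpha>: "bideg_le (int a - 1) (?e - (int b - int m2) - (int b - int m3)) \<alpha>1"
      "bideg_le (int a - 1) (?e - (int b - int m1) - (int b - int m3)) \<alpha>2"
      "bideg_le (int a - 1) (?e - (int b - int m1) - (int b - int m2)) \<alpha>3"
      and eq: "pdot C Q1 = \<alpha>2 * g3 - \<alpha>3 * g2" "pdot C Q2 = \<alpha>3 * g1 - \<alpha>1 * g3" "pdot C Q3 = \<alpha>1 * g2 - \<alpha>2 * g1"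
      using koszul_exact[OF a gfib ginf bg b1 CP0[unfolded CP]] by blast
    have b\<alpha>': "bideg_le (int a - 1) (int n - int m1 - 1) \<alpha>1" "bideg_le (int a - 1) (int n - int m2 - 1) \<alpha>2" "bideg_le (int a - 1) (int n - int m3 - 1) \<alpha>3"
      using b\<alpha> msum by (auto elim!: bideg_le_mono)
    define R where "R = (\<chi> k. C $ k - comb4 S L1 L2 L3 0 \<alpha>1 \<alpha>2 \<alpha>3 $ k)"
    have pR: "pdot R Q = pdot C Q - pdot (comb4 S L1 L2 L3 0 \<alpha>1 \<alpha>2 \<alpha>3) Q" for Q
      by (simp only: pdot_def R_def vec_lambda_beta left_diff_distrib sum_subtractf)
    have al: "bideg_le (2 * int a - 1) (int b - 1) (\<alpha> * L $ k)"
      if "bideg_le (int a - 1) (int n - int m - 1) \<alpha>" "vbideg_le (int a) (int b - int n + int m) L" for \<alpha> L m k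
    proof -
      have "bideg_le (int a - 1 + int a) (int n - int m - 1 + (int b - int n + int m)) (\<alpha> * L $ k)"
        using that by (intro bideg_le_mult) (auto simp: vbideg_le_def)
      then show ?thesis by (rule bideg_le_mono) auto
    qed
    have "vbideg_le (2 * int a - 1) (int b - 1) R"
      unfolding vbideg_le_def
    proof
      fix k
      have "bideg_le (2 * int a - 1) (int b - 1) (C $ k - (\<alpha>1 * L1 $ k + \<alpha>2 * L2 $ k + \<alpha>3 * L3 $ k))"
        using C by (intro bideg_le_diff bideg_le_add al[OF b\<alpha>'(1) L1(1)] al[OF b\<alpha>'(2) L2(1)] al[OF b\<alpha>'(3) L3(1)]) (simp add: vbideg_le_def)
      then show "bideg_le (2 * int a - 1) (int b - 1) (R $ k)" by (simp add: R_def comb4_def)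
    qed
    then have bR: "vbideg_le (int (2 * a - 1)) (int b - 1) R" using a by (simp add: of_nat_diff)
    have "pdot R Q1 = 0" "pdot R Q2 = 0" "pdot R Q3 = 0" unfolding pR dots eq by simp_all
    from minimal_basis_orthogonal[OF mb bR this] obtain \<beta> where \<beta>: "\<And>k. R $ k = \<beta> * [:S $ k:]" "bideg_le (int (2 * a - 1)) (int b - 1 - int n) \<beta>" by blast
    have "C = comb4 S L1 L2 L3 \<beta> \<alpha>1 \<alpha>2 \<alpha>3"
    proof (rule vec_ext_iff[THEN iffD2], intro allI)
      fix k
      have "C $ k = R $ k + comb4 S L1 L2 L3 0 \<alpha>1 \<alpha>2 \<alpha>3 $ k" by (simp add: R_def)
      then show "C $ k = comb4 S L1 L2 L3 \<beta> \<alpha>1 \<alpha>2 \<alpha>3 $ k" unfolding \<beta>(1) by (simp add: comb4_def)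
    qed
    moreover have "bideg_le (2 * int a - 1) (int b - 1 - int n) \<beta>" using \<beta>(2) a by (simp add: of_nat_diff)
    ultimately show ?thesis using b\<alpha>' by blast
  qed
  have inj: "\<beta> = 0 \<and> \<alpha>1 = 0 \<and> \<alpha>2 = 0 \<and> \<alpha>3 = 0"
    if d: "degree \<alpha>1 < a" "degree \<alpha>2 < a" "degree \<alpha>3 < a" and z: "comb4 S L1 L2 L3 \<beta> \<alpha>1 \<alpha>2 \<alpha>3 = 0" for \<beta> \<alpha>1 \<alpha>2 \<alpha>3
  proof -
    have "pdot (comb4 S L1 L2 L3 \<beta> \<alpha>1 \<alpha>2 \<alpha>3) Q = 0" for Q unfolding z by (simp add: pdot_def)
    then have e: "\<alpha>2 * g3 - \<alpha>3 * g2 = 0" "\<alpha>3 * g1 - \<alpha>1 * g3 = 0" "\<alpha>1 * g2 - \<alpha>2 * g1 = 0"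
      using dots by metis+
    have "fibre x \<alpha>1 = 0 \<and> fibre x \<alpha>2 = 0 \<and> fibre x \<alpha>3 = 0" for x
    proof (rule parallel_to_no_common_zero[OF gfib[of x]])
      show "degree (fibre x \<alpha>1) < a" "degree (fibre x \<alpha>2) < a" "degree (fibre x \<alpha>3) < a"
        using d le_less_trans[OF degree_fibre_le] by blast+
      show "fibre x \<alpha>2 * fibre x g3 = fibre x \<alpha>3 * fibre x g2" "fibre x \<alpha>3 * fibre x g1 = fibre x \<alpha>1 * fibre x g3"
        "fibre x \<alpha>1 * fibre x g2 = fibre x \<alpha>2 * fibre x g1"
        using e by (simp_all flip: fibre_mult)
    qed
    then have \<alpha>0: "\<alpha>1 = 0" "\<alpha>2 = 0" "\<alpha>3 = 0" using fibre_all_0 by blast+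
    obtain k where k: "S $ k \<noteq> 0" using S0 by (metis vec_ext_iff zero_index)
    have "comb4 S L1 L2 L3 \<beta> \<alpha>1 \<alpha>2 \<alpha>3 $ k = 0" using z by simp
    then have "\<beta> * [:S $ k:] = 0" by (simp only: comb4_def \<alpha>0 vec_lambda_beta mult_zero_left add_0_right)
    then have "\<beta> = 0" using k by (metis mult_eq_0_iff pCons_eq_0_iff)
    then show ?thesis using \<alpha>0 by blast
  qed
  show ?thesis
    by (intro exI[of _ L1] exI[of _ L2] exI[of _ L3] conjI allI impI L1(1) L2(1) L3(1) LP decomp)
      (use inj in blast)+
qed

section \<open>Bihomogeneous polynomials and their affine charts\<close>

lemma bivar_keys: "Poly_Mapping.keys m \<subseteq> {Vs, Vt, Vu, Vv}"
  using bivar.exhaust by auto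

lemma monom_val_bivar: "monom_val x m = x Vs ^ lk m Vs * x Vt ^ lk m Vt * x Vu ^ lk m Vu * x Vv ^ lk m Vv"
  by (simp add: monom_val_superset[OF _ bivar_keys] mult.assoc)

lemma bivar_mon_eqI:
  assumes "lk m Vs = lk m' Vs" "lk m Vt = lk m' Vt" "lk m Vu = lk m' Vu" "lk m Vv = lk m' Vv"
  shows "m = m'"
proof (rule poly_mapping_eqI)
  fix k show "lk m k = lk m' k" using assms by (cases k) auto
qed

definition dehom :: "'k::comm_ring_1 R \<Rightarrow> 'k poly poly" where
  "dehom = subst_mp (\<lambda>c. [:[:c:]:]) (\<lambda>w. case w of Vs \<Rightarrow> 1 | Vt \<Rightarrow> [:0, 1:] | Vu \<Rightarrow> 1 | Vv \<Rightarrow> [:[:0, 1:]:])"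

lemma dehom_hom: "comm_ring_hom dehom"
  unfolding dehom_def by (intro subst_mp_hom hom_const_poly hom_id)

interpretation dehom: comm_ring_hom "dehom :: 'k::comm_ring_1 R \<Rightarrow> _"
  by (rule dehom_hom)

lemma X_power: "[:0, 1 :: 'a::comm_ring_1:] ^ k = monom 1 k"
  by (induction k) (simp_all add: monom_0 monom_Suc)

lemma const_poly_power: "[:q :: 'a::comm_ring_1:] ^ k = [:q ^ k:]"
  by (induction k) simp_all

lemma dehom_single: "dehom (Poly_Mapping.single m c) = monom (monom c (lk m Vv)) (lk m Vt)"
proof -
  have 1: "monom 1 i * [:q:] = monom q i" for i and q :: "'a poly"
    by (simp add: smult_monom mult.commute[of _ "[:q:]"])
  have 2: "[:[:c:]:] * monom q i = monom (smult c q) i" for i q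
    by (simp add: smult_monom)
  have "dehom (Poly_Mapping.single m c) = [:[:c:]:] * (monom 1 (lk m Vt) * [:monom 1 (lk m Vv):])"
    unfolding dehom_def
    by (subst subst_mp_single)
      (simp_all only: monom_val_bivar bivar.case power_one X_power const_poly_power mult_1_left mult_1_right pCons_0_0)
  then show ?thesis unfolding 1 2 by (simp add: smult_monom)
qed

lemma coeff_dehom_sum: "coeff (coeff (dehom f) i) j = (\<Sum>m\<in>Poly_Mapping.keys f. if lk m Vt = i \<and> lk m Vv = j then lk f m else 0)"
proof -
  have "dehom f = (\<Sum>m\<in>Poly_Mapping.keys f. monom (monom (lk f m) (lk m Vv)) (lk m Vt))"
    by (subst poly_mapping_sum_single) (simp add: dehom.hom_sum dehom_single)
  then show ?thesis by (simp add: coeff_sum if_distrib[where f="\<lambda>p. coeff p j"] cong: if_cong)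
      (intro sum.cong, auto)
qed

text \<open>
  The monomial \<open>s\<^bsup>c-i\<^esup> t\<^sup>i u\<^bsup>d-j\<^esup> v\<^sup>j\<close>, which dehomogenizes to \<open>t\<^sup>i v\<^sup>j\<close>.
\<close>

definition bmon :: "nat \<Rightarrow> nat \<Rightarrow> nat \<Rightarrow> nat \<Rightarrow> bivar \<Rightarrow>\<^sub>0 nat" where
  "bmon c d i j = Poly_Mapping.single Vs (c - i) + Poly_Mapping.single Vt i +
     Poly_Mapping.single Vu (d - j) + Poly_Mapping.single Vv j"

lemma lookup_bmon [simp]: "lk (bmon c d i j) Vs = c - i" "lk (bmon c d i j) Vt = i"
  "lk (bmon c d i j) Vu = d - j" "lk (bmon c d i j) Vv = j"
  by (simp_all add: bmon_def lookup_add lookup_single when_def)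

lemma bihom_key:
  assumes "f \<in> bihom (int c) (int d)" "m \<in> Poly_Mapping.keys f"
  shows "m = bmon c d (lk m Vt) (lk m Vv) \<and> lk m Vt \<le> c \<and> lk m Vv \<le> d"
proof -
  have "lk m Vs + lk m Vt = c" "lk m Vu + lk m Vv = d" using assms unfolding bihom_def by force+
  then show ?thesis by (auto intro!: bivar_mon_eqI)
qed

lemma bihom_neg: "f \<in> bihom c d \<Longrightarrow> c < 0 \<or> d < 0 \<Longrightarrow> f = 0"
proof -
  assume "f \<in> bihom c d" "c < 0 \<or> d < 0"
  then have "Poly_Mapping.keys f = {}" unfolding bihom_def by force
  then show "f = 0" by simp
qed

lemma bihom_0 [simp]: "0 \<in> bihom c d" by (simp add: bihom_def)

lemma bihom_add: "f \<in> bihom c d \<Longrightarrow> g \<in> bihom c d \<Longrightarrow> f + g \<in> bihom c d"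
  using Poly_Mapping.keys_add[of f g] unfolding bihom_def by blast

lemma bihom_sum: "(\<And>i. i \<in> A \<Longrightarrow> f i \<in> bihom c d) \<Longrightarrow> sum f A \<in> bihom c d"
  by (induction A rule: infinite_finite_induct) (auto intro: bihom_add)

lemma bihom_mult:
  assumes "f \<in> bihom c d" "g \<in> bihom c' d'" shows "f * g \<in> bihom (c + c') (d + d')"
  unfolding bihom_def
proof (intro CollectI ballI)
  fix m assume "m \<in> Poly_Mapping.keys (f * g)"
  then obtain m1 m2 where m: "m = m1 + m2" "m1 \<in> Poly_Mapping.keys f" "m2 \<in> Poly_Mapping.keys g"
    using keys_mult[of f g] by auto
  then show "int (lk m Vs + lk m Vt) = c + c' \<and> int (lk m Vu + lk m Vv) = d + d'"
    using assms unfolding bihom_def by (auto simp: lookup_add)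
qed

lemma bihom_const: "const_mp c \<in> bihom 0 0"
  by (cases "c = 0") (simp_all add: bihom_def)

lemma bihom_scale: "f \<in> bihom c d \<Longrightarrow> const_mp r * f \<in> bihom c d"
  using bihom_mult[OF bihom_const, of f c d r] by simp

lemma bihom_uminus: "f \<in> bihom c d \<Longrightarrow> - f \<in> bihom c d"
  unfolding bihom_def by simp

lemma bihom_diff: "f \<in> bihom c d \<Longrightarrow> g \<in> bihom c d \<Longrightarrow> f - g \<in> bihom c d"
  using bihom_add[of f c d "- g"] bihom_uminus[of g c d] by simp

lemma coeff_dehom:
  assumes "f \<in> bihom (int c) (int d)"
  shows "coeff (coeff (dehom f) i) j = (if i \<le> c \<and> j \<le> d then lk f (bmon c d i j) else 0)"
proof -
  have "coeff (coeff (dehom f) i) j = (\<Sum>m\<in>Poly_Mapping.keys f. if m = bmon c d i j \<and> i \<le> c \<and> j \<le> d then lk f m else 0)"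
    unfolding coeff_dehom_sum
    by (intro sum.cong refl if_cong) (use bihom_key[OF assms] in auto)
  also have "\<dots> = (if i \<le> c \<and> j \<le> d then lk f (bmon c d i j) else 0)"
    by (auto simp: in_keys_iff)
  finally show ?thesis .
qed

lemma bideg_le_dehom:
  assumes "f \<in> bihom c d" shows "bideg_le c d (dehom f)"
proof (cases "c < 0 \<or> d < 0")
  case True then show ?thesis using bihom_neg[OF assms] by simp
next
  case False
  then have "f \<in> bihom (int (nat c)) (int (nat d))" using assms by simp
  from coeff_dehom[OF this] show ?thesis using False by (auto simp: bideg_le_def split: if_splits)
qed

lemma dehom_inj:
  assumes "f \<in> bihom c d" "dehom f = 0" shows "f = 0"
proof (cases "c < 0 \<or> d < 0")
  case True then show ?thesis using bihom_neg[OF assms(1)] by simp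
next
  case False
  then have f: "f \<in> bihom (int (nat c)) (int (nat d))" using assms by simp
  show ?thesis
  proof (rule ccontr)
    assume "f \<noteq> 0"
    then obtain m where m: "m \<in> Poly_Mapping.keys f" by fastforce
    have "coeff (coeff (dehom f) (lk m Vt)) (lk m Vv) = lk f m"
      using coeff_dehom[OF f] bihom_key[OF f m] by auto
    then show False using m assms(2) by (simp add: in_keys_iff)
  qed
qed

lemma dehom_eqI: "f \<in> bihom c d \<Longrightarrow> g \<in> bihom c d \<Longrightarrow> dehom f = dehom g \<Longrightarrow> f = g"
  using dehom_inj[of "f - g" c d] bihom_diff[of f c d g] by (simp add: dehom.hom_minus)

lemma bmon_bihom: "i \<le> c \<Longrightarrow> j \<le> d \<Longrightarrow> Poly_Mapping.single (bmon c d i j) r \<in> bihom (int c) (int d)"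
  by (auto simp: bihom_def split: if_splits)

lemma homogenize:
  assumes "bideg_le c d P" shows "\<exists>f\<in>bihom c d. dehom f = P"
proof (cases "c < 0 \<or> d < 0")
  case True
  then have "P = 0" using assms by (intro poly_eqI) (force simp: bideg_le_def)
  then show ?thesis by (intro bexI[of _ 0]) auto
next
  case False
  define c' d' where "c' = nat c" and "d' = nat d"
  have cd: "c = int c'" "d = int d'" using False by (auto simp: c'_def d'_def)
  define f where "f = (\<Sum>i\<le>c'. \<Sum>j\<le>d'. Poly_Mapping.single (bmon c' d' i j) (coeff (coeff P i) j))"
  have f: "f \<in> bihom c d" unfolding cd f_def by (intro bihom_sum bmon_bihom) auto
  have "dehom f = P"
  proof (intro poly_eqI)
    fix i j
    have "coeff (coeff (dehom f) i) j = (\<Sum>i'\<le>c'. \<Sum>j'\<le>d'. if i' = i \<and> j' = j then coeff (coeff P i') j' else 0)"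
      by (simp add: f_def dehom.hom_sum dehom_single coeff_sum) (intro sum.cong refl, auto)
    also have "\<dots> = (\<Sum>i'\<le>c'. if i' = i then (\<Sum>j'\<le>d'. if j' = j then coeff (coeff P i') j' else 0) else 0)"
      by (intro sum.cong refl) auto
    also have "\<dots> = (if i \<le> c' \<and> j \<le> d' then coeff (coeff P i) j else 0)" by simp
    also have "\<dots> = coeff (coeff P i) j" using bideg_leD[OF assms, of i j] by (auto simp: cd)
    finally show "coeff (coeff (dehom f) i) j = coeff (coeff P i) j" .
  qed
  then show ?thesis using f by blast
qed

lemma homogenize_vec:
  assumes "vbideg_le c d P" shows "\<exists>x\<in>bihom4 c d. \<forall>k. dehom (x $ k) = P $ k"
proof -
  have "\<forall>k. \<exists>f. f \<in> bihom c d \<and> dehom f = P $ k" using assms homogenize unfolding vbideg_le_def by blast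
  from choice[OF this] obtain f where "\<forall>k. f k \<in> bihom c d \<and> dehom (f k) = P $ k" by blast
  then show ?thesis by (intro bexI[of _ "\<chi> k. f k"]) (auto simp: bihom4_def)
qed

definition biproj_pt :: "'k \<Rightarrow> 'k \<Rightarrow> 'k \<Rightarrow> 'k \<Rightarrow> bivar \<Rightarrow> 'k" where
  "biproj_pt s t u v w = (case w of Vs \<Rightarrow> s | Vt \<Rightarrow> t | Vu \<Rightarrow> u | Vv \<Rightarrow> v)"

lemma biproj_pt_biproj: "(s \<noteq> 0 \<or> t \<noteq> 0) \<Longrightarrow> (u \<noteq> 0 \<or> v \<noteq> 0) \<Longrightarrow> biproj_pt s t u v \<in> biproj_coords"
  by (simp add: biproj_coords_def biproj_pt_def)

lemma eval_mp_bihom: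
  fixes f :: "'k::field R"
  assumes "f \<in> bihom (int a) (int b)"
  shows "eval_mp (biproj_pt s t u v) f = (\<Sum>i\<le>a. (\<Sum>j\<le>b. coeff (coeff (dehom f) i) j * u ^ (b - j) * v ^ j) * s ^ (a - i) * t ^ i)"
proof -
  let ?I = "{..a} \<times> {..b}"
  have sub: "Poly_Mapping.keys f \<subseteq> (\<lambda>(i, j). bmon a b i j) ` ?I"
  proof
    fix m assume "m \<in> Poly_Mapping.keys f"
    from bihom_key[OF assms this] show "m \<in> (\<lambda>(i, j). bmon a b i j) ` ?I"
      by (intro image_eqI[of _ _ "(lk m Vt, lk m Vv)"]) auto
  qed
  have inj: "inj_on (\<lambda>(i, j). bmon a b i j) ?I"
    by (rule inj_onI) (metis (mono_tags, lifting) case_prod_conv lookup_bmon(2,4) prod.collapse)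
  have "eval_mp (biproj_pt s t u v) f = (\<Sum>m\<in>(\<lambda>(i, j). bmon a b i j) ` ?I. lk f m * monom_val (biproj_pt s t u v) m)"
    unfolding eval_mp_subst_mp by (rule subst_mp_superset) (use sub in auto)
  also have "\<dots> = (\<Sum>(i, j)\<in>?I. lk f (bmon a b i j) * (s ^ (a - i) * t ^ i * u ^ (b - j) * v ^ j))"
    by (subst sum.reindex[OF inj]) (simp add: case_prod_unfold monom_val_bivar biproj_pt_def)
  also have "\<dots> = (\<Sum>i\<le>a. \<Sum>j\<le>b. lk f (bmon a b i j) * (s ^ (a - i) * t ^ i * u ^ (b - j) * v ^ j))"
    by (simp add: sum.cartesian_product)
  also have "\<dots> = (\<Sum>i\<le>a. (\<Sum>j\<le>b. coeff (coeff (dehom f) i) j * u ^ (b - j) * v ^ j) * s ^ (a - i) * t ^ i)"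
    by (simp add: coeff_dehom[OF assms] sum_distrib_left sum_distrib_right mult_ac)
  finally show ?thesis .
qed

lemma poly_as_sum_le:
  fixes p :: "'a::comm_ring_1 poly"
  assumes "degree p \<le> n" shows "poly p x = (\<Sum>i\<le>n. coeff p i * x ^ i)"
proof -
  have "(\<Sum>i\<le>degree p. coeff p i * x ^ i) = (\<Sum>i\<le>n. coeff p i * x ^ i)"
    using assms by (intro sum.mono_neutral_left) (auto simp: coeff_eq_0)
  then show ?thesis by (simp add: poly_altdef)
qed

lemma sum_zero_power: "(\<Sum>i\<le>(a::nat). f i * (0::'a::comm_semiring_1) ^ (a - i)) = f a"
proof -
  have "(\<Sum>i\<le>a. f i * (0::'a) ^ (a - i)) = (\<Sum>i\<le>a. if i = a then f i else 0)"
    by (intro sum.cong) (auto simp: power_0_left)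
  then show ?thesis by simp
qed

text \<open>
  Every point of \<open>P\<^sup>1 \<times> P\<^sup>1\<close> has coordinates of one of these four shapes, so that a common zero is seen
  on a fibre or on the fibre at infinity.
\<close>

lemma eval_charts:
  fixes f :: "'k::field R"
  assumes f: "f \<in> bihom (int a) (int b)"
  shows "eval_mp (biproj_pt 1 z 1 x) f = poly (fibre x (dehom f)) z"
    "eval_mp (biproj_pt 0 1 1 x) f = coeff (fibre x (dehom f)) a"
    "eval_mp (biproj_pt 1 z 0 1) f = poly (fibre_inf (int b) (dehom f)) z"
    "eval_mp (biproj_pt 0 1 0 1) f = coeff (fibre_inf (int b) (dehom f)) a"
proof -
  have b: "bideg_le (int a) (int b) (dehom f)" by (rule bideg_le_dehom[OF f])
  then have d: "degree (dehom f) \<le> a" "\<And>i. degree (coeff (dehom f) i) \<le> b"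
    by (auto simp: bideg_le_iff_deg_le deg_le_iff_degree)
  have s: "poly (coeff (dehom f) i) x = (\<Sum>j\<le>b. coeff (coeff (dehom f) i) j * 1 ^ (b - j) * x ^ j)" for i x
    using poly_as_sum_le[OF d(2)] by simp
  have t: "coeff (fibre_inf (int b) (dehom f)) i = (\<Sum>j\<le>b. coeff (coeff (dehom f) i) j * 0 ^ (b - j) * 1 ^ j)" for i
    by (simp add: sum_zero_power)
  have ds: "degree (fibre x (dehom f)) \<le> a" "degree (fibre_inf (int b) (dehom f)) \<le> a"
    using d(1) degree_fibre_le degree_fibre_inf_le order_trans by blast+
  show "eval_mp (biproj_pt 1 z 1 x) f = poly (fibre x (dehom f)) z"
    unfolding eval_mp_bihom[OF f] s[symmetric] poly_as_sum_le[OF ds(1)] by simp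
  show "eval_mp (biproj_pt 1 z 0 1) f = poly (fibre_inf (int b) (dehom f)) z"
    unfolding eval_mp_bihom[OF f] t[symmetric] poly_as_sum_le[OF ds(2)] by simp
  have z: "(\<Sum>i\<le>a. F i * 0 ^ (a - i) * 1 ^ i) = F a" for F :: "nat \<Rightarrow> 'k"
    using sum_zero_power[of F a] by simp
  show "eval_mp (biproj_pt 0 1 1 x) f = coeff (fibre x (dehom f)) a"
    unfolding eval_mp_bihom[OF f] s[symmetric] z by simp
  show "eval_mp (biproj_pt 0 1 0 1) f = coeff (fibre_inf (int b) (dehom f)) a"
    unfolding eval_mp_bihom[OF f] t[symmetric] z ..
qed

lemma no_common_zero4_of_basepoint_free:
  fixes p :: "'k::field R ^ 4"
  assumes p: "p \<in> bihom4 (int a) (int b)" and bpf: "basepoint_free p"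
  shows "no_common_zero4 a (\<lambda>k. fibre x (dehom (p $ k)))" "no_common_zero4 a (\<lambda>k. fibre_inf (int b) (dehom (p $ k)))"
proof -
  have pk: "p $ k \<in> bihom (int a) (int b)" for k using p by (simp add: bihom4_def)
  have nz: "\<exists>k. eval_mp (biproj_pt s t u v) (p $ k) \<noteq> 0" if "s \<noteq> 0 \<or> t \<noteq> 0" "u \<noteq> 0 \<or> v \<noteq> 0" for s t u v
    using bpf biproj_pt_biproj[OF that] unfolding basepoint_free_def by blast
  show "no_common_zero4 a (\<lambda>k. fibre x (dehom (p $ k)))"
    unfolding no_common_zero4_def eval_charts(1)[OF pk, symmetric] eval_charts(2)[OF pk, symmetric] using nz by simp
  show "no_common_zero4 a (\<lambda>k. fibre_inf (int b) (dehom (p $ k)))"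
    unfolding no_common_zero4_def eval_charts(3)[OF pk, symmetric] eval_charts(4)[OF pk, symmetric] using nz by simp
qed

text \<open>
  Such a syzygy would be \<open>\<alpha> \<times> f\<close> with \<open>\<alpha>\<close> of bidegree \<open>(a - 1, -1)\<close>.
\<close>

lemma three_forms_no_syzygy:
  fixes f1 f2 f3 :: "'k::alg_closed_field R"
  assumes a: "a \<ge> 1" and f: "f1 \<in> bihom (int a) (int b)" "f2 \<in> bihom (int a) (int b)" "f3 \<in> bihom (int a) (int b)"
    and nz: "\<And>x. x \<in> biproj_coords \<Longrightarrow> eval_mp x f1 \<noteq> 0 \<or> eval_mp x f2 \<noteq> 0 \<or> eval_mp x f3 \<noteq> 0"
    and c: "c1 \<in> bihom (2 * int a - 1) (int b - 1)" "c2 \<in> bihom (2 * int a - 1) (int b - 1)" "c3 \<in> bihom (2 * int a - 1) (int b - 1)"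
    and syz: "c1 * f1 + c2 * f2 + c3 * f3 = 0"
  shows "c1 = 0 \<and> c2 = 0 \<and> c3 = 0"
proof -
  have nz': "eval_mp (biproj_pt s t u v) f1 \<noteq> 0 \<or> eval_mp (biproj_pt s t u v) f2 \<noteq> 0 \<or> eval_mp (biproj_pt s t u v) f3 \<noteq> 0"
    if "s \<noteq> 0 \<or> t \<noteq> 0" "u \<noteq> 0 \<or> v \<noteq> 0" for s t u v
    by (rule nz[OF biproj_pt_biproj[OF that]])
  have fib: "no_common_zero a (fibre x (dehom f1)) (fibre x (dehom f2)) (fibre x (dehom f3))" for x
    unfolding no_common_zero_def eval_charts(1,2)[OF f(1), symmetric] eval_charts(1,2)[OF f(2), symmetric] eval_charts(1,2)[OF f(3), symmetric]
    using nz' by simp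
  have inf: "no_common_zero a (fibre_inf (int b) (dehom f1)) (fibre_inf (int b) (dehom f2)) (fibre_inf (int b) (dehom f3))"
    unfolding no_common_zero_def eval_charts(3,4)[OF f(1), symmetric] eval_charts(3,4)[OF f(2), symmetric] eval_charts(3,4)[OF f(3), symmetric]
    using nz' by simp
  have bc: "bideg_le (2 * int a - 1) (2 * int b - 1 - int b) (dehom c1)" "bideg_le (2 * int a - 1) (2 * int b - 1 - int b) (dehom c2)"
    "bideg_le (2 * int a - 1) (2 * int b - 1 - int b) (dehom c3)"
    using bideg_le_dehom[OF c(1)] bideg_le_dehom[OF c(2)] bideg_le_dehom[OF c(3)] by simp_all
  have syz': "dehom c1 * dehom f1 + dehom c2 * dehom f2 + dehom c3 * dehom f3 = 0"
    using arg_cong[OF syz, of dehom] by (simp add: dehom.hom_add dehom.hom_mult)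
  obtain \<alpha>1 \<alpha>2 \<alpha>3 where b\<alpha>: "bideg_le (int a - 1) (2 * int b - 1 - int b - int b) \<alpha>1" "bideg_le (int a - 1) (2 * int b - 1 - int b - int b) \<alpha>2"
    "bideg_le (int a - 1) (2 * int b - 1 - int b - int b) \<alpha>3"
    and eq: "dehom c1 = \<alpha>2 * dehom f3 - \<alpha>3 * dehom f2" "dehom c2 = \<alpha>3 * dehom f1 - \<alpha>1 * dehom f3" "dehom c3 = \<alpha>1 * dehom f2 - \<alpha>2 * dehom f1"
    using koszul_exact[OF a fib inf bideg_le_dehom[OF f(1)] bideg_le_dehom[OF f(2)] bideg_le_dehom[OF f(3)] bc syz'] by blast
  have "\<alpha>1 = 0" "\<alpha>2 = 0" "\<alpha>3 = 0" using b\<alpha> by (auto intro: bideg_le_neg)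
  then have "dehom c1 = 0" "dehom c2 = 0" "dehom c3 = 0" using eq by simp_all
  then show ?thesis using dehom_inj c by blast
qed

section \<open>Bases of the bigraded components\<close>

notation Matrix.vec_index (infixl "$v" 100)

lemma (in vector_space) family_independent:
  assumes I: "finite I" and ind: "\<forall>c. (\<Sum>i\<in>I. scale (c i) (v i)) = 0 \<longrightarrow> (\<forall>i\<in>I. c i = 0)"
  shows "inj_on v I" and "independent (v ` I)"
proof -
  show inj: "inj_on v I"
  proof (rule inj_onI, rule ccontr)
    fix i j assume ij: "i \<in> I" "j \<in> I" "v i = v j" "i \<noteq> j"
    have "(\<Sum>k\<in>I. scale ((if k = i then 1 else 0) - (if k = j then 1 else 0)) (v k)) =
      (\<Sum>k\<in>I. if k = i then v k else 0) - (\<Sum>k\<in>I. if k = j then v k else 0)"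
      by (simp add: scale_left_diff_distrib sum_subtractf if_distrib[where f="\<lambda>c. scale c _"] cong: if_cong)
    also have "\<dots> = 0" using ij I by simp
    finally have "(if i = i then 1 else 0) - (if i = j then 1 else 0) = (0 :: 'a)"
      using ind[rule_format, of "\<lambda>k. (if k = i then 1 else 0) - (if k = j then 1 else 0)" i] ij(1) by simp
    then show False using ij(4) by simp
  qed
  show "independent (v ` I)"
  proof (rule independent_if_scalars_zero)
    fix f x assume "(\<Sum>x\<in>v ` I. scale (f x) x) = 0" "x \<in> v ` I"
    then obtain i where i: "i \<in> I" "x = v i" by blast
    have "(\<Sum>i\<in>I. scale (f (v i)) (v i)) = 0"
      using \<open>(\<Sum>x\<in>v ` I. scale (f x) x) = 0\<close> by (simp add: sum.reindex[OF inj])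
    then show "f x = 0" using ind[rule_format, of "\<lambda>i. f (v i)" i] i by simp
  qed (use I in simp)
qed

lemma (in vector_space) family_basis:
  assumes I: "finite I" and ind: "\<forall>c. (\<Sum>i\<in>I. scale (c i) (v i)) = 0 \<longrightarrow> (\<forall>i\<in>I. c i = 0)"
  shows "\<exists>bs. ordered_basis bs (span (v ` I)) \<and> length bs = card I"
proof -
  note fam = family_independent[where I = I and v = v, OF assms]
  obtain bs where bs: "set bs = v ` I" "distinct bs" using finite_distinct_list[of "v ` I"] I by auto
  then have "length bs = card (v ` I)" using distinct_card by metis
  then have "length bs = card I" by (simp add: card_image[OF fam(1)])
  then show ?thesis using bs fam(2) by (auto simp: ordered_basis_def)
qed

lemma (in vector_space) family_dependent:
  assumes I: "finite I" and T: "finite T" "\<And>i. i \<in> I \<Longrightarrow> v i \<in> span T" and card: "card T < card I"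
  shows "\<exists>c. (\<Sum>i\<in>I. scale (c i) (v i)) = 0 \<and> (\<exists>i\<in>I. c i \<noteq> 0)"
proof (rule ccontr)
  assume "\<nexists>c. (\<Sum>i\<in>I. scale (c i) (v i)) = 0 \<and> (\<exists>i\<in>I. c i \<noteq> 0)"
  then have ind: "\<forall>c. (\<Sum>i\<in>I. scale (c i) (v i)) = 0 \<longrightarrow> (\<forall>i\<in>I. c i = 0)" by blast
  note fam = family_independent[where I = I and v = v, OF I ind]
  have "card (v ` I) \<le> card T" using independent_span_bound[OF T(1) fam(2)] T(2) by blast
  then show False using card by (simp add: card_image[OF fam(1)])
qed

lemma (in Modules.module) independent_finite:
  assumes "finite A" "\<And>f. (\<Sum>x\<in>A. scale (f x) x) = 0 \<Longrightarrow> \<forall>x\<in>A. f x = 0"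
  shows "independent A"
  unfolding independent_explicit_module
proof (intro allI impI)
  fix t u v assume t: "finite t" "t \<subseteq> A" "(\<Sum>v\<in>t. scale (u v) v) = 0" "v \<in> t"
  have "(\<Sum>x\<in>A. scale (if x \<in> t then u x else 0) x) = (\<Sum>x\<in>t. scale (if x \<in> t then u x else 0) x)"
    by (rule sum.mono_neutral_right) (use assms(1) t(2) in auto)
  also have "\<dots> = (\<Sum>v\<in>t. scale (u v) v)" by (rule sum.cong) auto
  finally have "\<forall>x\<in>A. (if x \<in> t then u x else 0) = 0" using t(3) by (intro assms(2)) simp
  then have "(if v \<in> t then u v else 0) = 0" using t(2,4) by blast
  then show "u v = 0" using t(4) by simp
qed

lemma (in Modules.module) ordered_basis_coords:
  assumes "ordered_basis bs M" "x \<in> M"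
  shows "\<exists>q. x = (\<Sum>j<length bs. scale (q j) (bs ! j))"
proof -
  have b: "distinct bs" "span (set bs) = M" using assms by (auto simp: ordered_basis_def)
  then obtain u where u: "x = (\<Sum>v\<in>set bs. scale (u v) v)" using assms(2) by (auto simp: span_finite)
  have "bij_betw ((!) bs) {..<length bs} (set bs)" by (rule bij_betw_nth) (use b(1) in auto)
  from sum.reindex_bij_betw[OF this, of "\<lambda>v. scale (u v) v"]
  have "x = (\<Sum>j<length bs. scale (u (bs ! j)) (bs ! j))" using u by simp
  then show ?thesis by (rule exI[of _ "\<lambda>j. u (bs ! j)"])
qed

definition mon_index :: "int \<Rightarrow> int \<Rightarrow> (nat \<times> nat) set" where
  "mon_index c d = {..<nat (c + 1)} \<times> {..<nat (d + 1)}"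

definition mon_form :: "int \<Rightarrow> int \<Rightarrow> nat \<times> nat \<Rightarrow> 'k::field R" where
  "mon_form c d x = Poly_Mapping.single (bmon (nat c) (nat d) (fst x) (snd x)) 1"

lemma finite_mon_index [simp]: "finite (mon_index c d)" by (simp add: mon_index_def)

lemma card_mon_index: "card (mon_index c d) = nat (c + 1) * nat (d + 1)" by (simp add: mon_index_def)

lemma const_mult_single: "const_mp c * Poly_Mapping.single m r = Poly_Mapping.single m (c * r)"
  by (simp add: mult_single)

lemma const_smult_mon_form: "const_mp c * mon_form c' d' x = Poly_Mapping.single (bmon (nat c') (nat d') (fst x) (snd x)) c"
  by (simp add: mon_form_def const_mult_single)

lemma mon_form_bihom: "x \<in> mon_index c d \<Longrightarrow> mon_form c d x \<in> bihom c d"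
proof -
  assume "x \<in> mon_index c d"
  then have "0 \<le> c" "0 \<le> d" "fst x \<le> nat c" "snd x \<le> nat d" by (auto simp: mon_index_def)
  then show ?thesis using bmon_bihom[of "fst x" "nat c" "snd x" "nat d" 1] by (simp add: mon_form_def)
qed

lemma bihom_coords:
  fixes f :: "'k::field R"
  assumes "f \<in> bihom c d" shows "\<exists>\<kappa>. f = (\<Sum>x\<in>mon_index c d. const_mp (\<kappa> x) * mon_form c d x)"
proof (cases "c < 0 \<or> d < 0")
  case True
  then have "mon_index c d = {}" by (auto simp: mon_index_def)
  then show ?thesis using bihom_neg[OF assms True] by simp
next
  case False
  define c' d' where "c' = nat c" and "d' = nat d"
  have cd: "c = int c'" "d = int d'" using False by (auto simp: c'_def d'_def)
  define \<kappa> where "\<kappa> = (\<lambda>x. lk f (bmon c' d' (fst x) (snd x)))"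
  have inj: "inj (\<lambda>x. bmon c' d' (fst x) (snd x))"
    by (rule injI) (metis lookup_bmon(2,4) prod_eq_iff)
  have "f = (\<Sum>x\<in>mon_index c d. const_mp (\<kappa> x) * mon_form c d x)"
  proof (rule poly_mapping_eqI)
    fix m
    have "lk (\<Sum>x\<in>mon_index c d. const_mp (\<kappa> x) * mon_form c d x) m = (\<Sum>x\<in>mon_index c d. if bmon c' d' (fst x) (snd x) = m then lk f m else 0)"
      unfolding const_smult_mon_form lookup_sum by (intro sum.cong refl) (auto simp: lookup_single when_def \<kappa>_def c'_def d'_def)
    also have "\<dots> = lk f m"
    proof (cases "m \<in> Poly_Mapping.keys f")
      case True
      from bihom_key[OF assms[unfolded cd] True] have m: "m = bmon c' d' (lk m Vt) (lk m Vv)" "lk m Vt \<le> c'" "lk m Vv \<le> d'" by auto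
      have "(\<Sum>x\<in>mon_index c d. if bmon c' d' (fst x) (snd x) = m then lk f m else 0) = (\<Sum>x\<in>mon_index c d. if x = (lk m Vt, lk m Vv) then lk f m else 0)"
      proof (intro sum.cong refl if_cong)
        fix x :: "nat \<times> nat"
        show "(bmon c' d' (fst x) (snd x) = m) = (x = (lk m Vt, lk m Vv))"
          using m(1) by (auto simp: prod_eq_iff)
      qed
      also have "\<dots> = lk f m"
      proof -
        have "nat (int n + 1) = Suc n" for n by (simp add: nat_add_distrib)
        then have "(lk m Vt, lk m Vv) \<in> mon_index c d" using m(2,3) by (simp add: mon_index_def cd)
        then show ?thesis by (subst sum.delta) (simp_all only: finite_mon_index if_True)
      qed
      finally show ?thesis .
    next
      case False then have "lk f m = 0" by (simp add: in_keys_iff)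
      then show ?thesis by (simp only: if_cancel sum.neutral_const)
    qed
    finally show "lk f m = lk (\<Sum>x\<in>mon_index c d. const_mp (\<kappa> x) * mon_form c d x) m" by simp
  qed
  then show ?thesis by blast
qed

lemma mon_form_independent:
  assumes "(\<Sum>x\<in>mon_index c d. const_mp (\<kappa> x) * (mon_form c d x :: 'k::field R)) = 0" "x \<in> mon_index c d"
  shows "\<kappa> x = 0"
proof -
  have "lk (\<Sum>x\<in>mon_index c d. const_mp (\<kappa> x) * (mon_form c d x :: 'k R)) (bmon (nat c) (nat d) (fst x) (snd x)) =
    (\<Sum>y\<in>mon_index c d. if y = x then \<kappa> y else 0)"
    unfolding const_smult_mon_form lookup_sum lookup_single when_def
  proof (intro sum.cong refl if_cong)
    fix y :: "nat \<times> nat"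
    show "(bmon (nat c) (nat d) (fst y) (snd y) = bmon (nat c) (nat d) (fst x) (snd x)) = (y = x)"
      by (metis lookup_bmon(2,4) prod_eq_iff)
  qed
  then show ?thesis using assms by simp
qed

lemma bihom_subspace: "KR.subspace (bihom c d)"
  unfolding KR.subspace_def by (auto intro: bihom_add bihom_scale)

lemma bihom_span: "KR.span (mon_form c d ` mon_index c d) = (bihom c d :: 'k::field R set)"
proof
  show "KR.span (mon_form c d ` mon_index c d) \<subseteq> (bihom c d :: 'k R set)"
    using mon_form_bihom by (intro KR.span_minimal bihom_subspace) auto
  show "(bihom c d :: 'k R set) \<subseteq> KR.span (mon_form c d ` mon_index c d)"
  proof
    fix f :: "'k R" assume "f \<in> bihom c d"
    then obtain \<kappa> where "f = (\<Sum>x\<in>mon_index c d. const_mp (\<kappa> x) * mon_form c d x)" using bihom_coords by blast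
    then show "f \<in> KR.span (mon_form c d ` mon_index c d)"
      by (auto intro!: KR.span_sum KR.span_scale intro: KR.span_base)
  qed
qed

lemma bihom_basis: "\<exists>gs. KR.ordered_basis gs (bihom c d :: 'k::field R set) \<and> length gs = nat (c + 1) * nat (d + 1)"
proof -
  have "\<forall>\<kappa>. (\<Sum>x\<in>mon_index c d. const_mp (\<kappa> x) * (mon_form c d x :: 'k R)) = 0 \<longrightarrow> (\<forall>x\<in>mon_index c d. \<kappa> x = 0)"
    using mon_form_independent by blast
  from KR.family_basis[OF finite_mon_index this] show ?thesis by (simp only: bihom_span card_mon_index)
qed

lemma four_component_basis:
  fixes T :: "nat \<Rightarrow> 'k::field R ^ 4" and c d :: "nat \<Rightarrow> int"
  assumes uniq: "\<And>f k. (\<And>k. k < 4 \<Longrightarrow> f k \<in> bihom (c k) (d k)) \<Longrightarrow> (\<Sum>k<4. f k *s T k) = 0 \<Longrightarrow> k < 4 \<Longrightarrow> f k = 0"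
    and sub: "KR4.subspace M" and inM: "\<And>f. (\<And>k. k < 4 \<Longrightarrow> f k \<in> bihom (c k) (d k)) \<Longrightarrow> (\<Sum>k<4. f k *s T k) \<in> M"
    and gen: "\<And>x. x \<in> M \<Longrightarrow> \<exists>f. (\<forall>k<4. f k \<in> bihom (c k) (d k)) \<and> x = (\<Sum>k<4. f k *s T k)"
  shows "\<exists>es. KR4.ordered_basis es M \<and> length es = (\<Sum>k<4. nat (c k + 1) * nat (d k + 1))"
proof -
  define I where "I = (SIGMA k:{..<4::nat}. mon_index (c k) (d k))"
  define e where "e = (\<lambda>(k, x). mon_form (c k) (d k) x *s T k)"
  have fin: "finite I" by (simp add: I_def)
  have regroup: "(\<Sum>y\<in>I. const_mp (\<kappa> y) *s e y) = (\<Sum>k<4. (\<Sum>x\<in>mon_index (c k) (d k). const_mp (\<kappa> (k, x)) * mon_form (c k) (d k) x) *s T k)" for \<kappa>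
  proof -
    have "(\<Sum>y\<in>I. const_mp (\<kappa> y) *s e y) = (\<Sum>k<4. \<Sum>x\<in>mon_index (c k) (d k). const_mp (\<kappa> (k, x)) *s e (k, x))"
      unfolding I_def by (subst sum.Sigma) (auto simp: case_prod_unfold)
    also have "\<dots> = (\<Sum>k<4. (\<Sum>x\<in>mon_index (c k) (d k). const_mp (\<kappa> (k, x)) * mon_form (c k) (d k) x) *s T k)"
      by (intro sum.cong refl) (simp add: e_def vec_ext_iff sum_distrib_right mult.assoc)
    finally show ?thesis .
  qed
  have comp: "(\<Sum>x\<in>mon_index (c k) (d k). const_mp (\<kappa> (k, x)) * mon_form (c k) (d k) x) \<in> bihom (c k) (d k)" for \<kappa> k
    by (intro bihom_sum bihom_scale mon_form_bihom)
  have ind': "\<kappa> y = 0" if z: "(\<Sum>y\<in>I. const_mp (\<kappa> y) *s e y) = 0" and y: "y \<in> I" for \<kappa> y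
  proof -
    obtain k x where kx: "y = (k, x)" "k < 4" "x \<in> mon_index (c k) (d k)" using y by (auto simp: I_def)
    have "(\<Sum>x\<in>mon_index (c k) (d k). const_mp (\<kappa> (k, x)) * mon_form (c k) (d k) x) = 0"
      by (rule uniq[of "\<lambda>k. \<Sum>x\<in>mon_index (c k) (d k). const_mp (\<kappa> (k, x)) * mon_form (c k) (d k) x"])
        (use comp z regroup kx in auto)
    then show ?thesis using mon_form_independent[where c = "c k" and d = "d k" and \<kappa> = "\<lambda>x. \<kappa> (k, x)" and x = x] kx by simp
  qed
  then have ind: "\<forall>\<kappa>. (\<Sum>y\<in>I. const_mp (\<kappa> y) *s e y) = 0 \<longrightarrow> (\<forall>y\<in>I. \<kappa> y = 0)" by blast
  have "KR4.span (e ` I) = M"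
  proof
    show "KR4.span (e ` I) \<subseteq> M"
    proof (rule KR4.span_minimal[OF _ sub], rule image_subsetI)
      fix y assume y: "y \<in> I"
      define \<kappa> where "\<kappa> = (\<lambda>y'. if y' = y then 1 else 0 :: 'k)"
      have "e y = (\<Sum>y'\<in>I. if y' = y then e y' else 0)" using y fin by simp
      also have "\<dots> = (\<Sum>y'\<in>I. const_mp (\<kappa> y') *s e y')" by (intro sum.cong) (auto simp: \<kappa>_def single_one)
      also have "\<dots> \<in> M" unfolding regroup by (intro inM comp)
      finally show "e y \<in> M" .
    qed
    show "M \<subseteq> KR4.span (e ` I)"
    proof
      fix x assume "x \<in> M"
      then obtain f where f: "\<And>k. k < 4 \<Longrightarrow> f k \<in> bihom (c k) (d k)" "x = (\<Sum>k<4. f k *s T k)" using gen by blast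
      have "\<forall>k. \<exists>\<kappa>. k < 4 \<longrightarrow> f k = (\<Sum>x\<in>mon_index (c k) (d k). const_mp (\<kappa> x) * mon_form (c k) (d k) x)"
        using bihom_coords[OF f(1)] by blast
      from choice[OF this] obtain \<kappa> where \<kappa>: "\<And>k. k < 4 \<Longrightarrow> f k = (\<Sum>x\<in>mon_index (c k) (d k). const_mp (\<kappa> k x) * mon_form (c k) (d k) x)" by blast
      have "x = (\<Sum>y\<in>I. const_mp (case_prod \<kappa> y) *s e y)" unfolding regroup f(2) by (intro sum.cong refl) (simp add: \<kappa>)
      then show "x \<in> KR4.span (e ` I)" by (auto intro!: KR4.span_sum KR4.span_scale intro: KR4.span_base)
    qed
  qed
  moreover have "card I = (\<Sum>k<4. nat (c k + 1) * nat (d k + 1))"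
    by (simp add: I_def card_mon_index)
  ultimately show ?thesis using KR4.family_basis[where I = I and v = e, OF fin ind] by metis
qed

section \<open>The strand of the approximation complex\<close>

definition yeval :: "(4 \<Rightarrow> 'k::field) \<Rightarrow> 'k YR \<Rightarrow> 'k R" where
  "yeval y = eval_mp (\<lambda>i. const_mp (y i))"

lemma yeval_hom: "comm_ring_hom (yeval y)"
  unfolding yeval_def by (rule eval_mp_hom)

lemma monom_val_const:
  fixes y :: "'v \<Rightarrow> 'k::comm_ring_1"
  shows "monom_val (\<lambda>i. const_mp (y i) :: ('w, 'k) mpoly) m = const_mp (monom_val y m)"
proof -
  interpret comm_ring_hom "const_mp :: 'k \<Rightarrow> ('w, 'k) mpoly" by (rule hom_const_mp)
  show ?thesis unfolding monom_val_def by (simp only: hom_prod hom_power)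
qed

lemma yeval_incl: "yeval y (incl_Y q) = const_mp (eval_mp y q)"
proof -
  interpret k: comm_ring_hom "const_mp :: 'a \<Rightarrow> 'a R" by (rule hom_const_mp)
  have keys: "Poly_Mapping.keys (incl_Y q) \<subseteq> Poly_Mapping.keys q"
    by (auto simp: in_keys_iff lookup_incl_Y)
  have "yeval y (incl_Y q) = (\<Sum>m\<in>Poly_Mapping.keys q. lk (incl_Y q) m * monom_val (\<lambda>i. const_mp (y i)) m)"
    unfolding yeval_def eval_mp_subst_mp by (rule subst_mp_superset) (use keys in auto)
  also have "\<dots> = (\<Sum>m\<in>Poly_Mapping.keys q. const_mp (lk q m * monom_val y m))"
    by (simp only: lookup_incl_Y monom_val_const const_mp_mult)
  also have "\<dots> = const_mp (eval_mp y q)"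
    by (simp only: k.hom_sum eval_mp_subst_mp subst_mp_def)
  finally show ?thesis .
qed

lemma yeval_const: "yeval y (Poly_Mapping.single 0 r) = r"
  by (simp add: yeval_def eval_mp_subst_mp subst_mp_single)

lemma yeval_var: "yeval y (var_mp i) = const_mp (y i)"
  unfolding yeval_def eval_mp_subst_mp by (subst subst_mp_single) (simp_all add: monom_val_single)

lemma lookup_mult_single0: "lk (f * Poly_Mapping.single 0 r) m = lk f m * r"
  for f :: "('v, 'r::comm_ring_1) mpoly"
  by (induction f rule: mpoly_induct)
    (simp_all add: distrib_right lookup_add mult_single lookup_single when_def)

definition emb4 :: "'k::field R ^ 4 \<Rightarrow> 'k YR ^ 4" where
  "emb4 c = (\<chi> i. Poly_Mapping.single 0 (c $ i))"

definition strand4 :: "('k::field R ^ 4) set \<Rightarrow> ('k YR ^ 4) set" where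
  "strand4 M = {z. \<forall>m. (\<chi> i. lk (z $ i) m) \<in> M}"

definition strand1 :: "'k::field R set \<Rightarrow> 'k YR set" where
  "strand1 M = {h. \<forall>m. lk h m \<in> M}"

lemma sum_mult_lookup: "lk (\<Sum>v\<in>B. incl_Y (q v) * Poly_Mapping.single 0 (r v)) m = (\<Sum>v\<in>B. const_mp (lk (q v) m) * r v)"
  by (simp add: lookup_sum lookup_mult_single0 lookup_incl_Y)

lemma lookup_sum_single:
  assumes "finite X" shows "lk (\<Sum>m\<in>X. Poly_Mapping.single m (c m)) m' = (if m' \<in> X then c m' else 0)"
proof -
  have "lk (\<Sum>m\<in>X. Poly_Mapping.single m (c m)) m' = (\<Sum>m\<in>X. if m = m' then c m else 0)"
    by (simp add: lookup_sum lookup_single when_def)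
  then show ?thesis using assms by simp
qed

text \<open>
  A \<open>K\<close>-basis of \<open>M\<close> is a \<open>K[y]\<close>-basis of \<open>K[y] \<otimes> M\<close>: compare the coefficients of each monomial in
  \<open>y\<close>.
\<close>

lemma strand1_basis:
  assumes "KR.ordered_basis gs (M :: 'k::field R set)"
  shows "YZ0.ordered_basis (map (Poly_Mapping.single 0) gs) (strand1 M)"
proof -
  let ?B = "set gs"
  have b: "distinct gs" "KR.independent ?B" "KR.span ?B = M" using assms by (auto simp: KR.ordered_basis_def)
  have inj: "inj (Poly_Mapping.single 0 :: 'k R \<Rightarrow> 'k YR)" by (rule injI) (metis lookup_single_eq)
  have d: "distinct (map (Poly_Mapping.single (0 :: 4 \<Rightarrow>\<^sub>0 nat)) gs)"
    using b(1) inj by (simp add: distinct_map inj_on_def)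
  have s: "(\<Sum>x\<in>Poly_Mapping.single 0 ` ?B. incl_Y (q x) * x) = (\<Sum>v\<in>?B. incl_Y (q (Poly_Mapping.single 0 v)) * Poly_Mapping.single 0 v)" for q
    by (rule sum.reindex_cong[of "Poly_Mapping.single 0"]) (use inj in \<open>auto simp: inj_on_def\<close>)
  have ind: "YZ0.independent (Poly_Mapping.single 0 ` ?B)"
  proof (rule YZ0.independent_finite, simp, rule ballI)
    fix q and x :: "'k YR"
    assume z: "(\<Sum>x\<in>Poly_Mapping.single 0 ` ?B. incl_Y (q x) * x) = 0" and "x \<in> Poly_Mapping.single 0 ` ?B"
    then obtain v where v: "v \<in> ?B" "x = Poly_Mapping.single 0 v" by blast
    show "q x = 0"
    proof (rule poly_mapping_eqI)
      fix m
      have "(\<Sum>v\<in>?B. const_mp (lk (q (Poly_Mapping.single 0 v)) m) * v) = lk (\<Sum>x\<in>Poly_Mapping.single 0 ` ?B. incl_Y (q x) * x) m"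
        unfolding s by (rule sum_mult_lookup[symmetric])
      also have "\<dots> = 0" using z by simp
      finally show "lk (q x) m = lk 0 m"
        using KR.independentD[OF b(2) _ order_refl, of "\<lambda>v. lk (q (Poly_Mapping.single 0 v)) m" v] v by simp
    qed
  qed
  have "YZ0.span (Poly_Mapping.single 0 ` ?B) = strand1 M"
  proof (intro equalityI subsetI)
    fix h assume "h \<in> YZ0.span (Poly_Mapping.single 0 ` ?B)"
    then obtain q where q: "h = (\<Sum>x\<in>Poly_Mapping.single 0 ` ?B. incl_Y (q x) * x)"
      by (auto simp: YZ0.span_finite)
    show "h \<in> strand1 M" unfolding strand1_def
    proof (intro CollectI allI)
      fix m
      have "lk h m = (\<Sum>v\<in>?B. const_mp (lk (q (Poly_Mapping.single 0 v)) m) * v)"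
        unfolding q s by (rule sum_mult_lookup)
      also have "\<dots> \<in> KR.span ?B" by (auto intro!: KR.span_sum KR.span_scale intro: KR.span_base)
      finally show "lk h m \<in> M" using b(3) by simp
    qed
  next
    fix h assume h: "h \<in> strand1 M"
    have "\<forall>m. \<exists>\<kappa>. lk h m = (\<Sum>v\<in>?B. const_mp (\<kappa> v) * v)"
    proof
      fix m have "lk h m \<in> KR.span ?B" using h b(3) by (simp add: strand1_def)
      then show "\<exists>\<kappa>. lk h m = (\<Sum>v\<in>?B. const_mp (\<kappa> v) * v)" by (auto simp: KR.span_finite)
    qed
    from choice[OF this] obtain \<kappa> where \<kappa>: "\<forall>m. lk h m = (\<Sum>v\<in>?B. const_mp (\<kappa> m v) * v)" by blast
    define q where "q = (\<lambda>v. \<Sum>m\<in>Poly_Mapping.keys h. Poly_Mapping.single m (\<kappa> m v))"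
    have "h = (\<Sum>v\<in>?B. incl_Y (q v) * Poly_Mapping.single 0 v)"
    proof (rule poly_mapping_eqI)
      fix m
      show "lk h m = lk (\<Sum>v\<in>?B. incl_Y (q v) * Poly_Mapping.single 0 v) m"
      proof (cases "m \<in> Poly_Mapping.keys h")
        case True
        then show ?thesis unfolding sum_mult_lookup q_def by (simp add: lookup_sum_single \<kappa>)
      next
        case False
        then have "lk h m = 0" by (simp add: in_keys_iff)
        then show ?thesis using False unfolding sum_mult_lookup q_def by (simp add: lookup_sum_single)
      qed
    qed
    also have "\<dots> \<in> YZ0.span (Poly_Mapping.single 0 ` ?B)"
      by (auto intro!: YZ0.span_sum YZ0.span_scale intro: YZ0.span_base)
    finally show "h \<in> YZ0.span (Poly_Mapping.single 0 ` ?B)" .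
  qed
  then show ?thesis using d ind by (simp add: YZ0.ordered_basis_def)
qed

lemma strand4_basis:
  assumes "KR4.ordered_basis es (M :: ('k::field R ^ 4) set)"
  shows "YZ1.ordered_basis (map emb4 es) (strand4 M)"
proof -
  let ?B = "set es"
  have b: "distinct es" "KR4.independent ?B" "KR4.span ?B = M" using assms by (auto simp: KR4.ordered_basis_def)
  have inj: "inj (emb4 :: 'k R ^ 4 \<Rightarrow> _)"
    by (rule injI) (simp add: emb4_def vec_ext_iff, metis lookup_single_eq)
  have d: "distinct (map emb4 es)"
    using b(1) inj by (simp add: distinct_map inj_on_def)
  have s: "(\<Sum>x\<in>emb4 ` ?B. incl_Y (q x) *s x) = (\<Sum>v\<in>?B. incl_Y (q (emb4 v)) *s emb4 v)" for q
    by (rule sum.reindex_cong[of emb4]) (use inj in \<open>auto simp: inj_on_def\<close>)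
  have look: "(\<chi> i. lk ((\<Sum>v\<in>?B. incl_Y (q v) *s emb4 v) $ i) m) = (\<Sum>v\<in>?B. const_mp (lk (q v) m) *s v)" for q m
    by (simp add: vec_ext_iff emb4_def sum_mult_lookup)
  have ind: "YZ1.independent (emb4 ` ?B)"
  proof (rule YZ1.independent_finite, simp, rule ballI)
    fix q and x :: "'k YR ^ 4"
    assume z: "(\<Sum>x\<in>emb4 ` ?B. incl_Y (q x) *s x) = 0" and "x \<in> emb4 ` ?B"
    then obtain v where v: "v \<in> ?B" "x = emb4 v" by blast
    show "q x = 0"
    proof (rule poly_mapping_eqI)
      fix m
      have "(\<Sum>v\<in>?B. const_mp (lk (q (emb4 v)) m) *s v) = (\<chi> i. lk ((\<Sum>x\<in>emb4 ` ?B. incl_Y (q x) *s x) $ i) m)"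
        unfolding s by (rule look[symmetric])
      also have "\<dots> = 0" using z by (simp add: vec_ext_iff)
      finally show "lk (q x) m = lk 0 m"
        using KR4.independentD[OF b(2) _ order_refl, of "\<lambda>v. lk (q (emb4 v)) m" v] v by simp
    qed
  qed
  have "YZ1.span (emb4 ` ?B) = strand4 M"
  proof (intro equalityI subsetI)
    fix h assume "h \<in> YZ1.span (emb4 ` ?B)"
    then obtain q where q: "h = (\<Sum>x\<in>emb4 ` ?B. incl_Y (q x) *s x)"
      by (auto simp: YZ1.span_finite)
    show "h \<in> strand4 M" unfolding strand4_def
    proof (intro CollectI allI)
      fix m
      have "(\<chi> i. lk (h $ i) m) = (\<Sum>v\<in>?B. const_mp (lk (q (emb4 v)) m) *s v)"
        unfolding q s by (rule look)
      also have "\<dots> \<in> KR4.span ?B" by (auto intro!: KR4.span_sum KR4.span_scale intro: KR4.span_base)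
      finally show "(\<chi> i. lk (h $ i) m) \<in> M" using b(3) by simp
    qed
  next
    fix h assume h: "h \<in> strand4 M"
    have "\<forall>m. \<exists>\<kappa>. (\<chi> i. lk (h $ i) m) = (\<Sum>v\<in>?B. const_mp (\<kappa> v) *s v)"
    proof
      fix m have "(\<chi> i. lk (h $ i) m) \<in> KR4.span ?B" using h b(3) by (simp add: strand4_def)
      then show "\<exists>\<kappa>. (\<chi> i. lk (h $ i) m) = (\<Sum>v\<in>?B. const_mp (\<kappa> v) *s v)" by (auto simp: KR4.span_finite)
    qed
    from choice[OF this] obtain \<kappa> where \<kappa>: "\<forall>m. (\<chi> i. lk (h $ i) m) = (\<Sum>v\<in>?B. const_mp (\<kappa> m v) *s v)" by blast
    define X where "X = (\<Union>i. Poly_Mapping.keys (h $ i))"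
    have X: "finite X" by (simp add: X_def)
    define q where "q = (\<lambda>v. \<Sum>m\<in>X. Poly_Mapping.single m (\<kappa> m v))"
    have eqm: "(\<chi> i. lk (h $ i) m) = (\<chi> i. lk ((\<Sum>v\<in>?B. incl_Y (q v) *s emb4 v) $ i) m)" for m
    proof (cases "m \<in> X")
      case True
      then show ?thesis unfolding look q_def by (simp add: lookup_sum_single[OF X] \<kappa>)
    next
      case False
      then have "lk (h $ i) m = 0" for i by (auto simp: X_def in_keys_iff)
      then show ?thesis using False unfolding look q_def
        by (simp add: lookup_sum_single[OF X] vec_ext_iff)
    qed
    have "h = (\<Sum>v\<in>?B. incl_Y (q v) *s emb4 v)"
    proof (rule vec_ext_iff[THEN iffD2], intro allI, rule poly_mapping_eqI)
      fix i m
      show "lk (h $ i) m = lk ((\<Sum>v\<in>?B. incl_Y (q v) *s emb4 v) $ i) m"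
        using arg_cong[OF eqm[of m], of "\<lambda>w. w $ i"] by (simp only: vec_lambda_beta)
    qed
    also have "\<dots> \<in> YZ1.span (emb4 ` ?B)"
      by (auto intro!: YZ1.span_sum YZ1.span_scale intro: YZ1.span_base)
    finally show "h \<in> YZ1.span (emb4 ` ?B)" .
  qed
  then show ?thesis using d ind by (simp add: YZ1.ordered_basis_def)
qed

lemma Z0_strand_eq: "Z0_strand c d = strand1 (bihom c d)"
  by (simp add: Z0_strand_def strand1_def)

lemma Z1_strand_eq: "Z1_strand p c d = strand4 (syz p \<inter> bihom4 c d)"
  by (simp add: Z1_strand_def strand4_def)

lemma bihom4_subspace: "KR4.subspace (bihom4 c d)"
  unfolding KR4.subspace_def bihom4_def by (auto intro: bihom_add bihom_scale)

lemma syz_submodule: "RR4.subspace (syz p)"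
  unfolding RR4.subspace_def syz_def
  by (auto simp: distrib_right sum.distrib mult.assoc simp flip: sum_distrib_left)

lemma syz_subspace: "KR4.subspace (syz p)"
  using syz_submodule[of p] unfolding RR4.subspace_def KR4.subspace_def by blast

lemma syz_comp_subspace: "KR4.subspace (syz p \<inter> bihom4 c d)"
  by (rule KR4.subspace_inter[OF syz_subspace bihom4_subspace])

lemma d1_matrix_exists:
  assumes es: "KR4.ordered_basis es (syz p \<inter> bihom4 c d)" and pk: "p \<in> bihom4 c' d'"
  shows "\<exists>M\<in>carrier_mat (nat (c + 1) * nat (d + 1)) (length es). d1_matrix p c d M"
proof -
  obtain gs where gs: "KR.ordered_basis gs (bihom c d :: 'a R set)" "length gs = nat (c + 1) * nat (d + 1)"
    using bihom_basis by blast
  define es' gs' where "es' = map emb4 es" and "gs' = map (Poly_Mapping.single (0 :: 4 \<Rightarrow>\<^sub>0 nat)) gs"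
  have e: "YZ1.ordered_basis es' (Z1_strand p c d)" unfolding Z1_strand_eq es'_def by (rule strand4_basis[OF es])
  have g: "YZ0.ordered_basis gs' (Z0_strand c d)" unfolding Z0_strand_eq gs'_def by (rule strand1_basis[OF gs(1)])
  have "\<forall>j. \<exists>q. j < length es' \<longrightarrow> d1 (es' ! j) = (\<Sum>i<length gs'. incl_Y (q i) * gs' ! i)"
  proof (intro allI)
    fix j
    show "\<exists>q. j < length es' \<longrightarrow> d1 (es' ! j) = (\<Sum>i<length gs'. incl_Y (q i) * gs' ! i)"
    proof (cases "j < length es'")
      case True
      then have "es ! j \<in> KR4.span (set es)" by (auto simp: es'_def intro: KR4.span_base)
      then have c: "es ! j \<in> bihom4 c d" using es by (simp add: KR4.ordered_basis_def)
      have "d1 (es' ! j) \<in> Z0_strand c d"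
        unfolding Z0_strand_def
      proof (intro CollectI allI)
        fix m
        have "lk (Poly_Mapping.single 0 (es ! j $ i) * var_mp i) m \<in> bihom c d" for i
          using c by (simp add: mult_single lookup_single when_def bihom4_def)
        then show "lk (d1 (es' ! j)) m \<in> bihom c d"
          using True by (simp add: d1_def es'_def emb4_def lookup_sum bihom_sum)
      qed
      then show ?thesis using YZ0.ordered_basis_coords[OF g] by blast
    qed simp
  qed
  from choice[OF this] obtain q where q: "\<And>j. j < length es' \<Longrightarrow> d1 (es' ! j) = (\<Sum>i<length gs'. incl_Y (q j i) * gs' ! i)" by blast
  define M where "M = mat (length gs') (length es') (\<lambda>(i, j). q j i)"
  have "d1_matrix p c d M"
    unfolding d1_matrix_def
    by (rule exI[of _ es'], rule exI[of _ gs']) (use e g q in \<open>auto simp: M_def intro!: sum.cong\<close>)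
  moreover have "M \<in> carrier_mat (nat (c + 1) * nat (d + 1)) (length es)"
    by (simp add: M_def es'_def gs'_def gs(2))
  ultimately show ?thesis by blast
qed

section \<open>The zeros of the determinant\<close>

definition yeval4 :: "(4 \<Rightarrow> 'k::field) \<Rightarrow> 'k YR ^ 4 \<Rightarrow> 'k R ^ 4" where
  "yeval4 y z = (\<chi> i. yeval y (z $ i))"

lemma yeval4_mem:
  assumes "KR4.subspace M" "z \<in> strand4 M"
  shows "yeval4 y z \<in> M"
proof -
  define X where "X = (\<Union>i. Poly_Mapping.keys (z $ i))"
  have "yeval y (z $ i) = (\<Sum>m\<in>X. lk (z $ i) m * const_mp (monom_val y m))" for i
    unfolding yeval_def eval_mp_subst_mp monom_val_const[symmetric]
    by (rule subst_mp_superset) (auto simp: X_def)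
  then have "yeval4 y z = (\<Sum>m\<in>X. const_mp (monom_val y m) *s (\<chi> i. lk (z $ i) m))"
    by (simp add: yeval4_def vec_ext_iff mult.commute)
  also have "\<dots> \<in> M"
    using assms(2) by (intro KR4.subspace_sum[OF assms(1)] KR4.subspace_scale[OF assms(1)]) (auto simp: strand4_def)
  finally show ?thesis .
qed

lemma yeval_d1: "yeval y (d1 z) = (\<Sum>i\<in>UNIV. yeval4 y z $ i * const_mp (y i))"
proof -
  interpret comm_ring_hom "yeval y" by (rule yeval_hom)
  show ?thesis unfolding d1_def yeval4_def
    by (simp only: hom_sum hom_mult yeval_var vec_lambda_beta)
qed

lemma eval_det:
  "eval_mp y (Determinant.det M) = Determinant.det (map_mat (eval_mp y) M)"
proof -
  interpret comm_ring_hom "eval_mp y" by (rule eval_mp_hom)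
  show ?thesis by simp
qed

lemma yeval_column:
  assumes "d1 (es ! j) = (\<Sum>i<length gs. incl_Y (M $$ (i, j)) * gs ! i)"
  shows "yeval y (d1 (es ! j)) = (\<Sum>i<length gs. const_mp (eval_mp y (M $$ (i, j))) * yeval y (gs ! i))"
proof -
  interpret comm_ring_hom "yeval y" by (rule yeval_hom)
  show ?thesis unfolding assms by (simp only: hom_sum hom_mult yeval_incl)
qed

text \<open>
  Let \<open>y = r p(x)\<close>.  For a syzygy \<open>z\<close> with coefficients in \<open>K[y]\<close>, the value of \<open>d1 z\<close> at \<open>y\<close> and \<open>x\<close> is
  \<open>r\<close> times that of \<open>z\<cdot>p\<close>, so it vanishes.  Therefore the vector \<open>h\<close> of the values at \<open>x\<close> of a basis of
  the target, which is not zero, is annihilated by the transposed matrix at \<open>y\<close>.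
\<close>

lemma det_vanishes_on_image:
  fixes p :: "'k::field R ^ 4"
  assumes M: "M \<in> carrier_mat N N" "d1_matrix p c d M" and cd: "c \<ge> 0" "d \<ge> 0" and y: "y \<in> image_coords p"
  shows "eval_mp y (Determinant.det M) = 0"
proof -
  obtain x r where x: "x \<in> biproj_coords" "r \<noteq> 0" "\<And>i. y i = r * eval_mp x (p $ i)"
    using y by (auto simp: image_coords_def)
  interpret x: comm_ring_hom "eval_mp x :: 'k R \<Rightarrow> 'k" by (rule eval_mp_hom)
  have xc: "eval_mp x (const_mp r) = r" for r :: 'k by (simp add: eval_mp_subst_mp subst_mp_single)
  obtain es gs where es: "YZ1.ordered_basis es (Z1_strand p c d)" and gs: "YZ0.ordered_basis gs (Z0_strand c d)"
    and len: "M \<in> carrier_mat (length gs) (length es)"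
    and col: "\<And>j. j < length es \<Longrightarrow> d1 (es ! j) = (\<Sum>i<length gs. incl_Y (M $$ (i, j)) * gs ! i)"
    using M(2) unfolding d1_matrix_def by blast
  have N: "length gs = N" "length es = N" using len M(1) by auto
  define h where "h = vec N (\<lambda>i. eval_mp x (yeval y (gs ! i)))"
  let ?A = "map_mat (eval_mp y) M"
  have A: "?A \<in> carrier_mat N N" using M(1) by simp
  have colz: "(\<Sum>i<N. eval_mp y (M $$ (i, j)) * h $v i) = 0" if j: "j < N" for j
  proof -
    have "es ! j \<in> YZ1.span (set es)" using j N by (auto intro: YZ1.span_base)
    then have "es ! j \<in> Z1_strand p c d" using es by (simp add: YZ1.ordered_basis_def)
    then have "yeval4 y (es ! j) \<in> syz p" using yeval4_mem[OF syz_comp_subspace] unfolding Z1_strand_eq by blast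
    then have sz: "(\<Sum>i\<in>UNIV. yeval4 y (es ! j) $ i * p $ i) = 0" by (simp add: syz_def)
    have "(\<Sum>i<N. eval_mp y (M $$ (i, j)) * h $v i) = eval_mp x (yeval y (d1 (es ! j)))"
      using yeval_column[OF col, of j y] j N by (simp add: x.hom_sum x.hom_mult xc h_def)
    also have "\<dots> = (\<Sum>i\<in>UNIV. eval_mp x (yeval4 y (es ! j) $ i) * (r * eval_mp x (p $ i)))"
      by (simp only: yeval_d1 x.hom_sum x.hom_mult xc x(3))
    also have "\<dots> = r * eval_mp x (\<Sum>i\<in>UNIV. yeval4 y (es ! j) $ i * p $ i)"
      by (simp add: x.hom_sum x.hom_mult sum_distrib_left mult_ac)
    also have "\<dots> = 0" by (simp add: sz)
    finally show ?thesis .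
  qed
  have "h \<noteq> 0\<^sub>v N"
  proof
    assume "h = 0\<^sub>v N"
    then have h0: "eval_mp x (yeval y (gs ! i)) = 0" if "i < N" for i
    proof -
      have "h $v i = 0" using \<open>h = 0\<^sub>v N\<close> that by simp
      then show ?thesis using that by (simp add: h_def)
    qed
    have van: "eval_mp x f = 0" if f: "f \<in> bihom c d" for f
    proof -
      have "Poly_Mapping.single 0 f \<in> Z0_strand c d"
        using f by (simp add: Z0_strand_def lookup_single when_def)
      then obtain q where q: "Poly_Mapping.single 0 f = (\<Sum>i<length gs. incl_Y (q i) * gs ! i)"
        using YZ0.ordered_basis_coords[OF gs] by blast
      interpret yv: comm_ring_hom "yeval y" by (rule yeval_hom)
      have "f = yeval y (Poly_Mapping.single 0 f)" by (rule yeval_const[symmetric])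
      also have "\<dots> = (\<Sum>i<length gs. const_mp (eval_mp y (q i)) * yeval y (gs ! i))"
        unfolding q by (simp only: yv.hom_sum yv.hom_mult yeval_incl)
      finally have "eval_mp x f = eval_mp x (\<Sum>i<length gs. const_mp (eval_mp y (q i)) * yeval y (gs ! i))" by (rule arg_cong)
      also have "\<dots> = 0" unfolding x.hom_sum x.hom_mult using h0 N by simp
      finally show ?thesis .
    qed
    obtain w1 where w1: "w1 \<in> {Vs, Vt}" "x w1 \<noteq> 0" using x(1) by (auto simp: biproj_coords_def)
    obtain w2 where w2: "w2 \<in> {Vu, Vv}" "x w2 \<noteq> 0" using x(1) by (auto simp: biproj_coords_def)
    \<comment> \<open>A monomial of the target that does not vanish at \<open>x\<close>.\<close>
    define m where "m = Poly_Mapping.single w1 (nat c) + Poly_Mapping.single w2 (nat d)"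
    have "Poly_Mapping.single m (1 :: 'k) \<in> bihom c d"
      using w1(1) w2(1) cd by (auto simp: bihom_def m_def lookup_add lookup_single when_def)
    then have "eval_mp x (Poly_Mapping.single m 1) = 0" by (rule van)
    then show False using w1 w2
      by (simp add: eval_mp_subst_mp subst_mp_single m_def monom_val_add monom_val_single)
  qed
  moreover have "transpose_mat ?A *\<^sub>v h = 0\<^sub>v N"
  proof (rule eq_vecI)
    fix j assume "j < dim_vec (0\<^sub>v N :: 'k Matrix.vec)"
    then have j: "j < N" by simp
    have "(transpose_mat ?A *\<^sub>v h) $v j = (\<Sum>i<N. eval_mp y (M $$ (i, j)) * h $v i)"
      using j M(1) by (simp add: scalar_prod_def h_def atLeast0LessThan)
    then show "(transpose_mat ?A *\<^sub>v h) $v j = 0\<^sub>v N $v j" using colz[OF j] j by simp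
  qed (use M(1) in simp)
  moreover have "h \<in> carrier_vec N" by (simp add: h_def)
  ultimately have "Determinant.det (transpose_mat ?A) = 0"
    using det_0_iff_vec_prod_zero_field[of "transpose_mat ?A" N] A by auto
  then have "Determinant.det ?A = 0" using Determinant.det_transpose[OF A] by simp
  then show ?thesis by (simp add: eval_det)
qed

text \<open>
  A vector in the kernel of the matrix at \<open>y\<close> combines the values of the basis of the source to a syzygy
  \<open>C\<close> with \<open>C\<cdot>y = 0\<close>.  By hypothesis \<open>C\<close> is zero, so these \<open>N\<close> values are linearly dependent.  But they
  span the space of syzygies, whose dimension is \<open>N\<close>.
\<close>

lemma det_nonzero_off_image:
  fixes p :: "'k::field R ^ 4"
  assumes M: "M \<in> carrier_mat N N" "d1_matrix p c d M"
    and dim: "KR4.dim (syz p \<inter> bihom4 c d) = N"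
    and inj: "\<And>C. C \<in> syz p \<inter> bihom4 c d \<Longrightarrow> (\<Sum>i\<in>UNIV. C $ i * const_mp (y i)) = 0 \<Longrightarrow> C = 0"
  shows "eval_mp y (Determinant.det M) \<noteq> 0"
proof
  assume z: "eval_mp y (Determinant.det M) = 0"
  obtain es gs where es: "YZ1.ordered_basis es (Z1_strand p c d)" and gs: "YZ0.ordered_basis gs (Z0_strand c d)"
    and len: "M \<in> carrier_mat (length gs) (length es)"
    and col: "\<And>j. j < length es \<Longrightarrow> d1 (es ! j) = (\<Sum>i<length gs. incl_Y (M $$ (i, j)) * gs ! i)"
    using M(2) unfolding d1_matrix_def by blast
  have N: "length gs = N" "length es = N" using len M(1) by auto
  let ?A = "map_mat (eval_mp y) M" and ?Syz = "syz p \<inter> bihom4 c d"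
  have A: "?A \<in> carrier_mat N N" using M(1) by simp
  have "Determinant.det ?A = 0" using z by (simp add: eval_det)
  then obtain v where v: "v \<in> carrier_vec N" "v \<noteq> 0\<^sub>v N" "?A *\<^sub>v v = 0\<^sub>v N"
    using det_0_iff_vec_prod_zero_field[OF A] by blast
  define w where "w = (\<lambda>j. yeval4 y (es ! j))"
  have wS: "w j \<in> ?Syz" if "j < N" for j
  proof -
    have "es ! j \<in> YZ1.span (set es)" using that N by (auto intro: YZ1.span_base)
    then have "es ! j \<in> Z1_strand p c d" using es by (simp add: YZ1.ordered_basis_def)
    then show ?thesis using yeval4_mem[OF syz_comp_subspace] unfolding Z1_strand_eq w_def by blast
  qed
  define C where "C = (\<Sum>j<N. const_mp (v $v j) *s w j)"
  have "C \<in> ?Syz" unfolding C_def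
    using wS by (intro KR4.subspace_sum[OF syz_comp_subspace] KR4.subspace_scale[OF syz_comp_subspace]) auto
  moreover have "(\<Sum>i\<in>UNIV. C $ i * const_mp (y i)) = 0"
  proof -
    have "(\<Sum>i\<in>UNIV. C $ i * const_mp (y i)) = (\<Sum>i\<in>UNIV. \<Sum>j<N. const_mp (v $v j) * (w j $ i * const_mp (y i)))"
      by (simp add: C_def sum_distrib_right mult.assoc)
    also have "\<dots> = (\<Sum>j<N. const_mp (v $v j) * yeval y (d1 (es ! j)))"
      by (subst sum.swap) (simp add: yeval_d1 w_def sum_distrib_left)
    also have "\<dots> = (\<Sum>j<N. \<Sum>i<N. const_mp (eval_mp y (M $$ (i, j)) * v $v j) * yeval y (gs ! i))"
    proof (rule sum.cong[OF refl])
      fix j assume "j \<in> {..<N}"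
      then have "yeval y (d1 (es ! j)) = (\<Sum>i<N. const_mp (eval_mp y (M $$ (i, j))) * yeval y (gs ! i))"
        using yeval_column[OF col, of j y] N by simp
      then show "const_mp (v $v j) * yeval y (d1 (es ! j)) = (\<Sum>i<N. const_mp (eval_mp y (M $$ (i, j)) * v $v j) * yeval y (gs ! i))"
        by (simp only: sum_distrib_left const_mp_mult mult_ac)
    qed
    also have "\<dots> = (\<Sum>i<N. const_mp (\<Sum>j<N. eval_mp y (M $$ (i, j)) * v $v j) * yeval y (gs ! i))"
    proof -
      interpret k: comm_ring_hom "const_mp :: 'k \<Rightarrow> 'k R" by (rule hom_const_mp)
      show ?thesis by (subst sum.swap) (simp only: k.hom_sum sum_distrib_right)
    qed
    also have "\<dots> = 0"
    proof (rule sum.neutral, rule ballI)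
      fix i assume i: "i \<in> {..<N}"
      then have "(\<Sum>j<N. eval_mp y (M $$ (i, j)) * v $v j) = (?A *\<^sub>v v) $v i"
        using M(1) v(1) by (simp add: scalar_prod_def atLeast0LessThan)
      also have "\<dots> = 0" using v(3) i by simp
      finally show "const_mp (\<Sum>j<N. eval_mp y (M $$ (i, j)) * v $v j) * yeval y (gs ! i) = 0" by simp
    qed
    finally show ?thesis .
  qed
  ultimately have C0: "C = 0" by (rule inj)
  obtain j0 where j0: "j0 < N" "v $v j0 \<noteq> 0"
    using v(1,2) by (metis carrier_vecD eq_vecI index_zero_vec(1,2))
  define W where "W = w ` ({..<N} - {j0})"
  have others: "w j \<in> KR4.span W" if "j < N" for j
  proof (cases "j = j0")
    case False then show ?thesis using that by (auto simp: W_def intro: KR4.span_base)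
  next
    case True
    have "const_mp (v $v j0) *s w j0 + (\<Sum>j\<in>{..<N} - {j0}. const_mp (v $v j) *s w j) = 0"
      using C0 j0(1) sum.remove[of "{..<N}" j0 "\<lambda>j. const_mp (v $v j) *s w j"] by (simp add: C_def)
    then have "const_mp (v $v j0) *s w j0 = - (\<Sum>j\<in>{..<N} - {j0}. const_mp (v $v j) *s w j)" by (simp add: eq_neg_iff_add_eq_0)
    also have "\<dots> \<in> KR4.span W"
      by (intro KR4.span_neg KR4.span_sum KR4.span_scale KR4.span_base) (auto simp: W_def)
    finally have "const_mp (1 / v $v j0) *s (const_mp (v $v j0) *s w j0) \<in> KR4.span W" by (rule KR4.span_scale)
    then show ?thesis using True j0(2) by (simp add: vector_smult_assoc mult_single single_one)
  qed
  have "?Syz \<subseteq> KR4.span W"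
  proof
    fix c0 assume c0: "c0 \<in> ?Syz"
    have lkc: "(\<chi> i. lk (emb4 c0 $ i) m) = (if m = 0 then c0 else 0)" for m
      by (simp add: emb4_def vec_ext_iff lookup_single when_def)
    have "(\<chi> i. lk (emb4 c0 $ i) m) \<in> ?Syz" for m
      unfolding lkc using c0 KR4.subspace_0[OF syz_comp_subspace[of p c d]] by simp
    then have "emb4 c0 \<in> Z1_strand p c d" by (simp add: Z1_strand_eq strand4_def)
    then obtain q where q: "emb4 c0 = (\<Sum>j<length es. incl_Y (q j) *s es ! j)"
      using YZ1.ordered_basis_coords[OF es] by blast
    interpret yv: comm_ring_hom "yeval y" by (rule yeval_hom)
    have "c0 = yeval4 y (emb4 c0)" by (simp add: yeval4_def emb4_def yeval_const vec_ext_iff)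
    also have "\<dots> = (\<Sum>j<length es. const_mp (eval_mp y (q j)) *s w j)"
      unfolding q yeval4_def w_def
      by (simp add: vec_ext_iff yv.hom_sum yv.hom_mult yeval_incl)
    also have "\<dots> \<in> KR4.span W" using others N by (intro KR4.span_sum KR4.span_scale) auto
    finally show "c0 \<in> KR4.span W" .
  qed
  then have "KR4.dim ?Syz \<le> card W" by (rule KR4.dim_le_card) (simp add: W_def)
  also have "card W \<le> card ({..<N} - {j0})" unfolding W_def by (rule card_image_le) simp
  also have "\<dots> < N" using j0(1) by simp
  finally show False using dim by simp
qed

section \<open>The ideal of the surface and the implicit equation\<close>

text \<open>
  Restriction of a polynomial to a curve \<open>\<gamma>\<close>.
\<close>

lemma eval_mp_along:
  fixes f :: "('v, 'k::comm_ring_1) mpoly"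
  shows "eval_mp (\<lambda>i. poly (\<gamma> i) \<tau>) f = poly (subst_mp (\<lambda>c. [:c:]) \<gamma> f) \<tau>"
proof -
  have "poly (subst_mp (\<lambda>c. [:c:]) \<gamma> f) \<tau> = subst_mp (\<lambda>c. c) (\<lambda>i. poly (\<gamma> i) \<tau>) f"
  proof (rule subst_mp_unique[of "\<lambda>f. poly (subst_mp (\<lambda>c. [:c:]) \<gamma> f) \<tau>"])
    have "comm_ring_hom (\<lambda>p :: 'k poly. poly p \<tau>)" by (rule comm_ring_homI) simp_all
    from hom_comp[OF this subst_mp_hom[OF hom_const_poly[OF hom_id]]]
    show "comm_ring_hom (\<lambda>f. poly (subst_mp (\<lambda>c. [:c:]) \<gamma> f) \<tau>)" .
    show "poly (subst_mp (\<lambda>c. [:c:]) \<gamma> (const_mp c)) \<tau> = c" for c by (simp add: subst_mp_single)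
    show "poly (subst_mp (\<lambda>c. [:c:]) \<gamma> (var_mp i)) \<tau> = poly (\<gamma> i) \<tau>" for i
      by (subst subst_mp_single) (simp_all add: monom_val_single)
  qed
  then show ?thesis by (simp add: eval_mp_subst_mp)
qed

lemma eval_mp_mult: "eval_mp (x :: 'v \<Rightarrow> 'k::comm_ring_1) (f * g) = eval_mp x f * eval_mp x g"
proof -
  interpret comm_ring_hom "eval_mp x" by (rule eval_mp_hom)
  show ?thesis by (rule hom_mult)
qed

lemma image_coordsI: "x \<in> biproj_coords \<Longrightarrow> r \<noteq> 0 \<Longrightarrow> (\<lambda>i. r * eval_mp x (p $ i)) \<in> image_coords p"
  by (auto simp: image_coords_def)

text \<open>
  If \<open>A\<close> and \<open>B\<close> do not vanish at \<open>y1\<close> and \<open>y2\<close> respectively, join preimages of these points, and the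
  two scalars, by lines.  On the resulting curve through \<open>y1\<close> and \<open>y2\<close> neither \<open>A\<close> nor \<open>B\<close> is zero, so
  there is a parameter at which neither vanishes and which gives a point of the surface.
\<close>

lemma vanishing_ideal_prime:
  fixes p :: "'k::alg_closed_field R ^ 4"
  assumes AB: "A * B \<in> vanishing_ideal (image_coords p)"
  shows "A \<in> vanishing_ideal (image_coords p) \<or> B \<in> vanishing_ideal (image_coords p)"
proof (rule ccontr)
  assume "\<not> ?thesis"
  then obtain y1 y2 where y: "y1 \<in> image_coords p" "eval_mp y1 A \<noteq> 0" "y2 \<in> image_coords p" "eval_mp y2 B \<noteq> 0"
    unfolding vanishing_ideal_def by blast
  obtain x1 r1 where x1: "x1 \<in> biproj_coords" "r1 \<noteq> 0" "\<And>i. y1 i = r1 * eval_mp x1 (p $ i)"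
    using y(1) by (auto simp: image_coords_def)
  obtain x2 r2 where x2: "x2 \<in> biproj_coords" "r2 \<noteq> 0" "\<And>i. y2 i = r2 * eval_mp x2 (p $ i)"
    using y(3) by (auto simp: image_coords_def)
  define line where "line = (\<lambda>c d :: 'k. [:c, d - c:])"
  have line: "poly (line c d) 0 = c" "poly (line c d) 1 = d" for c d by (simp_all add: line_def)
  define \<xi> where "\<xi> = (\<lambda>w. line (x1 w) (x2 w))"
  define \<rho> where "\<rho> = line r1 r2"
  define \<pi> where "\<pi> = (\<lambda>i. \<rho> * subst_mp (\<lambda>c. [:c:]) \<xi> (p $ i))"
  have \<pi>: "poly (\<pi> i) \<tau> = poly \<rho> \<tau> * eval_mp (\<lambda>w. poly (\<xi> w) \<tau>) (p $ i)" for i \<tau>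
    by (simp add: \<pi>_def eval_mp_along)
  obtain w1 where w1: "w1 \<in> {Vs, Vt}" "x1 w1 \<noteq> 0" using x1(1) by (auto simp: biproj_coords_def)
  obtain w2 where w2: "w2 \<in> {Vu, Vv}" "x1 w2 \<noteq> 0" using x1(1) by (auto simp: biproj_coords_def)
  let ?A = "subst_mp (\<lambda>c. [:c:]) \<pi> A" and ?B = "subst_mp (\<lambda>c. [:c:]) \<pi> B"
  have "(\<lambda>i. poly (\<pi> i) 0) = y1" "(\<lambda>i. poly (\<pi> i) 1) = y2"
    unfolding \<pi> \<rho>_def \<xi>_def line x1(3)[symmetric] x2(3)[symmetric] by simp_all
  then have "poly ?A 0 \<noteq> 0" "poly ?B 1 \<noteq> 0" using y by (simp_all flip: eval_mp_along)
  then have nz: "?A \<noteq> 0" "?B \<noteq> 0" by auto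
  have "poly \<rho> 0 \<noteq> 0" "poly (\<xi> w1) 0 \<noteq> 0" "poly (\<xi> w2) 0 \<noteq> 0"
    using x1(2) w1 w2 by (simp_all add: \<rho>_def \<xi>_def line)
  then have "\<rho> \<noteq> 0" "\<xi> w1 \<noteq> 0" "\<xi> w2 \<noteq> 0" by auto
  then have "?A * ?B * (\<rho> * \<xi> w1 * \<xi> w2) \<noteq> 0" using nz by simp
  then obtain \<tau> where \<tau>: "poly (?A * ?B * (\<rho> * \<xi> w1 * \<xi> w2)) \<tau> \<noteq> 0" using nonroot_exists by blast
  have "(\<lambda>w. poly (\<xi> w) \<tau>) \<in> biproj_coords" using \<tau> w1(1) w2(1) by (auto simp: biproj_coords_def)
  moreover have "poly \<rho> \<tau> \<noteq> 0" using \<tau> by simp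
  ultimately have "(\<lambda>i. poly (\<pi> i) \<tau>) \<in> image_coords p" unfolding \<pi> by (rule image_coordsI)
  then have "eval_mp (\<lambda>i. poly (\<pi> i) \<tau>) (A * B) = 0" using AB by (simp add: vanishing_ideal_def)
  then have "eval_mp (\<lambda>i. poly (\<pi> i) \<tau>) A * eval_mp (\<lambda>i. poly (\<pi> i) \<tau>) B = 0"
    by (simp only: eval_mp_mult)
  then show False using \<tau> by (simp add: eval_mp_along)
qed

text \<open>
  The set is a cone without its vertex: \<open>F\<close> vanishes on a punctured line through 0.
\<close>

lemma vanishing_at_0:
  fixes p :: "'k::alg_closed_field R ^ 4"
  assumes F: "F \<in> vanishing_ideal (image_coords p)"
  shows "eval_mp (\<lambda>_. 0) F = 0"
proof -
  define x where "x = biproj_pt (1::'k) 0 1 0"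
  have x: "x \<in> biproj_coords" unfolding x_def by (rule biproj_pt_biproj) auto
  define \<gamma> where "\<gamma> = (\<lambda>i. [:0, eval_mp x (p $ i):])"
  let ?P = "subst_mp (\<lambda>c. [:c:]) \<gamma> F"
  have "poly ?P r = 0" if "r \<noteq> 0" for r
  proof -
    have "(\<lambda>i. poly (\<gamma> i) r) \<in> image_coords p" using image_coordsI[OF x that, of p] by (simp add: \<gamma>_def)
    then have "eval_mp (\<lambda>i. poly (\<gamma> i) r) F = 0" using F by (simp add: vanishing_ideal_def)
    then show ?thesis by (simp add: eval_mp_along)
  qed
  then have "poly (?P * [:0, 1:]) r = 0" for r by (cases "r = 0") auto
  then have "?P * [:0, 1:] = 0" using nonroot_exists by blast
  then have "?P = 0" by simp
  then have "eval_mp (\<lambda>i. poly (\<gamma> i) 0) F = 0" unfolding eval_mp_along by simp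
  then show ?thesis by (simp add: \<gamma>_def)
qed

lemma bihom_power: "f \<in> bihom (int a) (int b) \<Longrightarrow> f ^ k \<in> bihom (int (k * a)) (int (k * b))"
proof (induction k)
  case 0
  show ?case using bihom_const[of 1] by (simp add: single_one)
next
  case (Suc k)
  then have "f * f ^ k \<in> bihom (int a + int (k * a)) (int b + int (k * b))" by (intro bihom_mult) auto
  then show ?case by simp
qed

text \<open>
  The image of a surface is not the whole space.  There are \<open>m\<^sup>3\<close> exponents for products of degree \<open>3m\<close>
  in the \<open>p\<^sub>i\<close>, while the forms of bidegree \<open>(3ma, 3mb)\<close> have a dimension of order \<open>m\<^sup>2\<close>.  So for large
  \<open>m\<close> there is a homogeneous relation between the \<open>p\<^sub>i\<close>, and any point where it is not zero will do.
\<close>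

lemma point_off_image:
  fixes p :: "'k::alg_closed_field R ^ 4"
  assumes p: "p \<in> bihom4 (int a) (int b)"
  shows "\<exists>y. y \<notin> image_coords p \<and> y \<noteq> (\<lambda>_. 0)"
proof -
  \<comment> \<open>Large enough for \<open>(3ma + 1)(3mb + 1) < 16 m\<^sup>2 (a + 1)(b + 1) = m\<^sup>3\<close>.\<close>
  define m where "m = 16 * ((a + 1) * (b + 1))"
  have m0: "m > 0" by (simp add: m_def)
  define I where "I = {..<m} \<times> {..<m} \<times> {..<m}"
  \<comment> \<open>The fourth exponent makes all products of the same degree \<open>3m\<close>; it is positive, so the
    relation has no constant term.\<close>
  define l where "l = (\<lambda>(i, j, k). 3 * m - i - j - k)"
  define v where "v = (\<lambda>x. p $ 1 ^ fst x * p $ 2 ^ fst (snd x) * p $ 3 ^ snd (snd x) * p $ 4 ^ l x)"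
  define E where "E = (\<lambda>x. Poly_Mapping.single (1::4) (fst x) + Poly_Mapping.single 2 (fst (snd x)) + Poly_Mapping.single 3 (snd (snd x)) + Poly_Mapping.single 4 (l x))"
  have sum_l: "fst x + fst (snd x) + snd (snd x) + l x = 3 * m \<and> l x > 0" if "x \<in> I" for x
    using that by (auto simp: I_def l_def)
  have pk: "p $ k \<in> bihom (int a) (int b)" for k using p by (simp add: bihom4_def)
  have vb: "v x \<in> bihom (int (3 * m * a)) (int (3 * m * b))" if "x \<in> I" for x
  proof -
    have "v x \<in> bihom (int (fst x * a) + int (fst (snd x) * a) + int (snd (snd x) * a) + int (l x * a))
      (int (fst x * b) + int (fst (snd x) * b) + int (snd (snd x) * b) + int (l x * b))"
      unfolding v_def by (intro bihom_mult bihom_power pk)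
    moreover have "int (fst x * c) + int (fst (snd x) * c) + int (snd (snd x) * c) + int (l x * c) = int (3 * m * c)" for c
      using sum_l[OF that] by (metis (no_types, lifting) distrib_right of_nat_add)
    ultimately show ?thesis by simp
  qed
  let ?c = "int (3 * m * a)" and ?d = "int (3 * m * b)"
  have "card (mon_form ?c ?d ` mon_index ?c ?d :: 'k R set) \<le> card (mon_index ?c ?d)" by (rule card_image_le) simp
  also have "\<dots> = (3 * m * a + 1) * (3 * m * b + 1)"
  proof -
    have "nat (int c + 1) = c + 1" for c by (simp add: nat_add_distrib)
    then show ?thesis by (simp only: card_mon_index)
  qed
  also have "\<dots> < (4 * m * (a + 1)) * (4 * m * (b + 1))"
  proof (rule mult_strict_mono)
    have "3 * m * c + 1 < 4 * m * (c + 1)" for c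
    proof -
      have "3 * m * c \<le> 4 * m * c" by simp
      then show ?thesis using m0 by (simp add: distrib_left)
    qed
    then show "3 * m * a + 1 < 4 * m * (a + 1)" "3 * m * b + 1 < 4 * m * (b + 1)" by blast+
  qed (use m0 in auto)
  also have "\<dots> = m * m * (16 * ((a + 1) * (b + 1)))" by (simp add: algebra_simps)
  also have "\<dots> = card I" by (simp add: I_def m_def)
  finally have card: "card (mon_form ?c ?d ` mon_index ?c ?d :: 'k R set) < card I" .
  have fin: "finite I" by (simp add: I_def)
  have fT: "finite (mon_form ?c ?d ` mon_index ?c ?d :: 'k R set)" by simp
  have "\<And>x. x \<in> I \<Longrightarrow> v x \<in> KR.span (mon_form ?c ?d ` mon_index ?c ?d)"
    unfolding bihom_span by (rule vb)
  then have "\<exists>\<kappa>. (\<Sum>x\<in>I. const_mp (\<kappa> x) * v x) = 0 \<and> (\<exists>x\<in>I. \<kappa> x \<noteq> 0)"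
    by (rule KR.family_dependent[where v = v, OF fin fT _ card])
  then obtain \<kappa> x0 where \<kappa>: "(\<Sum>x\<in>I. const_mp (\<kappa> x) * v x) = 0" and x0: "x0 \<in> I" "\<kappa> x0 \<noteq> 0"
    by blast
  define H where "H = (\<Sum>x\<in>I. Poly_Mapping.single (E x) (\<kappa> x))"
  have E: "lk (E x) 1 = fst x" "lk (E x) 2 = fst (snd x)" "lk (E x) 3 = snd (snd x)" "lk (E x) 4 = l x" for x
    by (simp_all add: E_def lookup_add lookup_single when_def)
  have Einj: "E x = E x' \<longleftrightarrow> x = x'" for x x' using E by (metis prod_eq_iff)
  have "lk H (E x0) = (\<Sum>x\<in>I. if x = x0 then \<kappa> x else 0)"
    by (simp add: H_def lookup_sum lookup_single when_def Einj)
  also have "\<dots> = \<kappa> x0" using x0 fin by simp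
  finally have "H \<noteq> 0" using x0(2) by auto
  then obtain y where y: "eval_mp y H \<noteq> 0" using Y_nonzero_eval by blast
  have mE: "monom_val y (E x) = y 1 ^ fst x * y 2 ^ fst (snd x) * y 3 ^ snd (snd x) * y 4 ^ l x" for x and y :: "4 \<Rightarrow> 'k"
    by (simp add: E_def monom_val_add monom_val_single)
  have evH: "eval_mp y H = (\<Sum>x\<in>I. \<kappa> x * (y 1 ^ fst x * y 2 ^ fst (snd x) * y 3 ^ snd (snd x) * y 4 ^ l x))" for y
  proof -
    interpret comm_ring_hom "eval_mp y :: 'k Y \<Rightarrow> 'k" by (rule eval_mp_hom)
    show ?thesis unfolding H_def hom_sum by (simp add: eval_mp_subst_mp subst_mp_single mE)
  qed
  have "y \<noteq> (\<lambda>_. 0)"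
  proof
    assume "y = (\<lambda>_. 0)"
    have "eval_mp y H = 0" unfolding evH
    proof (intro sum.neutral ballI)
      fix x assume "x \<in> I"
      then have "(0::'k) ^ l x = 0" using sum_l by simp
      then show "\<kappa> x * (y 1 ^ fst x * y 2 ^ fst (snd x) * y 3 ^ snd (snd x) * y 4 ^ l x) = 0"
        by (simp only: \<open>y = (\<lambda>_. 0)\<close> mult_zero_right)
    qed
    then show False using y by simp
  qed
  moreover have "y \<notin> image_coords p"
  proof
    assume "y \<in> image_coords p"
    then obtain x r where x: "\<And>i. y i = r * eval_mp x (p $ i)" by (auto simp: image_coords_def)
    interpret x: comm_ring_hom "eval_mp x :: 'k R \<Rightarrow> 'k" by (rule eval_mp_hom)
    have xc: "eval_mp x (const_mp c) = c" for c :: 'k by (simp add: eval_mp_subst_mp subst_mp_single)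
    have "eval_mp y H = (\<Sum>z\<in>I. r ^ (3 * m) * (\<kappa> z * eval_mp x (v z)))"
      unfolding evH
    proof (rule sum.cong[OF refl])
      fix z assume z: "z \<in> I"
      have "r ^ (3 * m) = r ^ fst z * r ^ fst (snd z) * r ^ snd (snd z) * r ^ l z"
        using sum_l[OF z] by (metis power_add)
      then show "\<kappa> z * (y 1 ^ fst z * y 2 ^ fst (snd z) * y 3 ^ snd (snd z) * y 4 ^ l z) = r ^ (3 * m) * (\<kappa> z * eval_mp x (v z))"
        by (simp add: x v_def x.hom_mult x.hom_power power_mult_distrib mult_ac)
    qed
    also have "\<dots> = r ^ (3 * m) * eval_mp x (\<Sum>z\<in>I. const_mp (\<kappa> z) * v z)"
      by (simp add: x.hom_sum x.hom_mult xc sum_distrib_left)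
    also have "\<dots> = 0" by (simp add: \<kappa>)
    finally show False using y by simp
  qed
  ultimately show ?thesis by blast
qed

text \<open>
  Eliminating the entry \<open>C\<^sub>j\<close>, where \<open>y\<^sub>j \<noteq> 0\<close>, turns \<open>C\<close> into a syzygy of the three forms
  \<open>p\<^sub>i - (y\<^sub>i / y\<^sub>j) p\<^sub>j\<close>.  At a common zero \<open>x\<close> of these forms \<open>p(x)\<close> would be proportional to \<open>y\<close>.
\<close>

lemma contraction_injective:
  fixes p :: "'k::alg_closed_field R ^ 4"
  assumes a: "a \<ge> 1" and p: "p \<in> bihom4 (int a) (int b)" and bpf: "basepoint_free p"
    and y: "y \<notin> image_coords p" "y \<noteq> (\<lambda>_. 0)"
    and C: "C \<in> syz p \<inter> bihom4 (2 * int a - 1) (int b - 1)" and Cy: "(\<Sum>i\<in>UNIV. C $ i * const_mp (y i)) = 0"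
  shows "C = 0"
proof -
  obtain j where j: "y j \<noteq> 0" using y(2) by auto
  obtain i1 i2 i3 where i: "distinct [j, i1, i2, i3]" "(UNIV :: 4 set) = {j, i1, i2, i3}"
    using sorted_enumeration_4[of j "\<lambda>_. 0"] by blast
  have sum4: "(\<Sum>i\<in>UNIV. f i) = f j + f i1 + f i2 + f i3" for f :: "4 \<Rightarrow> 'k R"
    unfolding i(2) using i(1) by (simp add: add.assoc)
  define q where "q = (\<lambda>i. p $ i - const_mp (y i / y j) * p $ j)"
  have pk: "p $ k \<in> bihom (int a) (int b)" for k using p by (simp add: bihom4_def)
  have qb: "q i \<in> bihom (int a) (int b)" for i unfolding q_def by (intro bihom_diff bihom_scale pk)
  have Ck: "C $ k \<in> bihom (2 * int a - 1) (int b - 1)" for k using C by (simp add: bihom4_def)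
  have nz: "eval_mp x (q i1) \<noteq> 0 \<or> eval_mp x (q i2) \<noteq> 0 \<or> eval_mp x (q i3) \<noteq> 0" if x: "x \<in> biproj_coords" for x
  proof (rule ccontr)
    assume neg: "\<not> ?thesis"
    interpret x: comm_ring_hom "eval_mp x :: 'k R \<Rightarrow> 'k" by (rule eval_mp_hom)
    have xc: "eval_mp x (const_mp c) = c" for c :: 'k by (simp add: eval_mp_subst_mp subst_mp_single)
    have q: "eval_mp x (q i) = eval_mp x (p $ i) - y i / y j * eval_mp x (p $ j)" for i
      by (simp add: q_def x.hom_minus x.hom_mult xc)
    have "eval_mp x (q j) = 0" using j by (simp add: q)
    then have qz: "eval_mp x (q i) = 0" for i
    proof -
      have "i \<in> {j, i1, i2, i3}" using i(2) by blast
      then show ?thesis using neg \<open>eval_mp x (q j) = 0\<close> by auto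
    qed
    have e: "eval_mp x (p $ i) = y i / y j * eval_mp x (p $ j)" for i using qz[of i] unfolding q by simp
    have pj: "eval_mp x (p $ j) \<noteq> 0"
    proof
      assume "eval_mp x (p $ j) = 0"
      then have "eval_mp x (p $ i) = 0" for i using e[of i] by simp
      then show False using bpf x unfolding basepoint_free_def by blast
    qed
    have "y i = y j / eval_mp x (p $ j) * eval_mp x (p $ i)" for i unfolding e[of i] using pj j by simp
    moreover have "y j / eval_mp x (p $ j) \<noteq> 0" using pj j by simp
    ultimately have "y \<in> image_coords p" using x unfolding image_coords_def by blast
    then show False using y(1) by blast
  qed
  have "const_mp (1 / y j) * (\<Sum>i\<in>UNIV. C $ i * const_mp (y i)) = 0" using Cy by simp
  then have "(\<Sum>i\<in>UNIV. C $ i * const_mp (y i / y j)) = 0"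
    by (simp add: sum_distrib_left mult.left_commute[of "const_mp (1 / y j)"] mult_single)
  then have Cj: "C $ j = - (C $ i1 * const_mp (y i1 / y j) + C $ i2 * const_mp (y i2 / y j) + C $ i3 * const_mp (y i3 / y j))"
  proof -
    have "const_mp (y j / y j) = (1 :: 'k R)" using j by (simp add: single_one)
    then have "C $ j + C $ i1 * const_mp (y i1 / y j) + C $ i2 * const_mp (y i2 / y j) + C $ i3 * const_mp (y i3 / y j) = 0"
      using \<open>(\<Sum>i\<in>UNIV. C $ i * const_mp (y i / y j)) = 0\<close> unfolding sum4 by (simp only: mult_1_right)
    then show ?thesis by (simp only: eq_neg_iff_add_eq_0 add.assoc)
  qed
  have "(\<Sum>i\<in>UNIV. C $ i * p $ i) = 0" using C by (simp add: syz_def)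
  then have "C $ i1 * q i1 + C $ i2 * q i2 + C $ i3 * q i3 = 0"
    unfolding sum4 Cj q_def by (simp add: algebra_simps)
  from three_forms_no_syzygy[OF a qb qb qb nz Ck Ck Ck this]
  have z: "C $ i1 = 0" "C $ i2 = 0" "C $ i3 = 0" by auto
  then have "C $ j = 0" unfolding Cj by simp
  then have "C $ i = 0" for i using z i(2) by (metis (full_types) insertE singletonD UNIV_I)
  then show ?thesis by (simp add: vec_ext_iff)
qed

context
  fixes p :: "'k::alg_closed_field R ^ 4" and a b N :: nat and M :: "'k Y mat"
  assumes a: "a \<ge> 1" and b: "b \<ge> 1" and p: "p \<in> bihom4 (int a) (int b)" and bpf: "basepoint_free p"
    and dim: "KR4.dim (syz p \<inter> bihom4 (2 * int a - 1) (int b - 1)) = N"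
    and M: "M \<in> carrier_mat N N" "d1_matrix p (2 * int a - 1) (int b - 1) M"
begin

lemma det_zero_on: "y \<in> image_coords p \<Longrightarrow> eval_mp y (Determinant.det M) = 0"
  using a b by (intro det_vanishes_on_image[OF M]) auto

lemma det_zeros_only: "eval_mp y (Determinant.det M) = 0 \<Longrightarrow> y \<in> image_coords p \<or> y = (\<lambda>_. 0)"
proof (rule ccontr)
  assume z: "eval_mp y (Determinant.det M) = 0" and "\<not> (y \<in> image_coords p \<or> y = (\<lambda>_. 0))"
  then have y: "y \<notin> image_coords p" "y \<noteq> (\<lambda>_. 0)" by blast+
  have "eval_mp y (Determinant.det M) \<noteq> 0"
    by (rule det_nonzero_off_image[OF M dim]) (rule contraction_injective[OF a p bpf y])
  then show False using z by simp
qed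

lemma det_M_nonzero: "Determinant.det M \<noteq> 0"
proof
  assume z: "Determinant.det M = 0"
  obtain y where y: "y \<notin> image_coords p" "y \<noteq> (\<lambda>_. 0)" using point_off_image[OF p] by blast
  have "eval_mp y (Determinant.det M) = 0" unfolding z by (simp add: eval_mp_def)
  then show False using det_zeros_only y by blast
qed

lemma det_M_vanishing: "Determinant.det M \<in> vanishing_ideal (image_coords p)"
  using det_zero_on by (simp add: vanishing_ideal_def)

lemma unit_not_vanishing: "u dvd 1 \<Longrightarrow> u \<notin> vanishing_ideal (image_coords p)"
proof
  assume "u dvd 1" "u \<in> vanishing_ideal (image_coords p)"
  then obtain r where r: "r \<noteq> 0" "u = const_mp r" using Y_unit_const by blast
  have "eval_mp (\<lambda>_. 0) u = 0" using vanishing_at_0 \<open>u \<in> _\<close> by blast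
  then show False using r by (simp add: eval_mp_subst_mp subst_mp_single)
qed

text \<open>
  The zeros of a factor of the determinant are zeros of the determinant, so they lie on the surface or
  at the vertex of its cone.
\<close>

lemma factor_divides_vanishing:
  assumes P: "Factorial_Ring.irreducible P" "P dvd Determinant.det M" and H: "H \<in> vanishing_ideal (image_coords p)"
  shows "P dvd H"
proof (rule Y_hypersurface_nullstellensatz[OF P(1)])
  fix y assume y: "eval_mp y P = 0"
  obtain Q where "Determinant.det M = P * Q" using P(2) unfolding dvd_def by blast
  then have "eval_mp y (Determinant.det M) = 0" using y by (simp add: eval_mp_mult)
  then have "y \<in> image_coords p \<or> y = (\<lambda>_. 0)" by (rule det_zeros_only)
  then show "eval_mp y H = 0" using H vanishing_at_0[OF H] by (auto simp: vanishing_ideal_def)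
qed

lemma implicit_equation_exists: "\<exists>F. implicit_equation p F"
proof -
  obtain F where F: "Factorial_Ring.irreducible F" "F dvd Determinant.det M" "F \<in> vanishing_ideal (image_coords p)"
    using Y_prime_factor[of "Determinant.det M" "\<lambda>f. f \<in> vanishing_ideal (image_coords p)",
        OF det_M_nonzero det_M_vanishing vanishing_ideal_prime unit_not_vanishing] by blast
  have "vanishing_ideal (image_coords p) = {G. F dvd G}"
  proof (intro equalityI subsetI CollectI)
    fix G assume "G \<in> vanishing_ideal (image_coords p)"
    then show "F dvd G" by (rule factor_divides_vanishing[OF F(1,2)])
  next
    fix G assume "G \<in> {G. F dvd G}"
    then obtain Q where "G = F * Q" unfolding dvd_def by blast
    then show "G \<in> vanishing_ideal (image_coords p)" using F(3) by (simp add: vanishing_ideal_def eval_mp_mult)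
  qed
  then show ?thesis using F(1) by (auto simp: implicit_equation_def)
qed

lemma det_power_of_implicit_equation:
  assumes F: "implicit_equation p F"
  shows "\<exists>r k. r \<noteq> 0 \<and> k > 0 \<and> Determinant.det M = const_mp r * F ^ k"
proof (rule Y_power_of_irreducible[OF det_M_nonzero])
  show irr: "Factorial_Ring.irreducible F" using F by (simp add: implicit_equation_def)
  show "\<not> Determinant.det M dvd 1" using det_M_vanishing unit_not_vanishing by blast
  have FV: "F \<in> vanishing_ideal (image_coords p)" using F by (simp add: implicit_equation_def)
  fix P assume P: "Factorial_Ring.irreducible P" "P dvd Determinant.det M"
  have "P dvd F" by (rule factor_divides_vanishing[OF P FV])
  then obtain u where u: "F = P * u" unfolding dvd_def by blast
  have "\<not> P dvd 1" using P(1) by (simp add: Factorial_Ring.irreducible_def)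
  then have "u dvd 1" using irr u unfolding Factorial_Ring.irreducible_def by blast
  then obtain w where w: "1 = u * w" unfolding dvd_def by blast
  have "P = F * w" by (metis u w mult.assoc mult.right_neutral)
  then show "F dvd P" by simp
qed

end

section \<open>The associated subspace\<close>

lemma nonzero_orthogonal:
  fixes Z :: "('k::field ^ 4) set"
  assumes "finite Z" "card Z \<le> 3"
  shows "\<exists>w. w \<noteq> 0 \<and> (\<forall>z\<in>Z. dot z w = 0)"
proof -
  have "card {1, 2, 3 :: 4} = 3" by simp
  then obtain f where f: "f ` Z \<subseteq> {1, 2, 3 :: 4}" "inj_on f Z"
    using card_le_inj[of Z "{1, 2, 3 :: 4}"] assms by (metis finite.emptyI finite_insert)
  define A where "A = (\<chi> i. if i \<in> f ` Z then inv_into Z f i else 0)"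
  have "\<exists>w. w \<noteq> 0 \<and> A *v w = 0"
  proof (rule ccontr)
    assume "\<nexists>w. w \<noteq> 0 \<and> A *v w = 0"
    then have "\<exists>B. B ** A = Finite_Cartesian_Product.mat 1" unfolding matrix_left_invertible_ker by blast
    then obtain B where B: "B ** A = Finite_Cartesian_Product.mat 1" by blast
    then have "A ** B = Finite_Cartesian_Product.mat 1" by (simp add: matrix_left_right_inverse)
    then have "(A ** B) $ 4 $ 4 = (1::'k)" by (simp add: Finite_Cartesian_Product.mat_def)
    moreover have "(4::4) \<notin> f ` Z" using f(1) by auto
    then have "A $ 4 = 0" by (simp add: A_def)
    ultimately show False by (simp add: matrix_matrix_mult_def)
  qed
  then obtain w where w: "w \<noteq> 0" "A *v w = 0" by blast
  have "dot z w = 0" if "z \<in> Z" for z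
  proof -
    have "A $ f z = z" using that f(2) by (simp add: A_def)
    then have "dot z w = (A *v w) $ f z" by (simp add: matrix_vector_mult_def dot_def)
    then show ?thesis using w(2) by simp
  qed
  then show ?thesis using w(1) by blast
qed

lemma basis_combination_unique:
  fixes p :: "'k::field R ^ 4"
  assumes "KR.ordered_basis [p $ 0, p $ 1, p $ 2, p $ 3] U"
    and "(\<Sum>i\<in>UNIV. const_mp (c i) * p $ i) = 0"
  shows "c i = 0"
proof -
  have b: "distinct [p $ 0, p $ 1, p $ 2, p $ 3]" "KR.independent {p $ 0, p $ 1, p $ 2, p $ 3}"
    using assms(1) by (simp_all add: KR.ordered_basis_def)
  have U: "(UNIV :: 4 set) = {0, 1, 2, 3}" unfolding UNIV_4 by auto
  have im: "(\<lambda>i. p $ i) ` UNIV = {p $ 0, p $ 1, p $ 2, p $ 3}" unfolding U by simp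
  have inj: "inj (\<lambda>i. p $ i)"
  proof (rule eq_card_imp_inj_on)
    show "card ((\<lambda>i. p $ i) ` UNIV) = card (UNIV :: 4 set)" unfolding im using b(1) by simp
  qed simp
  have "(\<Sum>v\<in>(\<lambda>i. p $ i) ` UNIV. const_mp (c (inv_into UNIV (\<lambda>i. p $ i) v)) * v) = (\<Sum>i\<in>UNIV. const_mp (c i) * p $ i)"
    by (subst sum.reindex[OF inj]) (simp add: inv_f_f[OF inj])
  then have "c (inv_into UNIV (\<lambda>i. p $ i) (p $ i)) = 0"
    using KR.independentD[OF b(2)[folded im], of "(\<lambda>i. p $ i) ` UNIV" "\<lambda>v. c (inv_into UNIV (\<lambda>i. p $ i) v)" "p $ i"] assms(2) by simp
  then show ?thesis by (simp add: inv_f_f[OF inj])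
qed

text \<open>
  The coordinates of \<open>assoc_form p n S j\<close> with respect to \<open>p\<close>.
\<close>

definition coef_vector :: "nat \<Rightarrow> 'k::field R ^ 4 \<Rightarrow> nat \<Rightarrow> 'k ^ 4" where
  "coef_vector n S j = (\<chi> i. lk (S $ i) (Poly_Mapping.single Vu (n - j) + Poly_Mapping.single Vv j))"

text \<open>
  As \<open>p\<close> is a basis, the coefficient vectors of \<open>S\<close> span a space of the same dimension as \<open>V\<close>.
  Together with the vectors of \<open>Z\<close> there are at most three linear conditions on \<open>w\<close>.
\<close>

lemma assoc_subspace_annihilator:
  fixes p S :: "'k::field R ^ 4"
  assumes basis: "KR.ordered_basis [p $ 0, p $ 1, p $ 2, p $ 3] U"
    and Z: "finite Z" "KR.dim (assoc_subspace p n S) + card Z \<le> 3"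
  shows "\<exists>w. w \<noteq> 0 \<and> (\<forall>z\<in>Z. dot z w = 0) \<and> (\<forall>j\<le>n. dot (coef_vector n S j) w = 0)"
proof -
  let ?V = "assoc_subspace p n S"
  obtain B where B: "B \<subseteq> ?V" "KR.independent B" "?V \<subseteq> KR.span B" "card B = KR.dim ?V"
    using KR.basis_exists[of ?V] by blast
  have finB: "finite B"
    using KR.independent_span_bound[of "assoc_form p n S ` {0..n}" B] B(1,2) by (simp add: assoc_subspace_def)
  have aform: "assoc_form p n S j = (\<Sum>i\<in>UNIV. const_mp (coef_vector n S j $ i) * p $ i)" for j
    by (simp add: assoc_form_def coef_vector_def)
  define W where "W = range (\<lambda>c :: 4 \<Rightarrow> 'k. \<Sum>i\<in>UNIV. const_mp (c i) * p $ i)"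
  have Wsub: "KR.subspace W"
    unfolding KR.subspace_def
  proof (intro conjI ballI allI)
    show "0 \<in> W" unfolding W_def by (rule image_eqI[of _ _ "\<lambda>_. 0"]) simp_all
    fix x y r assume "x \<in> W"
    then obtain c where c: "x = (\<Sum>i\<in>UNIV. const_mp (c i) * p $ i)" by (auto simp: W_def)
    have "const_mp r * x = (\<Sum>i\<in>UNIV. const_mp (r * c i) * p $ i)"
      unfolding c by (simp only: sum_distrib_left const_mp_mult mult.assoc)
    then show "const_mp r * x \<in> W" unfolding W_def by (rule image_eqI[of _ _ "\<lambda>i. r * c i"]) simp
    assume "y \<in> W"
    then obtain d where d: "y = (\<Sum>i\<in>UNIV. const_mp (d i) * p $ i)" by (auto simp: W_def)
    have "x + y = (\<Sum>i\<in>UNIV. const_mp (c i + d i) * p $ i)"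
      unfolding c d by (simp add: single_add distrib_right sum.distrib)
    then show "x + y \<in> W" unfolding W_def by (rule image_eqI[of _ _ "\<lambda>i. c i + d i"]) simp
  qed
  have "assoc_form p n S ` {0..n} \<subseteq> W" unfolding aform W_def by blast
  then have "?V \<subseteq> W" unfolding assoc_subspace_def by (rule KR.span_minimal[OF _ Wsub])
  then have "\<forall>v. \<exists>c :: 4 \<Rightarrow> 'k. v \<in> B \<longrightarrow> v = (\<Sum>i\<in>UNIV. const_mp (c i) * p $ i)" using B(1) by (auto simp: W_def)
  from choice[OF this] obtain \<beta> where \<beta>: "\<And>v. v \<in> B \<Longrightarrow> v = (\<Sum>i\<in>UNIV. const_mp (\<beta> v i) * p $ i)" by blast
  define b where "b = (\<lambda>v. (\<chi> i. \<beta> v i) :: 'k ^ 4)"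
  have "card (b ` B \<union> Z) \<le> 3"
    using card_Un_le[of "b ` B" Z] card_image_le[OF finB, of b] Z(2) B(4) by linarith
  then obtain w where w: "w \<noteq> 0" "\<And>z. z \<in> b ` B \<union> Z \<Longrightarrow> dot z w = 0"
    using nonzero_orthogonal[of "b ` B \<union> Z"] finB Z(1) by blast
  have "dot (coef_vector n S j) w = 0" if "j \<le> n" for j
  proof -
    have "assoc_form p n S j \<in> ?V"
      unfolding assoc_subspace_def by (rule KR.span_base) (use that in auto)
    then have "assoc_form p n S j \<in> KR.span B" using B(3) by blast
    then obtain \<kappa> where \<kappa>: "assoc_form p n S j = (\<Sum>v\<in>B. const_mp (\<kappa> v) * v)" by (auto simp: KR.span_finite[OF finB])
    interpret k: comm_ring_hom "const_mp :: 'k \<Rightarrow> 'k R" by (rule hom_const_mp)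
    have "(\<Sum>v\<in>B. const_mp (\<kappa> v) * v) = (\<Sum>v\<in>B. const_mp (\<kappa> v) * (\<Sum>i\<in>UNIV. const_mp (\<beta> v i) * p $ i))"
      by (rule sum.cong[OF refl]) (simp flip: \<beta>)
    also have "\<dots> = (\<Sum>i\<in>UNIV. const_mp (\<Sum>v\<in>B. \<kappa> v * \<beta> v i) * p $ i)"
      unfolding k.hom_sum sum_distrib_left sum_distrib_right
      by (subst sum.swap) (simp only: const_mp_mult mult.assoc)
    finally have "(\<Sum>i\<in>UNIV. const_mp (coef_vector n S j $ i) * p $ i) = (\<Sum>i\<in>UNIV. const_mp (\<Sum>v\<in>B. \<kappa> v * \<beta> v i) * p $ i)"
      unfolding aform[symmetric] \<kappa> .
    then have "(\<Sum>i\<in>UNIV. const_mp (coef_vector n S j $ i - (\<Sum>v\<in>B. \<kappa> v * \<beta> v i)) * p $ i) = 0"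
      by (simp only: single_diff left_diff_distrib sum_subtractf) simp
    from basis_combination_unique[OF basis this] have e: "coef_vector n S j $ i = (\<Sum>v\<in>B. \<kappa> v * b v $ i)" for i
      by (simp add: b_def)
    have "dot (coef_vector n S j) w = (\<Sum>i\<in>UNIV. \<Sum>v\<in>B. \<kappa> v * (b v $ i * w $ i))"
      by (simp add: dot_def e sum_distrib_right mult.assoc)
    also have "\<dots> = (\<Sum>v\<in>B. \<kappa> v * dot (b v) w)"
      by (subst sum.swap) (simp add: dot_def sum_distrib_left)
    also have "\<dots> = 0" using w(2) by simp
    finally show ?thesis .
  qed
  then show ?thesis using w by blast
qed

section \<open>The syzygies in the critical bidegree\<close>

lemma sum_lessThan_4: "(\<Sum>k<(4::nat). f k) = f 0 + f 1 + f 2 + (f 3 :: 'a::comm_monoid_add)"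
  by (simp add: eval_nat_numeral lessThan_Suc add_ac)

lemma less_4_cases: "k < (4::nat) \<Longrightarrow> k = 0 \<or> k = 1 \<or> k = 2 \<or> k = 3" by linarith

text \<open>
  The bidegree of the coefficient of the \<open>k\<close>th generator in a syzygy of bidegree \<open>(2a - 1, b - 1)\<close>, where
  \<open>k = 0\<close> stands for \<open>S\<close>.
\<close>

definition cofactor_deg1 :: "int \<Rightarrow> nat \<Rightarrow> int" where
  "cofactor_deg1 a k = (if k = 0 then 2 * a - 1 else a - 1)"

definition cofactor_deg2 :: "int \<Rightarrow> int \<Rightarrow> (nat \<Rightarrow> int) \<Rightarrow> nat \<Rightarrow> int" where
  "cofactor_deg2 b n m k = (if k = 0 then b - 1 - n else n - m k - 1)"

lemma dehom_sum_mult: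
  "dehom (\<Sum>k\<in>UNIV. x $ k * p $ k) = (\<Sum>k\<in>UNIV. dehom (x $ k) * dehom (p $ (k :: 4)))"
  by (simp add: dehom.hom_sum dehom.hom_mult)

lemma syz_iff_dehom:
  assumes "x \<in> bihom4 c d" "p \<in> bihom4 c' d'"
  shows "x \<in> syz p \<longleftrightarrow> (\<Sum>k\<in>UNIV. dehom (x $ k) * dehom (p $ k)) = 0"
proof
  have "(\<Sum>k\<in>UNIV. x $ k * p $ k) \<in> bihom (c + c') (d + d')"
    using assms by (intro bihom_sum bihom_mult) (auto simp: bihom4_def)
  moreover assume "(\<Sum>k\<in>UNIV. dehom (x $ k) * dehom (p $ k)) = 0"
  then have "dehom (\<Sum>k\<in>UNIV. x $ k * p $ k) = 0" by (simp only: dehom_sum_mult)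
  ultimately show "x \<in> syz p" unfolding syz_def using dehom_inj by blast
next
  assume "x \<in> syz p"
  then have "dehom (\<Sum>k\<in>UNIV. x $ k * p $ k) = 0" by (simp add: syz_def)
  then show "(\<Sum>k\<in>UNIV. dehom (x $ k) * dehom (p $ k)) = 0" by (simp only: dehom_sum_mult)
qed

text \<open>
  The syzygies of bidegree \<open>(2a - 1, b - 1)\<close> are the direct sum of four bigraded components of \<open>R\<close>,
  multiplied by \<open>T 0, \<dots>, T 3\<close>.
\<close>

definition strand_generators ::
  "'k::field R ^ 4 \<Rightarrow> int \<Rightarrow> int \<Rightarrow> int \<Rightarrow> (nat \<Rightarrow> 'k R ^ 4) \<Rightarrow> (nat \<Rightarrow> nat) \<Rightarrow> bool" where
  "strand_generators p a b n T m \<longleftrightarrow>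
     (\<forall>k\<in>{1, 2, 3}. T k \<in> syz p \<inter> bihom4 a (b - n + int (m k))) \<and>
     (\<forall>C\<in>syz p \<inter> bihom4 (2 * a - 1) (b - 1). \<exists>f.
        (\<forall>k<4. f k \<in> bihom (cofactor_deg1 a k) (cofactor_deg2 b n (\<lambda>k. int (m k)) k)) \<and> C = (\<Sum>k<4. f k *s T k)) \<and>
     (\<forall>f. (\<forall>k<4. f k \<in> bihom (cofactor_deg1 a k) (cofactor_deg2 b n (\<lambda>k. int (m k)) k)) \<longrightarrow>
        (\<Sum>k<4. f k *s T k) = 0 \<longrightarrow> (\<forall>k<4. f k = 0))"

text \<open>
  The lifts of the Koszul syzygies, homogenized.  Minimality of \<open>n\<close> excludes common zeros of the entries
  of \<open>S\<close>, since the corresponding linear factor could be cancelled.  A constant vector orthogonal to \<open>S\<close>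
  is a combination of those \<open>Q\<^sub>i\<close> that have degree 0, so the number of zeros among the \<open>m\<^sub>i\<close> is at least the
  dimension of the space of these vectors.
\<close>

lemma syzygy_structure:
  fixes p S :: "'k::alg_closed_field R ^ 4" and a b n :: nat
  assumes a: "a \<ge> 1" and p: "p \<in> bihom4 (int a) (int b)" and bpf: "basepoint_free p"
    and basis: "KR.ordered_basis [p $ 0, p $ 1, p $ 2, p $ 3] U"
    and S: "S \<in> syz p \<inter> bihom4 0 (int n)" "S \<noteq> 0"
    and min: "\<forall>m<n. \<not> (\<exists>T \<in> syz p \<inter> bihom4 0 (int m). T \<noteq> 0)" and bn: "2 * int n - 1 \<le> int b"
  shows "\<exists>T m. T 0 = S \<and> m 1 + m 2 + m 3 = n \<and> (KR.dim (assoc_subspace p n S) \<le> 3 \<longrightarrow> m 1 = 0) \<and>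
    (KR.dim (assoc_subspace p n S) \<le> 2 \<longrightarrow> m 1 = 0 \<and> m 2 = 0) \<and> strand_generators p (int a) (int b) (int n) T m"
proof -
  have pk: "p $ k \<in> bihom (int a) (int b)" for k using p by (simp add: bihom4_def)
  have Sk: "S $ k \<in> bihom 0 (int n)" for k using S(1) by (simp add: bihom4_def)
  define P where "P = (\<chi> k. dehom (p $ k))"
  define Sx where "Sx = (\<chi> k. coeff (dehom (S $ k)) 0)"
  have bS: "bideg_le (int 0) (int n) (dehom (S $ k))" for k using bideg_le_dehom[OF Sk] by simp
  have Sx: "dehom (S $ k) = [:Sx $ k:]" and degS: "degree (Sx $ k) \<le> n" for k
  proof -
    have "degree (dehom (S $ k)) = 0" "deg_le (int n) (coeff (dehom (S $ k)) 0)"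
      using bS[of k] unfolding bideg_le_iff_deg_le by auto
    then show "dehom (S $ k) = [:Sx $ k:]" "degree (Sx $ k) \<le> n"
      by (auto simp: Sx_def deg_le_iff_degree elim: degree_eq_zeroE)
  qed
  have bP: "vbideg_le (int a) (int b) P" unfolding vbideg_le_def P_def using bideg_le_dehom[OF pk] by simp
  have fib: "no_common_zero4 a (\<lambda>k. fibre x (P $ k))" and inf: "no_common_zero4 a (\<lambda>k. fibre_inf (int b) (P $ k))" for x
    using no_common_zero4_of_basepoint_free[OF p bpf] by (simp_all add: P_def)
  have "(\<Sum>k\<in>UNIV. dehom (S $ k) * dehom (p $ k)) = 0"
    using syz_iff_dehom[of S 0 "int n" p "int a" "int b"] S(1) p by auto
  then have SP: "(\<Sum>k\<in>UNIV. [:Sx $ k:] * P $ k) = 0" by (simp only: Sx P_def vec_lambda_beta)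
  then have PS: "pdot P Sx = 0" unfolding pdot_def by (simp only: mult.commute)
  have Sx0: "Sx \<noteq> 0"
  proof
    assume "Sx = 0"
    then have "dehom (S $ k) = 0" for k by (simp add: Sx)
    then have "S $ k = 0" for k using dehom_inj[OF Sk] by blast
    then show False using S(2) by (simp add: vec_ext_iff)
  qed
  \<comment> \<open>A common factor of the entries of \<open>S\<close>, or a degree less than \<open>n\<close>, gives a nonzero syzygy of
    bidegree \<open>(0, n - 1)\<close>.\<close>
  have smaller: False if U: "\<And>k. Sx $ k = D * W $ k" "D \<noteq> 0" "vdeg_le (int n - 1) W" for D and W :: "'k poly ^ 4"
  proof -
    have W0: "W \<noteq> 0" using U(1) Sx0 by (auto simp: vec_ext_iff)
    have n0: "n > 0"
    proof (rule ccontr)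
      assume "\<not> n > 0"
      then have "W $ k = 0" for k using U(3) deg_le_neg[of "int n - 1" "W $ k"] by (simp add: vdeg_le_def)
      then show False using W0 by (simp add: vec_ext_iff)
    qed
    have "vbideg_le 0 (int n - 1) (\<chi> k. [:W $ k:])"
      using U(3) by (auto simp: vbideg_le_def vdeg_le_def intro: bideg_le_const)
    then obtain T where T: "T \<in> bihom4 0 (int n - 1)" "\<And>k. dehom (T $ k) = [:W $ k:]"
      using homogenize_vec[of 0 "int n - 1"] by fastforce
    have "[:D:] * (\<Sum>k\<in>UNIV. [:W $ k:] * P $ k) = (\<Sum>k\<in>UNIV. [:Sx $ k:] * P $ k)"
      unfolding sum_distrib_left mult.assoc[symmetric] by (intro sum.cong refl arg_cong2[of _ _ _ _ "(*)"]) (simp add: U(1))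
    then have "[:D:] = 0 \<or> (\<Sum>k\<in>UNIV. [:W $ k:] * P $ k) = 0" by (simp only: SP mult_eq_0_iff)
    moreover have "[:D:] \<noteq> 0" using U(2) by simp
    ultimately have "(\<Sum>k\<in>UNIV. [:W $ k:] * P $ k) = 0" by blast
    then have "(\<Sum>k\<in>UNIV. dehom (T $ k) * dehom (p $ k)) = 0" by (simp only: T(2) P_def vec_lambda_beta)
    then have "T \<in> syz p" using syz_iff_dehom[OF T(1) p] by blast
    moreover have "T \<noteq> 0"
    proof
      assume "T = 0"
      then have "[:W $ k:] = 0" for k using T(2)[of k] by simp
      then show False using W0 by (simp add: vec_ext_iff)
    qed
    moreover have "T \<in> bihom4 0 (int (n - 1))" using T(1) n0 by (simp add: of_nat_diff)
    moreover have "n - 1 < n" using n0 by simp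
    ultimately show False using min by blast
  qed
  have noroot: "\<exists>k. poly (Sx $ k) z \<noteq> 0" for z
  proof (rule ccontr)
    assume "\<nexists>k. poly (Sx $ k) z \<noteq> 0"
    then have "\<forall>k. \<exists>q. Sx $ k = [:-z, 1:] * q" by (simp add: poly_eq_0_iff_dvd dvd_def)
    from choice[OF this] obtain q where q: "\<And>k. Sx $ k = [:-z, 1:] * q k" by blast
    have "deg_le (int n - 1) (q k)" for k
    proof (cases "q k = 0")
      case False
      then have "degree (Sx $ k) = 1 + degree (q k)" unfolding q by (subst degree_mult_eq) auto
      then have "int (degree (q k)) \<le> int n - 1" using degS[of k] by simp
      then show ?thesis using deg_le_iff_degree deg_le_mono by blast
    qed simp
    then show False using smaller[of "[:-z, 1:]" "\<chi> k. q k"] q by (simp add: vdeg_le_def)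
  qed
  have topS: "\<exists>k. coeff (Sx $ k) n \<noteq> 0"
  proof (rule ccontr)
    assume *: "\<nexists>k. coeff (Sx $ k) n \<noteq> 0"
    have "deg_le (int n - 1) (Sx $ k)" for k
      by (rule deg_le_step) (use degS[of k] * in \<open>auto simp: deg_le_iff_degree\<close>)
    then show False using smaller[of 1 Sx] by (simp add: vdeg_le_def)
  qed
  obtain Q1 Q2 Q3 m1 m2 m3 where mb: "minimal_basis_of Sx n Q1 Q2 Q3 m1 m2 m3"
    using minimal_basis_exists[OF degS noroot topS] by blast
  have ms: "m1 \<le> m2" "m2 \<le> m3" "m1 + m2 + m3 = n" using mb by (auto simp: minimal_basis_of_def)
  have const: "\<exists>c1 c2 c3. (\<chi> k. [:w $ k:]) = c1 *s Q1 + c2 *s Q2 + c3 *s Q3 \<and>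
      deg_le (0 - int m1) c1 \<and> deg_le (0 - int m2) c2 \<and> deg_le (0 - int m3) c3"
    if w: "\<And>j. j \<le> n \<Longrightarrow> dot (coef_vector n S j) w = 0" for w
  proof (rule mb_gens[OF mb])
    have cS: "coeff (Sx $ i) j = coef_vector n S j $ i" if "j \<le> n" for i j
    proof -
      have "coeff (Sx $ i) j = lk (S $ i) (bmon 0 n 0 j)"
        using coeff_dehom[of "S $ i" 0 n 0 j] Sk[of i] that by (simp add: Sx_def)
      also have "bmon 0 n 0 j = Poly_Mapping.single Vu (n - j) + Poly_Mapping.single Vv j" by (simp add: bmon_def)
      finally show ?thesis by (simp add: coef_vector_def)
    qed
    show "dot Sx (\<chi> k. [:w $ k:]) = 0"
    proof (rule poly_eqI)
      fix j
      have "coeff (dot Sx (\<chi> k. [:w $ k:])) j = (\<Sum>k\<in>UNIV. coeff (Sx $ k) j * w $ k)"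
        by (simp add: dot_def coeff_sum mult.commute)
      also have "\<dots> = 0"
      proof (cases "j \<le> n")
        case True
        then have "(\<Sum>k\<in>UNIV. coeff (Sx $ k) j * w $ k) = dot (coef_vector n S j) w" by (simp add: dot_def cS)
        then show ?thesis using w True by simp
      next
        case False
        then have "coeff (Sx $ k) j = 0" for k using degS[of k] by (intro coeff_eq_0) simp
        then show ?thesis by simp
      qed
      finally show "coeff (dot Sx (\<chi> k. [:w $ k:])) j = coeff 0 j" by simp
    qed
    have "deg_le (int 0) [:w $ k:]" for k unfolding deg_le_iff_degree by simp
    then show "vdeg_le 0 (\<chi> k. [:w $ k:])" by (simp add: vdeg_le_def)
  qed
  have m1: "m1 = 0" if d3: "KR.dim (assoc_subspace p n S) \<le> 3"
  proof (rule ccontr)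
    assume "m1 \<noteq> 0"
    obtain w where w: "w \<noteq> 0" "\<And>j. j \<le> n \<Longrightarrow> dot (coef_vector n S j) w = 0"
      using assoc_subspace_annihilator[OF basis, of "{}" n S] d3 by auto
    obtain c1 c2 c3 where "(\<chi> k. [:w $ k:]) = c1 *s Q1 + c2 *s Q2 + c3 *s Q3"
      "deg_le (0 - int m1) c1" "deg_le (0 - int m2) c2" "deg_le (0 - int m3) c3" using const[OF w(2)] by blast
    moreover then have "c1 = 0" "c2 = 0" "c3 = 0" using \<open>m1 \<noteq> 0\<close> ms by (auto intro: deg_le_neg)
    ultimately have "[:w $ k:] = 0" for k by (metis (no_types, lifting) add_0 vec_lambda_beta vector_smult_lzero zero_index)
    then show False using w(1) by (simp add: vec_ext_iff)
  qed
  have m2: "m2 = 0" if d2: "KR.dim (assoc_subspace p n S) \<le> 2"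
  proof (rule ccontr)
    assume m2: "m2 \<noteq> 0"
    have m10: "m1 = 0" using m1 d2 by simp
    have repr: "\<exists>c. (\<forall>k. [:w $ k:] = c * Q1 $ k) \<and> degree c = 0" if w: "\<And>j. j \<le> n \<Longrightarrow> dot (coef_vector n S j) w = 0" for w
    proof -
      obtain c1 c2 c3 where c: "(\<chi> k. [:w $ k:]) = c1 *s Q1 + c2 *s Q2 + c3 *s Q3"
        "deg_le (0 - int m1) c1" "deg_le (0 - int m2) c2" "deg_le (0 - int m3) c3" using const[OF w] by blast
      have "c2 = 0" "c3 = 0" using c m2 ms by (auto intro: deg_le_neg)
      then have "(\<chi> k. [:w $ k:]) = c1 *s Q1" using c(1) by simp
      then have "[:w $ k:] = c1 * Q1 $ k" for k by (metis vec_lambda_beta vector_smult_component)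
      moreover have "degree c1 = 0" using c(2) m10 deg_le_iff_degree[of 0 c1] by simp
      ultimately show ?thesis by blast
    qed
    have dQ: "degree (Q1 $ k) = 0" for k using mb_vb(1)[OF mb] m10 deg_le_iff_degree[of 0 "Q1 $ k"] by (simp add: vdeg_le_def)
    obtain w0 where w0: "w0 \<noteq> 0" "\<And>j. j \<le> n \<Longrightarrow> dot (coef_vector n S j) w0 = 0"
      using assoc_subspace_annihilator[OF basis, of "{}" n S] d2 by auto
    obtain k0 where k0: "w0 $ k0 \<noteq> 0" using w0(1) by (auto simp: vec_ext_iff)
    have Qk0: "Q1 $ k0 \<noteq> 0" using repr[OF w0(2)] k0 by (metis mult_zero_right pCons_eq_0_iff)
    \<comment> \<open>If only \<open>Q1\<close> had degree 0, the constant solutions would be the multiples of \<open>Q1\<close>; but there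
      is one that vanishes in an entry where \<open>Q1\<close> does not.\<close>
    obtain w where w: "w \<noteq> 0" "dot (axis k0 1) w = 0" "\<And>j. j \<le> n \<Longrightarrow> dot (coef_vector n S j) w = 0"
      using assoc_subspace_annihilator[OF basis, of "{axis k0 1}" n S] d2 by auto
    have "w $ k0 = 0" using w(2) by (simp add: dot_commute[of "axis k0 1"] dot_axis)
    moreover obtain c where c: "\<And>k. [:w $ k:] = c * Q1 $ k" using repr[OF w(3)] by blast
    ultimately have "c = 0" using Qk0 c[of k0] by simp
    then have "[:w $ k:] = 0" for k using c by simp
    then show False using w(1) by (simp add: vec_ext_iff)
  qed
  obtain L1 L2 L3 where bL: "vbideg_le (int a) (int b - int n + int m1) L1" "vbideg_le (int a) (int b - int n + int m2) L2"
     "vbideg_le (int a) (int b - int n + int m3) L3"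
    and LP: "(\<Sum>k\<in>UNIV. L1 $ k * P $ k) = 0" "(\<Sum>k\<in>UNIV. L2 $ k * P $ k) = 0" "(\<Sum>k\<in>UNIV. L3 $ k * P $ k) = 0"
    and dec: "\<And>C. vbideg_le (2 * int a - 1) (int b - 1) C \<Longrightarrow> (\<Sum>k\<in>UNIV. C $ k * P $ k) = 0 \<Longrightarrow>
        (\<exists>\<beta> \<alpha>1 \<alpha>2 \<alpha>3. bideg_le (2 * int a - 1) (int b - 1 - int n) \<beta> \<and> bideg_le (int a - 1) (int n - int m1 - 1) \<alpha>1 \<and>
           bideg_le (int a - 1) (int n - int m2 - 1) \<alpha>2 \<and> bideg_le (int a - 1) (int n - int m3 - 1) \<alpha>3 \<and>
           C = comb4 Sx L1 L2 L3 \<beta> \<alpha>1 \<alpha>2 \<alpha>3)"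
    and inj: "\<And>\<beta> \<alpha>1 \<alpha>2 \<alpha>3. degree \<alpha>1 < a \<Longrightarrow> degree \<alpha>2 < a \<Longrightarrow> degree \<alpha>3 < a \<Longrightarrow>
        comb4 Sx L1 L2 L3 \<beta> \<alpha>1 \<alpha>2 \<alpha>3 = 0 \<Longrightarrow> \<beta> = 0 \<and> \<alpha>1 = 0 \<and> \<alpha>2 = 0 \<and> \<alpha>3 = 0"
    using koszul_lifts[OF a bP fib inf PS Sx0 mb bn] by blast
  have hL: "\<exists>T. T \<in> syz p \<inter> bihom4 (int a) d \<and> (\<forall>k. dehom (T $ k) = L $ k)"
    if L: "vbideg_le (int a) d L" "(\<Sum>k\<in>UNIV. L $ k * P $ k) = 0" for L d
  proof -
    obtain T where T: "T \<in> bihom4 (int a) d" "\<forall>k. dehom (T $ k) = L $ k" using homogenize_vec[OF L(1)] by blast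
    have "(\<Sum>k\<in>UNIV. dehom (T $ k) * dehom (p $ k)) = 0" using L(2) T(2) by (simp add: P_def)
    then have "T \<in> syz p" using syz_iff_dehom[OF T(1) p] by blast
    then show ?thesis using T by blast
  qed
  obtain T1 where T1: "T1 \<in> syz p \<inter> bihom4 (int a) (int b - int n + int m1)" "\<And>k. dehom (T1 $ k) = L1 $ k"
    using hL[OF bL(1) LP(1)] by blast
  obtain T2 where T2: "T2 \<in> syz p \<inter> bihom4 (int a) (int b - int n + int m2)" "\<And>k. dehom (T2 $ k) = L2 $ k"
    using hL[OF bL(2) LP(2)] by blast
  obtain T3 where T3: "T3 \<in> syz p \<inter> bihom4 (int a) (int b - int n + int m3)" "\<And>k. dehom (T3 $ k) = L3 $ k"
    using hL[OF bL(3) LP(3)] by blast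
  define T where "T = (\<lambda>k::nat. if k = 0 then S else if k = 1 then T1 else if k = 2 then T2 else T3)"
  define m where "m = (\<lambda>k::nat. if k = 1 then m1 else if k = 2 then m2 else m3)"
  have Tv: "T 0 = S" "T 1 = T1" "T 2 = T2" "T 3 = T3" and mv: "m 1 = m1" "m 2 = m2" "m 3 = m3"
    by (simp_all add: T_def m_def)
  let ?cs = "cofactor_deg1 (int a)" and ?cu = "cofactor_deg2 (int b) (int n) (\<lambda>k. int (m k))"
  have cv: "?cs 0 = 2 * int a - 1" "?cs 1 = int a - 1" "?cs 2 = int a - 1" "?cs 3 = int a - 1"
    "?cu 0 = int b - 1 - int n" "?cu 1 = int n - int m1 - 1" "?cu 2 = int n - int m2 - 1" "?cu 3 = int n - int m3 - 1"
    by (simp_all add: cofactor_deg1_def cofactor_deg2_def m_def)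
  have dehT: "dehom ((\<Sum>k<4. f k *s T k) $ i) = comb4 Sx L1 L2 L3 (dehom (f 0)) (dehom (f 1)) (dehom (f 2)) (dehom (f 3)) $ i" for f i
    by (simp only: sum_lessThan_4 Tv vector_add_component vector_smult_component dehom.hom_add dehom.hom_mult Sx T1(2) T2(2) T3(2) comb4_def vec_lambda_beta)
  have fT: "(\<Sum>k<4. f k *s T k) \<in> bihom4 (2 * int a - 1) (int b - 1)"
    if f: "\<And>k. k < 4 \<Longrightarrow> f k \<in> bihom (?cs k) (?cu k)" for f
    unfolding bihom4_def
  proof (intro CollectI allI)
    fix i
    have f': "f 0 \<in> bihom (2 * int a - 1) (int b - 1 - int n)" "f 1 \<in> bihom (int a - 1) (int n - int m1 - 1)"
      "f 2 \<in> bihom (int a - 1) (int n - int m2 - 1)" "f 3 \<in> bihom (int a - 1) (int n - int m3 - 1)"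
      using f[of 0] f[of 1] f[of 2] f[of 3] unfolding cv by simp_all
    have Ti: "T1 $ i \<in> bihom (int a) (int b - int n + int m1)" "T2 $ i \<in> bihom (int a) (int b - int n + int m2)"
      "T3 $ i \<in> bihom (int a) (int b - int n + int m3)" using T1(1) T2(1) T3(1) by (simp_all add: bihom4_def)
    have "f 0 * S $ i \<in> bihom (2 * int a - 1) (int b - 1)"
      using bihom_mult[OF f'(1) Sk[of i]] by simp
    moreover have "f 1 * T1 $ i \<in> bihom (2 * int a - 1) (int b - 1)"
      using bihom_mult[OF f'(2) Ti(1)] by (simp add: algebra_simps)
    moreover have "f 2 * T2 $ i \<in> bihom (2 * int a - 1) (int b - 1)"
      using bihom_mult[OF f'(3) Ti(2)] by (simp add: algebra_simps)
    moreover have "f 3 * T3 $ i \<in> bihom (2 * int a - 1) (int b - 1)"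
      using bihom_mult[OF f'(4) Ti(3)] by (simp add: algebra_simps)
    ultimately show "(\<Sum>k<4. f k *s T k) $ i \<in> bihom (2 * int a - 1) (int b - 1)"
      unfolding sum_lessThan_4 Tv by (simp add: bihom_add)
  qed
  have gen: "\<exists>f. (\<forall>k<4. f k \<in> bihom (?cs k) (?cu k)) \<and> C = (\<Sum>k<4. f k *s T k)"
    if C: "C \<in> syz p \<inter> bihom4 (2 * int a - 1) (int b - 1)" for C
  proof -
    have Ck: "C $ k \<in> bihom (2 * int a - 1) (int b - 1)" for k using C by (simp add: bihom4_def)
    define D where "D = (\<chi> k. dehom (C $ k))"
    have "vbideg_le (2 * int a - 1) (int b - 1) D" unfolding vbideg_le_def D_def using bideg_le_dehom[OF Ck] by simp
    moreover have "(\<Sum>k\<in>UNIV. D $ k * P $ k) = 0"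
      using syz_iff_dehom[of C _ _ p "int a" "int b"] C p by (auto simp: D_def P_def)
    ultimately obtain \<beta> \<alpha>1 \<alpha>2 \<alpha>3 where b: "bideg_le (2 * int a - 1) (int b - 1 - int n) \<beta>" "bideg_le (int a - 1) (int n - int m1 - 1) \<alpha>1"
      "bideg_le (int a - 1) (int n - int m2 - 1) \<alpha>2" "bideg_le (int a - 1) (int n - int m3 - 1) \<alpha>3"
      and D: "D = comb4 Sx L1 L2 L3 \<beta> \<alpha>1 \<alpha>2 \<alpha>3" using dec by blast
    obtain f0 f1 f2 f3 where f: "f0 \<in> bihom (2 * int a - 1) (int b - 1 - int n)" "dehom f0 = \<beta>"
      "f1 \<in> bihom (int a - 1) (int n - int m1 - 1)" "dehom f1 = \<alpha>1"
      "f2 \<in> bihom (int a - 1) (int n - int m2 - 1)" "dehom f2 = \<alpha>2"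
      "f3 \<in> bihom (int a - 1) (int n - int m3 - 1)" "dehom f3 = \<alpha>3"
      using homogenize[OF b(1)] homogenize[OF b(2)] homogenize[OF b(3)] homogenize[OF b(4)] by blast
    define f where "f = (\<lambda>k::nat. if k = 0 then f0 else if k = 1 then f1 else if k = 2 then f2 else f3)"
    have fv: "f 0 = f0" "f 1 = f1" "f 2 = f2" "f 3 = f3" by (simp_all add: f_def)
    have fb: "f k \<in> bihom (?cs k) (?cu k)" if "k < 4" for k
      using less_4_cases[OF that] by (elim disjE) (simp_all only: fv cv f)
    have "C = (\<Sum>k<4. f k *s T k)"
    proof (rule vec_ext_iff[THEN iffD2], intro allI)
      fix i
      show "C $ i = (\<Sum>k<4. f k *s T k) $ i"
      proof (rule dehom_eqI[OF Ck])
        show "(\<Sum>k<4. f k *s T k) $ i \<in> bihom (2 * int a - 1) (int b - 1)"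
          using fT[of f, OF fb] by (simp add: bihom4_def)
        have "dehom (C $ i) = D $ i" by (simp add: D_def)
        then show "dehom (C $ i) = dehom ((\<Sum>k<4. f k *s T k) $ i)" by (simp only: D dehT fv f)
      qed
    qed
    then show ?thesis using fb by blast
  qed
  have uniq: "\<forall>k<4. f k = 0" if f: "\<And>k. k < 4 \<Longrightarrow> f k \<in> bihom (?cs k) (?cu k)" and z: "(\<Sum>k<4. f k *s T k) = 0" for f
  proof -
    have "comb4 Sx L1 L2 L3 (dehom (f 0)) (dehom (f 1)) (dehom (f 2)) (dehom (f 3)) = 0"
      using dehT[of f] z by (simp add: vec_ext_iff)
    moreover have "degree (dehom (f k)) < a" if "k \<in> {1, 2, 3}" for k
    proof -
      have "f k \<in> bihom (int (a - 1)) (?cu k)" using f[of k] that a by (auto simp: cofactor_deg1_def of_nat_diff)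
      then have "degree (dehom (f k)) \<le> a - 1" by (intro bideg_le_degree[OF bideg_le_dehom])
      then show ?thesis using a by simp
    qed
    ultimately have "dehom (f 0) = 0" "dehom (f 1) = 0" "dehom (f 2) = 0" "dehom (f 3) = 0"
      using inj[of "dehom (f 1)" "dehom (f 2)" "dehom (f 3)" "dehom (f 0)"] by auto
    then have "dehom (f k) = 0" if "k < 4" for k using less_4_cases[OF that] by auto
    then show ?thesis using dehom_inj f by blast
  qed
  have m12: "m 1 = 0 \<and> m 2 = 0" if "KR.dim (assoc_subspace p n S) \<le> 2"
    using m1 m2 that unfolding mv by simp
  have Tb: "T k \<in> syz p \<inter> bihom4 (int a) (int b - int n + int (m k))" if "k \<in> {1, 2, 3}" for k
    using that T1(1) T2(1) T3(1) by (elim insertE emptyE) (simp_all only: Tv mv)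
  have msum: "m 1 + m 2 + m 3 = n" unfolding mv by (rule ms(3))
  have m1': "m 1 = 0" if "KR.dim (assoc_subspace p n S) \<le> 3" unfolding mv by (rule m1[OF that])
  have "strand_generators p (int a) (int b) (int n) T m"
    unfolding strand_generators_def using Tb gen uniq by blast
  then show ?thesis using Tv(1) msum m1' m12 by blast
qed

theorem mainTheorem1:
  fixes a b n :: nat
    and U :: "'k::alg_closed_field R set"
    and p S :: "'k R ^ 4"
  assumes "a \<ge> 1" and "b \<ge> 1"
    and "U \<subseteq> bihom (int a) (int b)"
    and "KR.ordered_basis [p $ 0, p $ 1, p $ 2, p $ 3] U"
    and "basepoint_free p"
    and "S \<in> syz p \<inter> bihom4 0 (int n)" and "S \<noteq> 0"
    and "\<forall>m<n. \<not> (\<exists>T \<in> syz p \<inter> bihom4 0 (int m). T \<noteq> 0)"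
    and "int b \<ge> 2 * int n - 1"
  shows
    "(KR.dim (assoc_subspace p n S) = 2 \<longrightarrow>
       (\<exists>S1 S2.
          S1 \<in> syz p \<inter> bihom4 (int a) (int b - int n) \<and>
          S2 \<in> syz p \<inter> bihom4 (int a) (int b - int n) \<and>
          KR4.dim (RR4.span {S, S1, S2} \<inter> bihom4 (2 * int a - 1) (int b - 1)) = 2 * a * b \<and>
          determines_d1 p (2 * int a - 1) (int b - 1) {S, S1, S2})) \<and>
     (KR.dim (assoc_subspace p n S) = 3 \<longrightarrow>
       (\<exists>S1 S2 S3. \<exists>\<mu>::int.
          S1 \<in> syz p \<inter> bihom4 (int a) (int b - int n) \<and>
          S2 \<in> syz p \<inter> bihom4 (int a) (int b - int n + \<mu>) \<and>
          S3 \<in> syz p \<inter> bihom4 (int a) (int b - \<mu>) \<and>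
          KR4.dim (RR4.span {S, S1, S2, S3} \<inter> bihom4 (2 * int a - 1) (int b - 1)) = 2 * a * b \<and>
          determines_d1 p (2 * int a - 1) (int b - 1) {S, S1, S2, S3})) \<and>
     (KR.dim (assoc_subspace p n S) = 4 \<longrightarrow>
       (\<exists>S1 S2 S3. \<exists>\<mu>1 \<mu>2::int.
          S1 \<in> syz p \<inter> bihom4 (int a) (int b - int n + \<mu>1) \<and>
          S2 \<in> syz p \<inter> bihom4 (int a) (int b - int n + \<mu>2) \<and>
          S3 \<in> syz p \<inter> bihom4 (int a) (int b - \<mu>1 - \<mu>2) \<and>
          KR4.dim (RR4.span {S, S1, S2, S3} \<inter> bihom4 (2 * int a - 1) (int b - 1)) = 2 * a * b \<and>
          determines_d1 p (2 * int a - 1) (int b - 1) {S, S1, S2, S3})) \<and>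
     (\<exists>F. implicit_equation p F) \<and>
     (\<exists>M \<in> carrier_mat (2 * a * b) (2 * a * b). d1_matrix p (2 * int a - 1) (int b - 1) M) \<and>
     (\<forall>F. \<forall>M \<in> carrier_mat (2 * a * b) (2 * a * b).
        implicit_equation p F \<and> d1_matrix p (2 * int a - 1) (int b - 1) M \<longrightarrow>
        (\<exists>r k. r \<noteq> 0 \<and> k > 0 \<and> Determinant.det M = const_mp r * F ^ k))"
proof -
  note bpf = \<open>basepoint_free p\<close>
  have p: "p \<in> bihom4 (int a) (int b)"
    unfolding bihom4_def
  proof (intro CollectI allI)
    fix i :: 4
    have "i \<in> {0, 1, 2, 3}" using exhaust_4[of i] by auto
    then have "p $ i \<in> set [p $ 0, p $ 1, p $ 2, p $ 3]" by auto
    then have "p $ i \<in> KR.span (set [p $ 0, p $ 1, p $ 2, p $ 3])" by (rule KR.span_base)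
    then show "p $ i \<in> bihom (int a) (int b)" using assms(3,4) unfolding KR.ordered_basis_def by blast
  qed
  have bn: "2 * int n - 1 \<le> int b" using assms(9) by simp
  then have nb: "n \<le> b" using assms(2) by linarith
  obtain T m where T0: "T 0 = S" and ms: "m 1 + m 2 + m 3 = n"
    and d3: "KR.dim (assoc_subspace p n S) \<le> 3 \<longrightarrow> m 1 = 0"
    and d2: "KR.dim (assoc_subspace p n S) \<le> 2 \<longrightarrow> m 1 = 0 \<and> m 2 = 0"
    and str: "strand_generators p (int a) (int b) (int n) T m"
    using syzygy_structure[OF assms(1) p bpf assms(4,6,7,8) bn] by blast
  let ?cs = "cofactor_deg1 (int a)" and ?cu = "cofactor_deg2 (int b) (int n) (\<lambda>k. int (m k))"
  have Tk: "T k \<in> syz p \<inter> bihom4 (int a) (int b - int n + int (m k))" if "k \<in> {1, 2, 3}" for k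
    using str that unfolding strand_generators_def by blast
  have gen': "\<exists>f. (\<forall>k<4. f k \<in> bihom (?cs k) (?cu k)) \<and> C = (\<Sum>k<4. f k *s T k)"
    if "C \<in> syz p \<inter> bihom4 (2 * int a - 1) (int b - 1)" for C
    using str that unfolding strand_generators_def by blast
  have uniq: "\<forall>k<4. f k = 0" if "\<And>k. k < 4 \<Longrightarrow> f k \<in> bihom (?cs k) (?cu k)" "(\<Sum>k<4. f k *s T k) = 0" for f
    using str that unfolding strand_generators_def by blast
  define Syz where "Syz = syz p \<inter> bihom4 (2 * int a - 1) (int b - 1)"
  note gen = gen'[folded Syz_def]
  have Tsyz: "T k \<in> syz p" if "k < 4" for k
  proof -
    have "k = 0 \<or> k \<in> {1, 2, 3}" using that by auto
    then show ?thesis using Tk T0 assms(6) by auto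
  qed
  have inSyz: "(\<Sum>k<4. f k *s T k) \<in> Syz" if f: "\<And>k. k < 4 \<Longrightarrow> f k \<in> bihom (?cs k) (?cu k)" for f
  proof -
    have sz: "(\<Sum>k<4. f k *s T k) \<in> syz p"
      by (intro RR4.subspace_sum[OF syz_submodule] RR4.subspace_scale[OF syz_submodule] Tsyz) simp
    have "(f k *s T k) $ i \<in> bihom (2 * int a - 1) (int b - 1)" if k: "k < 4" for k i
    proof (cases "k = 0")
      case True
      have "S $ i \<in> bihom 0 (int n)" using assms(6) by (simp add: bihom4_def)
      from bihom_mult[OF f[OF k] this] show ?thesis using True T0 by (simp add: cofactor_deg1_def cofactor_deg2_def)
    next
      case False
      then have "k \<in> {1, 2, 3}" using k by auto
      then have "T k $ i \<in> bihom (int a) (int b - int n + int (m k))" using Tk[of k] by (simp add: bihom4_def)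
      from bihom_mult[OF f[OF k] this] show ?thesis using False by (simp add: cofactor_deg1_def cofactor_deg2_def algebra_simps)
    qed
    then have "(\<Sum>k<4. f k *s T k) \<in> bihom4 (2 * int a - 1) (int b - 1)"
      unfolding bihom4_def by (auto intro!: bihom_sum)
    then show ?thesis using sz by (simp add: Syz_def)
  qed
  obtain es where es: "KR4.ordered_basis es Syz" "length es = (\<Sum>k<4. nat (?cs k + 1) * nat (?cu k + 1))"
  proof -
    have "\<exists>es. KR4.ordered_basis es Syz \<and> length es = (\<Sum>k<4. nat (?cs k + 1) * nat (?cu k + 1))"
    proof (rule four_component_basis[where T = T])
      show "KR4.subspace Syz" unfolding Syz_def by (rule syz_comp_subspace)
    qed (use uniq inSyz gen in blast)+
    then show ?thesis using that by blast
  qed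
  have len: "length es = 2 * a * b"
  proof -
    have "nat (?cs 0 + 1) = 2 * a" "nat (?cs 1 + 1) = a" "nat (?cs 2 + 1) = a" "nat (?cs 3 + 1) = a"
      "nat (?cu 0 + 1) = b - n" "nat (?cu 1 + 1) = m 2 + m 3" "nat (?cu 2 + 1) = m 1 + m 3" "nat (?cu 3 + 1) = m 1 + m 2"
      using ms nb by (auto simp: cofactor_deg1_def cofactor_deg2_def)
    then have "length es = 2 * a * (b - n) + a * (m 2 + m 3) + a * (m 1 + m 3) + a * (m 1 + m 2)"
      unfolding es(2) sum_lessThan_4 by simp
    also have "\<dots> = 2 * a * (b - n) + 2 * a * (m 1 + m 2 + m 3)" by (simp add: algebra_simps)
    also have "\<dots> = 2 * a * ((b - n) + n)" unfolding ms by (simp add: distrib_left)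
    finally show ?thesis using nb by simp
  qed
  have dim: "KR4.dim Syz = 2 * a * b"
  proof -
    have "KR4.dim (KR4.span (set es)) = card (set es)"
      using es(1) by (intro KR4.dim_span_eq_card_independent) (simp add: KR4.ordered_basis_def)
    moreover have "KR4.span (set es) = Syz" "distinct es" using es(1) by (simp_all add: KR4.ordered_basis_def)
    ultimately show ?thesis using distinct_card[of es] len by (simp only:)
  qed
  have det: "KR4.dim (RR4.span X \<inter> bihom4 (2 * int a - 1) (int b - 1)) = 2 * a * b \<and>
      determines_d1 p (2 * int a - 1) (int b - 1) X"
    if X: "X \<subseteq> syz p" "Syz \<subseteq> RR4.span X" for X
  proof -
    have "RR4.span X \<subseteq> syz p" by (rule RR4.span_minimal[OF X(1) syz_submodule])
    then have "RR4.span X \<inter> bihom4 (2 * int a - 1) (int b - 1) = Syz" using X(2) by (auto simp: Syz_def)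
    then show ?thesis using dim by (simp add: determines_d1_def Syz_def)
  qed
  have span4: "Syz \<subseteq> RR4.span {S, T 1, T 2, T 3}"
  proof
    fix C assume "C \<in> Syz"
    then obtain f where "C = (\<Sum>k<4. f k *s T k)" using gen by blast
    then show "C \<in> RR4.span {S, T 1, T 2, T 3}"
      unfolding sum_lessThan_4 T0 by (auto intro!: RR4.span_add RR4.span_scale intro: RR4.span_base)
  qed
  have syz4: "{S, T 1, T 2, T 3} \<subseteq> syz p" using Tsyz[of 1] Tsyz[of 2] Tsyz[of 3] assms(6) by simp
  have case2: "\<exists>S1 S2.
          S1 \<in> syz p \<inter> bihom4 (int a) (int b - int n) \<and>
          S2 \<in> syz p \<inter> bihom4 (int a) (int b - int n) \<and>
          KR4.dim (RR4.span {S, S1, S2} \<inter> bihom4 (2 * int a - 1) (int b - 1)) = 2 * a * b \<and>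
          determines_d1 p (2 * int a - 1) (int b - 1) {S, S1, S2}" if "KR.dim (assoc_subspace p n S) = 2"
  proof -
    have m0: "m 1 = 0" "m 2 = 0" using d2 that by auto
    have "Syz \<subseteq> RR4.span {S, T 1, T 2}"
    proof
      fix C assume "C \<in> Syz"
      then obtain f where f: "\<And>k. k < 4 \<Longrightarrow> f k \<in> bihom (?cs k) (?cu k)" "C = (\<Sum>k<4. f k *s T k)" using gen by blast
      \<comment> \<open>Now \<open>m 3 = n\<close>, so the coefficient of \<open>T 3\<close> has degree \<open>-1\<close> in \<open>u, v\<close>.\<close>
      have "?cu 3 < 0" using m0 ms by (simp add: cofactor_deg2_def)
      then have "f 3 = 0" using bihom_neg f(1)[of 3] by auto
      then show "C \<in> RR4.span {S, T 1, T 2}"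
        unfolding f(2) sum_lessThan_4 T0 by (auto intro!: RR4.span_add RR4.span_scale intro: RR4.span_base)
    qed
    moreover have "{S, T 1, T 2} \<subseteq> syz p" using syz4 by blast
    ultimately have "KR4.dim (RR4.span {S, T 1, T 2} \<inter> bihom4 (2 * int a - 1) (int b - 1)) = 2 * a * b \<and>
        determines_d1 p (2 * int a - 1) (int b - 1) {S, T 1, T 2}" by (intro det)
    moreover have "T 1 \<in> syz p \<inter> bihom4 (int a) (int b - int n)" "T 2 \<in> syz p \<inter> bihom4 (int a) (int b - int n)"
      using Tk[of 1] Tk[of 2] m0 by simp_all
    ultimately show ?thesis by blast
  qed
  have case3: "\<exists>S1 S2 S3. \<exists>\<mu>::int.
          S1 \<in> syz p \<inter> bihom4 (int a) (int b - int n) \<and>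
          S2 \<in> syz p \<inter> bihom4 (int a) (int b - int n + \<mu>) \<and>
          S3 \<in> syz p \<inter> bihom4 (int a) (int b - \<mu>) \<and>
          KR4.dim (RR4.span {S, S1, S2, S3} \<inter> bihom4 (2 * int a - 1) (int b - 1)) = 2 * a * b \<and>
          determines_d1 p (2 * int a - 1) (int b - 1) {S, S1, S2, S3}" if "KR.dim (assoc_subspace p n S) = 3"
  proof -
    have m0: "m 1 = 0" using d3 that by auto
    then have e: "int b - int n + int (m 3) = int b - int (m 2)" using ms by linarith
    have "T 1 \<in> syz p \<inter> bihom4 (int a) (int b - int n)" "T 2 \<in> syz p \<inter> bihom4 (int a) (int b - int n + int (m 2))"
      "T 3 \<in> syz p \<inter> bihom4 (int a) (int b - int (m 2))"
      using Tk[of 1] Tk[of 2] Tk[of 3, unfolded e] m0 by simp_all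
    then show ?thesis using det[OF syz4 span4] by blast
  qed
  have case4: "\<exists>S1 S2 S3. \<exists>\<mu>1 \<mu>2::int.
          S1 \<in> syz p \<inter> bihom4 (int a) (int b - int n + \<mu>1) \<and>
          S2 \<in> syz p \<inter> bihom4 (int a) (int b - int n + \<mu>2) \<and>
          S3 \<in> syz p \<inter> bihom4 (int a) (int b - \<mu>1 - \<mu>2) \<and>
          KR4.dim (RR4.span {S, S1, S2, S3} \<inter> bihom4 (2 * int a - 1) (int b - 1)) = 2 * a * b \<and>
          determines_d1 p (2 * int a - 1) (int b - 1) {S, S1, S2, S3}"
  proof -
    have e: "int b - int n + int (m 3) = int b - int (m 1) - int (m 2)" using ms by linarith
    have "T 1 \<in> syz p \<inter> bihom4 (int a) (int b - int n + int (m 1))" "T 2 \<in> syz p \<inter> bihom4 (int a) (int b - int n + int (m 2))"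
      "T 3 \<in> syz p \<inter> bihom4 (int a) (int b - int (m 1) - int (m 2))"
      using Tk[of 1] Tk[of 2] Tk[of 3, unfolded e] by simp_all
    then show ?thesis using det[OF syz4 span4] by blast
  qed
  have size: "nat (2 * int a - 1 + 1) * nat (int b - 1 + 1) = 2 * a * b"
    by (simp add: nat_mult_distrib)
  obtain M0 where M0: "M0 \<in> carrier_mat (2 * a * b) (2 * a * b)" "d1_matrix p (2 * int a - 1) (int b - 1) M0"
    using d1_matrix_exists[OF es(1)[unfolded Syz_def] p] unfolding size len by blast
  have "\<exists>F. implicit_equation p F"
    by (rule implicit_equation_exists[OF assms(1,2) p bpf dim[unfolded Syz_def] M0])
  moreover have "\<exists>r k. r \<noteq> 0 \<and> k > 0 \<and> Determinant.det M = const_mp r * F ^ k"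
    if "M \<in> carrier_mat (2 * a * b) (2 * a * b)" "implicit_equation p F" "d1_matrix p (2 * int a - 1) (int b - 1) M" for F M
    by (rule det_power_of_implicit_equation[OF assms(1,2) p bpf dim[unfolded Syz_def] that(1,3,2)])
  ultimately show ?thesis using case2 case3 case4 M0 by blast
qed

end
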